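(* Let $\Omega\subseteq\mathbb{C}$ be an open set and let $(L_n)_{n\ge 1}$ be an increasing sequence of compact subsets of $\overline{\Omega}$ such that: (a) $\overline{L_n\cap\Omega}=L_n$ for every $n$; (b) for every $n$, each connected component of $\{\infty\}\cup(\mathbb{C}\setminus L_n)$ contains a connected component of $\{\infty\}\cup(\mathbb{C}\setminus\overline{\Omega})$; (c) every compact subset of $\Omega$ is contained in some $L_n$. Let $Y^\infty(\Omega)$ be the associated Fréchet space (defined in the context). Let $(K_r)_{r\ge 1}$ be a sequence of compact subsets of $\mathbb{C}$ with $K_r\cap L_n=\emptyset$ for all $r,n$. Let $F\subset\mathbb{N}_0\times\mathbb{N}_0$ be a set containing a sequence $(\tilde p_n,\tilde q_n)_{n\ge1}$ with $\tilde p_n\to+\infty$ and $\tilde q_n\to+\infty$. Then there exists a function $f\in Y^\infty(\Omega)$ such that for every rational function $h$ and every member $K_s$ of the sequence $(K_r)$ there exists a sequence $(p_n,q_n)\in F$, $n=1,2,\dots$, with the following property: for every $m\ge 1$ there exists $n(m)$ such that (i) $f\in\mathcal{D}_{p_n,q_n}(\zeta)\cap E_{p_n,q_n,\zeta}(K_s\cup L_m)$ for every $\zeta\in L_m$ and every $n\ge n(m)$; (ii) for every $\ell\in\mathbb{N}_0$, $\sup_{\zeta\in L_m}\sup_{z\in L_m}\big|[f;p_n/q_n]_\zeta^{(\ell)}(z)-f^{(\ell)}(z)\big|\to0$ as $n\to+\infty$; (iii) $\sup_{\zeta\in L_m}\sup_{z\in K_s}\chi\big([f;p_n/q_n]_\zeta(z),h(z)\big)\to0$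 as $n\to+\infty$. Moreover, the set of such functions $f$ is dense and $G_\delta$ in $Y^\infty(\Omega)$.
   Context: Notation: $\mathbb{N}_0=\{0,1,2,\dots\}$; closures of subsets of $\mathbb{C}$ are taken in $\mathbb{C}$; $H(\Omega)$ is the set of holomorphic functions on $\Omega$; $\{\infty\}\cup(\mathbb{C}\setminus A)$ is viewed as a subset of the Riemann sphere $\mathbb{C}\cup\{\infty\}$. Chordal metric on $\mathbb{C}\cup\{\infty\}$: $\chi(a,b)=\frac{|a-b|}{\sqrt{1+|a|^2}\sqrt{1+|b|^2}}$ for $a,b\in\mathbb{C}$, $\chi(a,\infty)=\frac{1}{\sqrt{1+|a|^2}}$ for $a\in\mathbb{C}$, $\chi(\infty,\infty)=0$. Rational functions are regarded as maps into $\mathbb{C}\cup\{\infty\}$. Function spaces: $T^\infty(\Omega)=T^\infty(\Omega,(L_n))$ is the space of all $f\in H(\Omega)$ such that for every $\ell\in\mathbb{N}_0$ and every $n$ the restriction $f^{(\ell)}|_{L_n\cap\Omega}$ is uniformly continuous; hence $f^{(\ell)}$ extends continuously to $\overline{L_n\cap\Omega}=L_n$, and the extension is still denoted $f^{(\ell)}$. It is a Fréchet space with the seminorms $\sup_{z\in L_n}|f^{(\ell)}(z)|$, $\ell\in\mathbb{N}_0$, $n\ge1$. $Y^\infty(\Omega)$ is the closure in $T^\infty(\Omega)$ of the set of rational functions with poles off $\bigcup_n L_n$, with the induced topology. Padé approximants: let $\sum_{n\ge0}a_n(z-\zeta)^n$ be a (formal) power series; for $f\in T^\infty(\Omega)$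 and $\zeta\in\bigcup_n L_n$ one takes $a_n=f^{(n)}(\zeta)/n!$ (using the continuous extensions when $\zeta\in\partial\Omega$), and $a_i=0$ for $i<0$. For $p,q\in\mathbb{N}_0$ the Padé approximant $[f;p/q]_\zeta$ is a rational function $A/B$ with $\deg A\le p$, $\deg B\le q$, $B(\zeta)\ne0$, whose Taylor coefficients at $\zeta$ of orders $0,\dots,p+q$ are $a_0,\dots,a_{p+q}$. One writes $f\in\mathcal{D}_{p,q}(\zeta)$ if $q=0$, or if $q\ge1$ and the $q\times q$ Hankel determinant $\det(a_{p-q+i+j-1})_{1\le i,j\le q}$ is non-zero; in that case $[f;p/q]_\zeta$ exists, is unique, and equals $A(f,\zeta)/B(f,\zeta)$ with the Jacobi formulas: $A(f,\zeta)(z)$ and $B(f,\zeta)(z)$ are the $(q+1)\times(q+1)$ determinants whose $i$-th row after the first ($i=1,\dots,q$) is $(a_{p-q+i},a_{p-q+i+1},\dots,a_{p+i})$ and whose first rows are respectively $\big((z-\zeta)^qS_{p-q}(z),(z-\zeta)^{q-1}S_{p-q+1}(z),\dots,S_p(z)\big)$ and $\big((z-\zeta)^q,(z-\zeta)^{q-1},\dots,1\big)$, where $S_k(z)=\sum_{\nu=0}^ka_\nu(z-\zeta)^\nu$ for $k\ge0$ and $S_k=0$ for $k<0$. For a set $K\subset\mathbb{C}$, $f\in E_{p,q,\zeta}(K)$ means that the polynomials $A(f,\zeta)$ and $B(f,\zeta)$ given by the Jacobi formulas have no common zero in $K$. *)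

theory Defs
  imports
    "HOL-Complex_Analysis.Complex_Analysis"
    "HOL-Computational_Algebra.Computational_Algebra"
    "HOL-Computational_Algebra.Field_as_Ring"
    "Jordan_Normal_Form.Determinant"
begin

text \<open>The Riemann sphere is the one-point compactification of the plane; \<^term>\<open>None\<close> is the
  point at infinity.\<close>

abbreviation riemann_sphere :: "complex option topology" where
  "riemann_sphere \<equiv> Alexandroff_compactification euclidean"

definition sphere_compl :: "complex set \<Rightarrow> complex option set" where
  "sphere_compl A = insert None (Some ` (- A))"

definition sphere_components :: "complex option set \<Rightarrow> complex option set set" where
  "sphere_components S = connected_components_of (subtopology riemann_sphere S)"

fun chordal :: "complex option \<Rightarrow> complex option \<Rightarrow> real" where
  "chordal (Some a) (Some b) =
     cmod (a - b) / (sqrt (1 + (cmod a)\<^sup>2) * sqrt (1 + (cmod b)\<^sup>2))"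
| "chordal (Some a) None = 1 / sqrt (1 + (cmod a)\<^sup>2)"
| "chordal None (Some b) = 1 / sqrt (1 + (cmod b)\<^sup>2)"
| "chordal None None = 0"

text \<open>A rational function is an element of the fraction field of the polynomial ring.
  \<^const>\<open>quot_of_fract\<close> returns a coprime pair, so the zeros of the denominator are exactly the
  poles. The value of \<open>rat_fun\<close> at a pole carries no meaning.\<close>

type_synonym ratfun = "complex poly fract"

definition is_rat_pole :: "ratfun \<Rightarrow> complex \<Rightarrow> bool" where
  "is_rat_pole R z \<longleftrightarrow> poly (snd (quot_of_fract R)) z = 0"

definition rat_fun :: "ratfun \<Rightarrow> complex \<Rightarrow> complex" where
  "rat_fun R z = poly (fst (quot_of_fract R)) z / poly (snd (quot_of_fract R)) z"

definition rat_sphere :: "ratfun \<Rightarrow> complex \<Rightarrow> complex option" where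
  "rat_sphere R z = (if is_rat_pole R z then None else Some (rat_fun R z))"

text \<open>Functions on \<open>\<Omega>\<close> are represented by extensional functions (those equal to
  \<^term>\<open>undefined\<close> off \<open>\<Omega>\<close>), so that equality in the space is equality on \<open>\<Omega>\<close>.\<close>

definition T_space :: "complex set \<Rightarrow> (nat \<Rightarrow> complex set) \<Rightarrow> (complex \<Rightarrow> complex) set" where
  "T_space \<Omega> L = {f \<in> extensional \<Omega>. f holomorphic_on \<Omega> \<and>
     (\<forall>l n. uniformly_continuous_on (L n \<inter> \<Omega>) ((deriv ^^ l) f))}"

text \<open>The continuous extension of the \<open>l\<close>-th derivative to the union of the \<open>L n\<close>. Off \<open>\<Omega>\<close>
  the limits have to be taken inside the sets \<open>L n \<inter> \<Omega>\<close>, because a limit inside \<open>\<Omega>\<close> need not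
  exist; since \<open>L\<close> is increasing, the limit is the same for all \<open>n\<close> with \<open>z \<in> L n\<close>. On \<open>\<Omega>\<close> no
  limit is taken, because \<open>L n \<inter> \<Omega>\<close> may have isolated points.\<close>

definition deriv_ext ::
  "complex set \<Rightarrow> (nat \<Rightarrow> complex set) \<Rightarrow> (complex \<Rightarrow> complex) \<Rightarrow> nat \<Rightarrow> complex \<Rightarrow> complex" where
  "deriv_ext \<Omega> L f l z =
     (if z \<in> \<Omega> then (deriv ^^ l) f z
      else (THE v. \<forall>n. z \<in> L n \<longrightarrow> ((deriv ^^ l) f \<longlongrightarrow> v) (at z within (L n \<inter> \<Omega>))))"

text \<open>Suprema are taken in \<^typ>\<open>ennreal\<close>, where the supremum over the empty set is \<open>0\<close>.\<close>

definition T_seminorm ::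
  "complex set \<Rightarrow> (nat \<Rightarrow> complex set) \<Rightarrow> nat \<Rightarrow> nat \<Rightarrow> (complex \<Rightarrow> complex) \<Rightarrow> ennreal" where
  "T_seminorm \<Omega> L l n f = (SUP z\<in>L n. ennreal (cmod (deriv_ext \<Omega> L f l z)))"

definition T_topology ::
  "complex set \<Rightarrow> (nat \<Rightarrow> complex set) \<Rightarrow> (complex \<Rightarrow> complex) topology" where
  "T_topology \<Omega> L = topology_generated_by
     {{g \<in> T_space \<Omega> L. T_seminorm \<Omega> L l n (\<lambda>z. g z - f z) < ennreal e} | f l n e.
        f \<in> T_space \<Omega> L \<and> 0 < e}"

definition Y_space :: "complex set \<Rightarrow> (nat \<Rightarrow> complex set) \<Rightarrow> (complex \<Rightarrow> complex) set" where
  "Y_space \<Omega> L = T_topology \<Omega> L closure_of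
     {restrict (rat_fun R) \<Omega> | R. \<forall>z \<in> (\<Union>n. L n). \<not> is_rat_pole R z}"

definition Y_topology ::
  "complex set \<Rightarrow> (nat \<Rightarrow> complex set) \<Rightarrow> (complex \<Rightarrow> complex) topology" where
  "Y_topology \<Omega> L = subtopology (T_topology \<Omega> L) (Y_space \<Omega> L)"

text \<open>Below, \<open>a\<close> is the coefficient sequence of a power series centred at \<open>\<zeta>\<close>.\<close>

definition coeff_int :: "(nat \<Rightarrow> complex) \<Rightarrow> int \<Rightarrow> complex" where
  "coeff_int a k = (if k < 0 then 0 else a (nat k))"

definition partial_sum :: "(nat \<Rightarrow> complex) \<Rightarrow> complex \<Rightarrow> int \<Rightarrow> complex poly" where
  "partial_sum a \<zeta> k = (if k < 0 then 0 else (\<Sum>\<nu>\<le>nat k. Polynomial.smult (a \<nu>) ([:- \<zeta>, 1:] ^ \<nu>)))"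

definition is_pade :: "(nat \<Rightarrow> complex) \<Rightarrow> complex \<Rightarrow> nat \<Rightarrow> nat \<Rightarrow> ratfun \<Rightarrow> bool" where
  "is_pade a \<zeta> p q R \<longleftrightarrow>
     (\<exists>A B. R = to_fract A / to_fract B \<and> degree A \<le> p \<and> degree B \<le> q \<and> poly B \<zeta> \<noteq> 0 \<and>
        (\<forall>k\<le>p + q. (deriv ^^ k) (\<lambda>z. poly A z / poly B z) \<zeta> / fact k = a k))"

text \<open>Meaningful only if there is exactly one such function, e.g. under \<open>pade_D\<close> below.\<close>

definition pade :: "(nat \<Rightarrow> complex) \<Rightarrow> complex \<Rightarrow> nat \<Rightarrow> nat \<Rightarrow> ratfun" where
  "pade a \<zeta> p q = (THE R. is_pade a \<zeta> p q R)"

text \<open>Matrix indices start at \<open>0\<close> here: in the Hankel determinant the \<open>(i, j)\<close> entry is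
  \<open>a\<^bsub>p-q+(i+1)+(j+1)-1\<^esub>\<close>.\<close>

definition pade_D :: "(nat \<Rightarrow> complex) \<Rightarrow> nat \<Rightarrow> nat \<Rightarrow> bool" where
  "pade_D a p q \<longleftrightarrow> q = 0 \<or>
     Determinant.det (Matrix.mat q q (\<lambda>(i, j).
       coeff_int a (int p - int q + int i + int j + 1))) \<noteq> 0"

definition jacobi_num :: "(nat \<Rightarrow> complex) \<Rightarrow> complex \<Rightarrow> nat \<Rightarrow> nat \<Rightarrow> complex poly" where
  "jacobi_num a \<zeta> p q = Determinant.det (Matrix.mat (q + 1) (q + 1) (\<lambda>(i, j).
     if i = 0 then [:- \<zeta>, 1:] ^ (q - j) * partial_sum a \<zeta> (int p - int q + int j)
     else [: coeff_int a (int p - int q + int i + int j) :]))"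

definition jacobi_den :: "(nat \<Rightarrow> complex) \<Rightarrow> complex \<Rightarrow> nat \<Rightarrow> nat \<Rightarrow> complex poly" where
  "jacobi_den a \<zeta> p q = Determinant.det (Matrix.mat (q + 1) (q + 1) (\<lambda>(i, j).
     if i = 0 then [:- \<zeta>, 1:] ^ (q - j)
     else [: coeff_int a (int p - int q + int i + int j) :]))"

definition pade_E :: "(nat \<Rightarrow> complex) \<Rightarrow> complex \<Rightarrow> nat \<Rightarrow> nat \<Rightarrow> complex set \<Rightarrow> bool" where
  "pade_E a \<zeta> p q K \<longleftrightarrow>
     \<not> (\<exists>z\<in>K. poly (jacobi_num a \<zeta> p q) z = 0 \<and> poly (jacobi_den a \<zeta> p q) z = 0)"

definition taylor_coeff ::
  "complex set \<Rightarrow> (nat \<Rightarrow> complex set) \<Rightarrow> (complex \<Rightarrow> complex) \<Rightarrow> complex \<Rightarrow> nat \<Rightarrow> complex" where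
  "taylor_coeff \<Omega> L f \<zeta> n = deriv_ext \<Omega> L f n \<zeta> / fact n"

text \<open>The distance between the \<open>l\<close>-th derivative of \<open>R\<close> at \<open>z\<close> and the number \<open>w\<close>; it is infinite
  if \<open>R\<close> has a pole at \<open>z\<close>.\<close>

definition rat_deriv_dist :: "ratfun \<Rightarrow> nat \<Rightarrow> complex \<Rightarrow> complex \<Rightarrow> ennreal" where
  "rat_deriv_dist R l z w =
     (if is_rat_pole R z then \<infinity> else ennreal (cmod ((deriv ^^ l) (rat_fun R) z - w)))"

definition pade_universal ::
  "complex set \<Rightarrow> (nat \<Rightarrow> complex set) \<Rightarrow> (nat \<Rightarrow> complex set) \<Rightarrow> (nat \<times> nat) set \<Rightarrow>
     (complex \<Rightarrow> complex) \<Rightarrow> bool" where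
  "pade_universal \<Omega> L K F f \<longleftrightarrow>
     (\<forall>(h :: ratfun) s. \<exists>p q :: nat \<Rightarrow> nat. (\<forall>n. (p n, q n) \<in> F) \<and>
       (\<forall>m. \<exists>N.
         (\<forall>\<zeta>\<in>L m. \<forall>n\<ge>N.
            pade_D (taylor_coeff \<Omega> L f \<zeta>) (p n) (q n) \<and>
            pade_E (taylor_coeff \<Omega> L f \<zeta>) \<zeta> (p n) (q n) (K s \<union> L m)) \<and>
         (\<forall>l. (\<lambda>n. SUP \<zeta>\<in>L m. SUP z\<in>L m.
            rat_deriv_dist (pade (taylor_coeff \<Omega> L f \<zeta>) \<zeta> (p n) (q n)) l z
              (deriv_ext \<Omega> L f l z)) \<longlonglongrightarrow> 0) \<and>
         (\<lambda>n. SUP \<zeta>\<in>L m. SUP z\<in>K s.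
            ennreal (chordal
              (rat_sphere (pade (taylor_coeff \<Omega> L f \<zeta>) \<zeta> (p n) (q n)) z)
              (rat_sphere h z))) \<longlonglongrightarrow> 0))"

end

theory Submission
  imports Defs
begin

text \<open>
  A rational function \<open>A / B\<close> in lowest terms, with \<open>A\<close> of degree exactly \<open>p\<close> and \<open>B\<close> of degree at most
  \<open>q\<close>, is its own Pade approximant of type \<open>(p, q)\<close> at every centre off its poles, with nonvanishing Hankel determinant and coprime Jacobi polynomials. All requirements on
  the approximant are open conditions on finitely many Taylor coefficients, uniformly on compact
  sets of centres, so they persist for every function that is close to this rational function in
  finitely many derivatives on \<open>L N\<close>.

  For the density of the good functions, let \<open>g\<close> be a rational function in the space and \<open>h\<close> a
  rational target on \<open>K s\<close>. Some rational \<open>\<phi>\<close> is close to \<open>g\<close> on \<open>L N\<close> and to \<open>h\<close> on \<open>K s\<close>; adding a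
  small multiple of a high power of \<open>z\<close> gives its numerator degree exactly \<open>p\<close>, for some \<open>(p, q)\<close> in \<open>F\<close>.
  Possibly \<open>\<phi>\<close> has poles in \<open>\<Omega>\<close> (off \<open>L N\<close>), but by Runge's theorem and hypothesis (b) its poles can
  be pushed out of the closure of \<open>\<Omega>\<close> by a change that is small on \<open>L N\<close>, which by stability does not
  spoil the approximants. The theorem then follows from Baire's category theorem, since countably
  many targets \<open>h\<close> suffice.
\<close>

section \<open>Jacobi determinants and the uniqueness of Pade approximants\<close>

text \<open>The function is never controlled on \<open>K s\<close>. An approximant of type
  \<open>(p, q)\<close> depends only on Taylor coefficients of order at most \<open>p + q\<close>,
  so centres in \<open>L N\<close> alone steer it on \<open>K s\<close>; moving poles may change the
  function there at will, while the approximants barely move. The exact numerator degree excludes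
  the defective case: for coprime \<open>A\<close>, \<open>B\<close> with
  \<open>degree A = p\<close>, no nonzero pair of degrees below \<open>p\<close> and
  \<open>q\<close> has the same quotient, which forces a nonzero Hankel determinant. No condition on
  holes links \<open>K s\<close> with \<open>L N\<close>, so polynomials cannot in general join
  \<open>g\<close> to \<open>h\<close>; a rational function close to 1 near one compact set and to 0
  on the other does, and its poles may lie anywhere off both. As \<open>h\<close> may have poles in
  \<open>K s\<close>, estimates there are made in homogeneous coordinates, where \<open>A\<close>
  and \<open>B\<close> vary separately. Universality demands one sequence of types for all
  \<open>L m\<close> and all derivatives; it is encoded by asking, for each \<open>N\<close>, for a
  single type with tolerance \<open>1 / (N + 1)\<close> on \<open>L N\<close> for derivatives up to
  \<open>N\<close>. These conditions are open, and a diagonal choice recovers the sequence because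
  \<open>L\<close> increases.\<close>

abbreviation ratio :: "complex poly \<Rightarrow> complex poly \<Rightarrow> complex \<Rightarrow> complex" where
  "ratio A B \<equiv> \<lambda>z. poly A z / poly B z"

text \<open>The Jacobi numerator, the Jacobi denominator and the orthogonality relations are
  determinants that differ only in row 0. Leaving this row free as \<open>r\<close> lets one Laplace
  expansion serve all three.\<close>

definition jacobi_mat :: "(nat \<Rightarrow> complex) \<Rightarrow> nat \<Rightarrow> nat \<Rightarrow> (nat \<Rightarrow> complex poly) \<Rightarrow> complex poly mat" where
  "jacobi_mat a p q r = Matrix.mat (q + 1) (q + 1) (\<lambda>(i, j).
     if i = 0 then r j else [: coeff_int a (int p - int q + int i + int j) :])"

definition jacobi_cof :: "(nat \<Rightarrow> complex) \<Rightarrow> nat \<Rightarrow> nat \<Rightarrow> nat \<Rightarrow> complex poly" where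
  "jacobi_cof a p q j = cofactor (jacobi_mat a p q (\<lambda>_. 0)) 0 j"

lemma jacobi_mat_carrier: "jacobi_mat a p q r \<in> carrier_mat (q + 1) (q + 1)"
  by (simp add: jacobi_mat_def)

lemma cofactor_jacobi_mat: "cofactor (jacobi_mat a p q r) 0 j = jacobi_cof a p q j" if "j \<le> q"
proof -
  have "mat_delete (jacobi_mat a p q r) 0 j = mat_delete (jacobi_mat a p q (\<lambda>_. 0)) 0 j"
    unfolding mat_delete_def jacobi_mat_def using that by (intro eq_matI) auto
  thus ?thesis by (simp add: jacobi_cof_def cofactor_def)
qed

lemma det_jacobi_mat: "Determinant.det (jacobi_mat a p q r) = (\<Sum>j\<le>q. r j * jacobi_cof a p q j)"
proof -
  have "Determinant.det (jacobi_mat a p q r) =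
      (\<Sum>j<q + 1. jacobi_mat a p q r $$ (0, j) * cofactor (jacobi_mat a p q r) 0 j)"
    by (rule laplace_expansion_row[OF jacobi_mat_carrier]) simp
  also have "\<dots> = (\<Sum>j\<le>q. r j * jacobi_cof a p q j)"
    by (rule sum.cong) (auto simp: cofactor_jacobi_mat, simp add: jacobi_mat_def)
  finally show ?thesis .
qed

lemma degree_jacobi_cof: "j \<le> q \<Longrightarrow> degree (jacobi_cof a p q j) = 0"
proof -
  assume j: "j \<le> q"
  have "degree (Determinant.det (mat_delete (jacobi_mat a p q (\<lambda>_. 0)) 0 j)) \<le> 0 * q"
    by (rule degree_det_le) (auto simp: mat_delete_def jacobi_mat_def)
  moreover have "degree (((- 1) ^ (0 + j)) :: complex poly) = 0"
    by (simp add: degree_power_eq)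
  ultimately show ?thesis
    unfolding jacobi_cof_def cofactor_def
    by (metis bot_nat_0.extremum_uniqueI degree_mult_le mult_zero_left add_0)
qed

text \<open>Row \<open>i\<close> copied into row 0 gives two equal rows. This is the source of the
  vanishing coefficients of orders \<open>p + 1\<close> to \<open>p + q\<close>.\<close>

lemma jacobi_cof_orthogonal:
  assumes "1 \<le> i" "i \<le> q"
  shows "(\<Sum>j\<le>q. [:coeff_int a (int p - int q + int i + int j):] * jacobi_cof a p q j) = 0"
proof -
  let ?r = "\<lambda>j. [:coeff_int a (int p - int q + int i + int j):]"
  have "Determinant.det (jacobi_mat a p q ?r) = 0"
    by (rule det_identical_rows[OF jacobi_mat_carrier, of 0 i])
       (use assms in \<open>auto simp: jacobi_mat_def intro!: eq_vecI\<close>)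
  thus ?thesis by (simp add: det_jacobi_mat)
qed

text \<open>Deleting row 0 and the last column shifts the row index by one and leaves the Hankel
  matrix, so this cofactor is what \<open>pade_D\<close> tests. For \<open>q = 0\<close> the empty
  determinant 1 matches the first disjunct of \<open>pade_D\<close>.\<close>

lemma jacobi_cof_last:
  "jacobi_cof a p q q = [:(-1) ^ q * Determinant.det (Matrix.mat q q (\<lambda>(i, j).
       coeff_int a (int p - int q + int i + int j + 1))):]"
proof -
  interpret to_poly: comm_ring_hom "\<lambda>c::complex. [:c:]"
    by unfold_locales auto
  let ?H = "Matrix.mat q q (\<lambda>(i, j). coeff_int a (int p - int q + int i + int j + 1))"
  have "mat_delete (jacobi_mat a p q (\<lambda>_. 0)) 0 q = map_mat (\<lambda>c. [:c:]) ?H"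
    unfolding mat_delete_def jacobi_mat_def
    by (intro eq_matI) (auto simp: algebra_simps)
  hence "Determinant.det (mat_delete (jacobi_mat a p q (\<lambda>_. 0)) 0 q) = [:Determinant.det ?H:]"
    using to_poly.hom_det[of ?H] by simp
  moreover have "((- 1) ^ q :: complex poly) = [:(-1) ^ q:]"
    by (metis poly_const_pow minus_pCons minus_zero one_poly_eq_simps(1))
  ultimately show ?thesis by (simp add: jacobi_cof_def cofactor_def)
qed

text \<open>All rows except row 0 are constant, hence so are the cofactors along row 0. Read as
  numbers, they turn both Jacobi determinants into linear combinations of known polynomials.\<close>

definition jacobi_weight :: "(nat \<Rightarrow> complex) \<Rightarrow> nat \<Rightarrow> nat \<Rightarrow> nat \<Rightarrow> complex" where
  "jacobi_weight a p q j = poly.coeff (jacobi_cof a p q j) 0"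

lemma jacobi_cof_weight: "j \<le> q \<Longrightarrow> jacobi_cof a p q j = [:jacobi_weight a p q j:]"
  using degree_jacobi_cof[of j q a p] unfolding jacobi_weight_def by (metis degree_0_id)

lemma jacobi_num_weights:
  "jacobi_num a \<zeta> p q = (\<Sum>j\<le>q. Polynomial.smult (jacobi_weight a p q j)
      ([:- \<zeta>, 1:] ^ (q - j) * partial_sum a \<zeta> (int p - int q + int j)))"
proof -
  have "jacobi_num a \<zeta> p q = Determinant.det (jacobi_mat a p q
      (\<lambda>j. [:- \<zeta>, 1:] ^ (q - j) * partial_sum a \<zeta> (int p - int q + int j)))"
    unfolding jacobi_num_def jacobi_mat_def by simp
  thus ?thesis
    unfolding det_jacobi_mat by (auto simp: jacobi_cof_weight intro!: sum.cong)
qed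

lemma jacobi_den_weights:
  "jacobi_den a \<zeta> p q = (\<Sum>j\<le>q. Polynomial.smult (jacobi_weight a p q j) ([:- \<zeta>, 1:] ^ (q - j)))"
proof -
  have "jacobi_den a \<zeta> p q = Determinant.det (jacobi_mat a p q (\<lambda>j. [:- \<zeta>, 1:] ^ (q - j)))"
    unfolding jacobi_den_def jacobi_mat_def by simp
  thus ?thesis
    unfolding det_jacobi_mat by (auto simp: jacobi_cof_weight intro!: sum.cong)
qed

lemma jacobi_weight_orthogonal:
  assumes "1 \<le> i" "i \<le> q"
  shows "(\<Sum>j\<le>q. jacobi_weight a p q j * coeff_int a (int p - int q + int i + int j)) = 0"
proof -
  have "[:\<Sum>j\<le>q. jacobi_weight a p q j * coeff_int a (int p - int q + int i + int j):] =
      (\<Sum>j\<le>q. [:jacobi_weight a p q j * coeff_int a (int p - int q + int i + int j):])"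
    by (rule poly_eqI) (simp add: coeff_sum coeff_pCons split: nat.split)
  also have "\<dots> = (\<Sum>j\<le>q. [:coeff_int a (int p - int q + int i + int j):] * jacobi_cof a p q j)"
    by (rule sum.cong) (auto simp: jacobi_cof_weight mult.commute)
  finally show ?thesis using jacobi_cof_orthogonal[OF assms, of a p] by simp
qed

lemma jacobi_weight_last: "jacobi_weight a p q q \<noteq> 0 \<longleftrightarrow> pade_D a p q"
  using jacobi_cof_last[of a p q] by (auto simp: pade_D_def jacobi_weight_def)

section \<open>Taylor expansions at the centre as formal power series\<close>

definition taylor_fps :: "complex \<Rightarrow> complex poly \<Rightarrow> complex fps" where
  "taylor_fps \<zeta> A = fps_of_poly (A \<circ>\<^sub>p [:\<zeta>, 1:])"

lemma taylor_fps_mult: "taylor_fps \<zeta> (A * B) = taylor_fps \<zeta> A * taylor_fps \<zeta> B"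
  by (simp add: taylor_fps_def pcompose_mult fps_of_poly_mult)

lemma taylor_fps_diff: "taylor_fps \<zeta> (A - B) = taylor_fps \<zeta> A - taylor_fps \<zeta> B"
  by (simp add: taylor_fps_def pcompose_diff fps_of_poly_diff)

lemma taylor_fps_sum: "taylor_fps \<zeta> (sum f S) = (\<Sum>x\<in>S. taylor_fps \<zeta> (f x))"
  by (simp add: taylor_fps_def pcompose_sum fps_of_poly_sum)

lemma taylor_fps_smult: "taylor_fps \<zeta> (Polynomial.smult c A) = fps_const c * taylor_fps \<zeta> A"
  by (simp add: taylor_fps_def pcompose_smult fps_of_poly_smult)

lemma taylor_fps_linear_power: "taylor_fps \<zeta> ([:- \<zeta>, 1:] ^ n) = fps_X ^ n"
proof (induction n)
  case 0
  have "taylor_fps \<zeta> 1 = 1" by (simp add: taylor_fps_def pcompose_1)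
  thus ?case by simp
next
  case (Suc n)
  have "taylor_fps \<zeta> [:- \<zeta>, 1:] = fps_X"
    by (simp add: taylor_fps_def pcompose_pCons)
  thus ?case using Suc by (simp only: power_Suc taylor_fps_mult)
qed

lemma taylor_fps_nth_0: "fps_nth (taylor_fps \<zeta> A) 0 = poly A \<zeta>"
  by (simp add: taylor_fps_def)

lemma taylor_fps_nth_degree: "degree A < n \<Longrightarrow> fps_nth (taylor_fps \<zeta> A) n = 0"
  by (simp add: taylor_fps_def coeff_eq_0 degree_pcompose)

lemma taylor_fps_eq_0_iff: "taylor_fps \<zeta> A = 0 \<longleftrightarrow> A = 0"
  unfolding taylor_fps_def fps_of_poly_eq_iff[of _ 0, simplified]
  by (auto intro: pcompose_eq_0)

lemma eq_0_if_tay_nth: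
  assumes "degree A \<le> N" "\<And>n. n \<le> N \<Longrightarrow> fps_nth (taylor_fps \<zeta> A) n = 0"
  shows "A = 0"
proof -
  have "fps_nth (taylor_fps \<zeta> A) n = 0" for n
    using assms taylor_fps_nth_degree[of A n \<zeta>] by (cases "n \<le> N") auto
  thus ?thesis using taylor_fps_eq_0_iff fps_eq_iff by (metis fps_zero_nth)
qed

lemma taylor_fps_partial_sum:
  "fps_nth (taylor_fps \<zeta> (partial_sum a \<zeta> k)) n = (if int n \<le> k then a n else 0)"
proof (cases "k < 0")
  case True
  thus ?thesis by (auto simp: partial_sum_def taylor_fps_def)
next
  case False
  have "taylor_fps \<zeta> (partial_sum a \<zeta> k) = (\<Sum>\<nu>\<le>nat k. fps_const (a \<nu>) * fps_X ^ \<nu>)"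
    using False by (simp add: partial_sum_def taylor_fps_sum taylor_fps_smult taylor_fps_linear_power)
  also have "fps_nth \<dots> n = (\<Sum>\<nu>\<le>nat k. if n = \<nu> then a \<nu> else 0)"
    unfolding fps_sum_nth by (rule sum.cong) auto
  also have "\<dots> = (if int n \<le> k then a n else 0)"
    using False by auto
  finally show ?thesis .
qed

lemma degree_partial_sum: "degree (partial_sum a \<zeta> k) \<le> nat k"
  unfolding partial_sum_def
  by (auto intro!: degree_sum_le order.trans[OF degree_smult_le] simp: degree_power_eq)

lemma degree_jacobi_den: "degree (jacobi_den a \<zeta> p q) \<le> q"
  unfolding jacobi_den_weights
  by (auto intro!: degree_sum_le order.trans[OF degree_smult_le] simp: degree_power_eq)

text \<open>The degrees \<open>q - j\<close> and \<open>p - q + j\<close> of the two factors add up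
  to \<open>p\<close>; for a negative truncation index the product is 0.\<close>

lemma degree_jacobi_num: "degree (jacobi_num a \<zeta> p q) \<le> p"
proof -
  have "degree ([:- \<zeta>, 1:] ^ (q - j) * partial_sum a \<zeta> (int p - int q + int j)) \<le> p" if "j \<le> q" for j
  proof (cases "int p - int q + int j < 0")
    case True thus ?thesis by (simp add: partial_sum_def)
  next
    case False
    have "degree ([:- \<zeta>, 1:] ^ (q - j) * partial_sum a \<zeta> (int p - int q + int j))
      \<le> (q - j) + nat (int p - int q + int j)"
      by (intro order.trans[OF degree_mult_le] add_mono degree_partial_sum) (simp add: degree_power_eq)
    thus ?thesis using False that by simp
  qed
  thus ?thesis unfolding jacobi_num_weights
    by (intro degree_sum_le order.trans[OF degree_smult_le]) auto
qed

lemma fps_X_power_mult_nth_int: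
  "fps_nth (fps_X ^ m * Abs_fps a) n = coeff_int a (int n - int m)"
  by (auto simp: fps_X_power_mult_nth coeff_int_def nat_diff_distrib)

text \<open>Multiplication by the power \<open>q - j\<close> turns a series truncated at
  \<open>p - q + j\<close> into one truncated at \<open>p\<close>. Up to order \<open>p\<close> both
  sides are the same combination of the \<open>a\<close>. Beyond it the left side is 0, and so is
  the right side, by orthogonality with row \<open>n - p\<close>.\<close>

lemma jacobi_expansion:
  assumes "n \<le> p + q"
  shows "fps_nth (taylor_fps \<zeta> (jacobi_num a \<zeta> p q)) n = fps_nth (taylor_fps \<zeta> (jacobi_den a \<zeta> p q) * Abs_fps a) n"
proof -
  let ?c = "jacobi_weight a p q"
  have l: "fps_nth (taylor_fps \<zeta> (jacobi_num a \<zeta> p q)) n =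
      (\<Sum>j\<le>q. ?c j * (if n \<le> p then coeff_int a (int n - int (q - j)) else 0))"
    unfolding jacobi_num_weights taylor_fps_sum taylor_fps_smult taylor_fps_mult taylor_fps_linear_power fps_sum_nth
    by (rule sum.cong)
       (auto simp: fps_X_power_mult_nth taylor_fps_partial_sum coeff_int_def nat_diff_distrib)
  have r: "fps_nth (taylor_fps \<zeta> (jacobi_den a \<zeta> p q) * Abs_fps a) n =
      (\<Sum>j\<le>q. ?c j * coeff_int a (int n - int (q - j)))"
    unfolding jacobi_den_weights taylor_fps_sum taylor_fps_smult taylor_fps_linear_power sum_distrib_right fps_sum_nth
    by (rule sum.cong) (auto simp: mult.assoc fps_X_power_mult_nth_int)
  show ?thesis
  proof (cases "n \<le> p")
    case True thus ?thesis by (simp add: l r)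
  next
    case False
    define i where "i = n - p"
    have "(\<Sum>j\<le>q. ?c j * coeff_int a (int n - int (q - j))) =
       (\<Sum>j\<le>q. ?c j * coeff_int a (int p - int q + int i + int j))"
      by (rule sum.cong) (use False in \<open>auto simp: i_def of_nat_diff algebra_simps\<close>)
    also have "\<dots> = 0"
      using False assms by (intro jacobi_weight_orthogonal) (auto simp: i_def)
    finally show ?thesis using False by (simp add: l r)
  qed
qed

lemma fps_mult_nth_low_zero:
  fixes f g :: "'a :: comm_semiring_1 fps"
  assumes "\<And>n. n \<le> N \<Longrightarrow> fps_nth f n = 0" "n \<le> N"
  shows "fps_nth (f * g) n = 0"
  using assms by (auto simp: fps_mult_nth intro!: sum.neutral)

text \<open>As a series, \<open>A B' - A' B\<close> equals
  \<open>(A - B a) B' - (A' - B' a) B\<close>, so it vanishes up to order \<open>N\<close>, while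
  its degree is at most \<open>N\<close>. This argument gives uniqueness of the approximant, the
  nonzero Hankel determinant and the identification of the Jacobi polynomials.\<close>

lemma pade_cross_eq:
  assumes "\<And>n. n \<le> N \<Longrightarrow> fps_nth (taylor_fps \<zeta> A) n = fps_nth (taylor_fps \<zeta> B * Abs_fps a) n"
    and "\<And>n. n \<le> N \<Longrightarrow> fps_nth (taylor_fps \<zeta> A') n = fps_nth (taylor_fps \<zeta> B' * Abs_fps a) n"
    and "degree (A * B') \<le> N" "degree (A' * B) \<le> N"
  shows "A * B' = A' * B"
proof -
  have "taylor_fps \<zeta> (A * B' - A' * B) =
      (taylor_fps \<zeta> A - taylor_fps \<zeta> B * Abs_fps a) * taylor_fps \<zeta> B' - (taylor_fps \<zeta> A' - taylor_fps \<zeta> B' * Abs_fps a) * taylor_fps \<zeta> B"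
    by (simp add: taylor_fps_mult taylor_fps_diff algebra_simps)
  moreover have "fps_nth ((taylor_fps \<zeta> A - taylor_fps \<zeta> B * Abs_fps a) * taylor_fps \<zeta> B') n = 0" if "n \<le> N" for n
    by (rule fps_mult_nth_low_zero[where N = N]) (use assms that in auto)
  moreover have "fps_nth ((taylor_fps \<zeta> A' - taylor_fps \<zeta> B' * Abs_fps a) * taylor_fps \<zeta> B) n = 0" if "n \<le> N" for n
    by (rule fps_mult_nth_low_zero[where N = N]) (use assms that in auto)
  ultimately have "fps_nth (taylor_fps \<zeta> (A * B' - A' * B)) n = 0" if "n \<le> N" for n
    using that by simp
  moreover have "degree (A * B' - A' * B) \<le> N"
    using assms by (intro degree_diff_le)
  ultimately have "A * B' - A' * B = 0" by (rule eq_0_if_tay_nth[rotated])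
  thus ?thesis by simp
qed

lemma holomorphic_on_poly [holomorphic_intros]: "poly A holomorphic_on S" for A :: "complex poly"
  by (auto simp: holomorphic_on_def field_differentiable_def
      intro: has_field_derivative_at_within poly_DERIV)

lemma analytic_on_poly: "poly A analytic_on S" for A :: "complex poly"
  by (auto simp: analytic_on_def intro!: holomorphic_on_poly exI[of _ 1])

lemma taylor_fps_quotient:
  assumes "poly B \<zeta> \<noteq> 0"
  shows "taylor_fps \<zeta> A = taylor_fps \<zeta> B * Abs_fps (\<lambda>k. (deriv ^^ k) (ratio A B) \<zeta> / fact k)"
proof -
  have poly_exp: "(\<lambda>w. poly A (\<zeta> + w)) has_fps_expansion taylor_fps \<zeta> A" for A
  proof -
    have "eval_fps (taylor_fps \<zeta> A) has_fps_expansion taylor_fps \<zeta> A"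
      by (rule eval_fps_has_fps_expansion) (simp add: taylor_fps_def)
    moreover have "eval_fps (taylor_fps \<zeta> A) = (\<lambda>w. poly A (\<zeta> + w))"
      by (auto simp: taylor_fps_def poly_pcompose add.commute fun_eq_iff)
    ultimately show ?thesis by simp
  qed
  have "(ratio A B) analytic_on {\<zeta>}"
    using assms by (intro analytic_intros analytic_on_poly) auto
  hence "(\<lambda>w. poly A (\<zeta> + w) / poly B (\<zeta> + w)) has_fps_expansion
      fps_expansion (ratio A B) \<zeta>"
    by (rule analytic_at_imp_has_fps_expansion)
  hence "(\<lambda>w. poly B (\<zeta> + w) * (poly A (\<zeta> + w) / poly B (\<zeta> + w))) has_fps_expansion
      taylor_fps \<zeta> B * fps_expansion (ratio A B) \<zeta>" (is "?f has_fps_expansion ?F")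
    by (intro has_fps_expansion_mult poly_exp)
  moreover have ev: "eventually (\<lambda>w. poly A (\<zeta> + w) = ?f w) (nhds 0)"
  proof -
    have "open {w. poly B (\<zeta> + w) \<noteq> 0}" by (intro open_Collect_neq continuous_intros)
    hence "eventually (\<lambda>w. w \<in> {w. poly B (\<zeta> + w) \<noteq> 0}) (nhds 0)"
      using assms by (intro eventually_nhds_in_open) auto
    thus ?thesis by eventually_elim auto
  qed
  ultimately have "(\<lambda>w. poly A (\<zeta> + w)) has_fps_expansion ?F"
    using has_fps_expansion_cong[OF ev refl] by blast
  hence "taylor_fps \<zeta> A = ?F"
    using fps_expansion_unique_complex poly_exp by blast
  thus ?thesis by (simp add: fps_expansion_def)
qed

lemma fps_nth_cong_low:
  fixes f :: "'a :: comm_semiring_1 fps"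
  assumes "\<And>k. k \<le> n \<Longrightarrow> a k = b k"
  shows "fps_nth (f * Abs_fps a) n = fps_nth (f * Abs_fps b) n"
  unfolding fps_mult_nth using assms by (auto intro!: sum.cong)

text \<open>Since \<open>B\<close> does not vanish at the centre, its Taylor series is invertible.
  The nonlinear condition on the quotient is thus equivalent to the linear one
  \<open>A = B a\<close> up to order \<open>N\<close>, which makes the handling of
  \<open>is_pade\<close> purely formal.\<close>

lemma quotient_coeffs_iff:
  assumes "poly B \<zeta> \<noteq> 0"
  shows "(\<forall>k\<le>N. (deriv ^^ k) (ratio A B) \<zeta> / fact k = a k) \<longleftrightarrow>
    (\<forall>n\<le>N. fps_nth (taylor_fps \<zeta> A) n = fps_nth (taylor_fps \<zeta> B * Abs_fps a) n)" (is "?l \<longleftrightarrow> ?r")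
proof -
  let ?e = "\<lambda>k. (deriv ^^ k) (ratio A B) \<zeta> / fact k"
  note tq = taylor_fps_quotient[OF assms, of A]
  show ?thesis
  proof
    assume l: ?l
    show ?r
    proof (intro allI impI)
      fix n assume "n \<le> N"
      show "fps_nth (taylor_fps \<zeta> A) n = fps_nth (taylor_fps \<zeta> B * Abs_fps a) n"
        unfolding tq by (rule fps_nth_cong_low) (use l \<open>n \<le> N\<close> in auto)
    qed
  next
    assume r: ?r
    have B0: "fps_nth (taylor_fps \<zeta> B) 0 \<noteq> 0" using assms by (simp add: taylor_fps_nth_0)
    have "fps_nth (taylor_fps \<zeta> B * (Abs_fps ?e - Abs_fps a)) n = 0" if "n \<le> N" for n
      using r that unfolding tq by (simp add: algebra_simps)
    hence "fps_nth (taylor_fps \<zeta> B * (Abs_fps ?e - Abs_fps a) * inverse (taylor_fps \<zeta> B)) n = 0" if "n \<le> N" for n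
      using that by (intro fps_mult_nth_low_zero[where N = N and g = "inverse (taylor_fps \<zeta> B)"]) auto
    moreover have "taylor_fps \<zeta> B * (Abs_fps ?e - Abs_fps a) * inverse (taylor_fps \<zeta> B) = Abs_fps ?e - Abs_fps a"
      using inverse_mult_eq_1[OF B0] by (simp add: mult.commute mult.left_commute)
    ultimately show ?l by auto
  qed
qed

lemma is_pade_iff:
  "is_pade a \<zeta> p q R \<longleftrightarrow>
     (\<exists>A B. R = to_fract A / to_fract B \<and> degree A \<le> p \<and> degree B \<le> q \<and> poly B \<zeta> \<noteq> 0 \<and>
        (\<forall>n\<le>p + q. fps_nth (taylor_fps \<zeta> A) n = fps_nth (taylor_fps \<zeta> B * Abs_fps a) n))"
  unfolding is_pade_def using quotient_coeffs_iff by blast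

lemma to_fract_divide_eq_iff:
  assumes "B \<noteq> 0" "B' \<noteq> 0"
  shows "to_fract A / to_fract B = to_fract A' / to_fract B' \<longleftrightarrow> A * B' = A' * B"
  using assms by (simp add: divide_simps flip: to_fract_mult)

lemma is_pade_unique:
  assumes "is_pade a \<zeta> p q R" "is_pade a \<zeta> p q R'"
  shows "R = R'"
proof -
  from assms(1) obtain A B where AB: "R = to_fract A / to_fract B"
    "degree A \<le> p" "degree B \<le> q" "poly B \<zeta> \<noteq> 0"
    "\<And>n. n \<le> p + q \<Longrightarrow> fps_nth (taylor_fps \<zeta> A) n = fps_nth (taylor_fps \<zeta> B * Abs_fps a) n"
    unfolding is_pade_iff by blast
  from assms(2) obtain A' B' where AB': "R' = to_fract A' / to_fract B'"
    "degree A' \<le> p" "degree B' \<le> q" "poly B' \<zeta> \<noteq> 0"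
    "\<And>n. n \<le> p + q \<Longrightarrow> fps_nth (taylor_fps \<zeta> A') n = fps_nth (taylor_fps \<zeta> B' * Abs_fps a) n"
    unfolding is_pade_iff by blast
  have "A * B' = A' * B"
  proof (rule pade_cross_eq[OF AB(5) AB'(5)])
    show "degree (A * B') \<le> p + q" using degree_mult_le[of A B'] AB AB' by linarith
    show "degree (A' * B) \<le> p + q" using degree_mult_le[of A' B] AB AB' by linarith
  qed
  moreover have "B \<noteq> 0" "B' \<noteq> 0" using AB AB' by auto
  ultimately show ?thesis unfolding AB(1) AB'(1) by (simp add: to_fract_divide_eq_iff)
qed

text \<open>At the centre only the summand \<open>j = q\<close> survives, because
  \<open>0 ^ 0 = 1\<close>, and its weight is the Hankel determinant up to sign. So
  \<open>pade_D\<close> makes the Jacobi denominator admissible in \<open>is_pade\<close>.\<close>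

lemma pade_eq_jacobi:
  assumes "pade_D a p q"
  shows "poly (jacobi_den a \<zeta> p q) \<zeta> \<noteq> 0"
    and "pade a \<zeta> p q = to_fract (jacobi_num a \<zeta> p q) / to_fract (jacobi_den a \<zeta> p q)"
proof -
  let ?c = "jacobi_weight a p q"
  have "poly (jacobi_den a \<zeta> p q) \<zeta> = (\<Sum>j\<le>q. ?c j * 0 ^ (q - j))"
    unfolding jacobi_den_weights by (simp add: poly_sum)
  also have "\<dots> = (\<Sum>j\<in>{q}. ?c j * 0 ^ (q - j))"
    by (rule sum.mono_neutral_right) auto
  finally show 1: "poly (jacobi_den a \<zeta> p q) \<zeta> \<noteq> 0" using jacobi_weight_last assms by simp
  have "is_pade a \<zeta> p q (to_fract (jacobi_num a \<zeta> p q) / to_fract (jacobi_den a \<zeta> p q))"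
    unfolding is_pade_iff
    by (intro exI[of _ "jacobi_num a \<zeta> p q"] exI[of _ "jacobi_den a \<zeta> p q"] conjI refl allI impI 1
        degree_jacobi_num degree_jacobi_den jacobi_expansion)
  thus "pade a \<zeta> p q = to_fract (jacobi_num a \<zeta> p q) / to_fract (jacobi_den a \<zeta> p q)"
    unfolding pade_def by (intro the_equality is_pade_unique)
qed

text \<open>For the second claim, cross-multiplication with the Jacobi pair and coprimality make
  \<open>A\<close> a divisor of the Jacobi numerator. Its degree is at most
  \<open>p = degree A\<close>, so the quotient is a constant.\<close>

lemma pade_of_rational:
  assumes "coprime A B" "degree A = p" "degree B \<le> q" "A \<noteq> 0" "poly B \<zeta> \<noteq> 0"
    and a: "taylor_fps \<zeta> A = taylor_fps \<zeta> B * Abs_fps a"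
  shows "pade_D a p q"
    and "\<exists>c. c \<noteq> 0 \<and> jacobi_num a \<zeta> p q = Polynomial.smult c A \<and> jacobi_den a \<zeta> p q = Polynomial.smult c B"
proof -
  have "B \<noteq> 0" using assms by auto
  show D: "pade_D a p q"
    \<comment> \<open>A kernel vector of the Hankel matrix gives \<open>Q \<noteq> 0\<close> and \<open>P\<close> of degrees below \<open>q\<close> and \<open>p\<close> with
      \<open>A Q = P B\<close>, whence \<open>A\<close> divides \<open>P\<close>.\<close>
  proof (rule ccontr)
    assume nD: "\<not> pade_D a p q"
    let ?H = "Matrix.mat q q (\<lambda>(i, j). coeff_int a (int p - int q + int i + int j + 1))"
    have "q \<noteq> 0" and "Determinant.det ?H = 0" using nD by (auto simp: pade_D_def)
    then obtain v where v: "v \<in> carrier_vec q" "v \<noteq> 0\<^sub>v q" "?H *\<^sub>v v = 0\<^sub>v q"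
      using det_0_iff_vec_prod_zero_field[of ?H q] by auto
    \<comment> \<open>The entries of \<open>v\<close> go with descending powers, so that the
      coefficient of order \<open>p + i\<close> of \<open>Q a\<close> is entry \<open>i\<close> of
      the Hankel product, which is 0.\<close>
    define Q where "Q = (\<Sum>j<q. Polynomial.smult (vec_index v j) ([:- \<zeta>, 1:] ^ (q - 1 - j)))"
    have Q_nth: "fps_nth (taylor_fps \<zeta> Q * Abs_fps a) n = (\<Sum>j<q. vec_index v j * coeff_int a (int n - int (q - 1 - j)))" for n
      unfolding Q_def taylor_fps_sum taylor_fps_smult taylor_fps_linear_power sum_distrib_right fps_sum_nth
      by (rule sum.cong) (auto simp: mult.assoc fps_X_power_mult_nth_int)
    have Q_van: "fps_nth (taylor_fps \<zeta> Q * Abs_fps a) n = 0" if "p \<le> n" "n < p + q" for n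
    proof -
      define i where "i = n - p"
      have i: "i < q" "n = p + i" using that by (auto simp: i_def)
      have "0 = vec_index (?H *\<^sub>v v) i" unfolding v(3) using i by simp
      also have "\<dots> = (\<Sum>j<q. coeff_int a (int p - int q + int i + int j + 1) * vec_index v j)"
        using v(1) i by (auto simp: scalar_prod_def atLeast0LessThan intro!: sum.cong)
      also have "\<dots> = (\<Sum>j<q. vec_index v j * coeff_int a (int n - int (q - 1 - j)))"
        by (rule sum.cong) (auto simp: i of_nat_diff algebra_simps)
      finally show ?thesis by (simp add: Q_nth)
    qed
    have Q0: "Q \<noteq> 0"
    proof
      assume "Q = 0"
      have "vec_index v j = 0" if "j < q" for j
      proof -
        have "0 = fps_nth (taylor_fps \<zeta> Q) (q - 1 - j)" by (simp add: \<open>Q = 0\<close> taylor_fps_def)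
        also have "\<dots> = (\<Sum>j'<q. if j' = j then vec_index v j' else 0)"
          unfolding Q_def taylor_fps_sum taylor_fps_smult taylor_fps_linear_power fps_sum_nth
          by (rule sum.cong) (use that in auto)
        also have "\<dots> = vec_index v j" using that by simp
        finally show ?thesis by simp
      qed
      hence "v = 0\<^sub>v q" using v(1) by (intro eq_vecI) auto
      thus False using v by simp
    qed
    have degQ: "degree Q \<le> q - 1"
      unfolding Q_def by (auto intro!: degree_sum_le order.trans[OF degree_smult_le] simp: degree_power_eq)
    \<comment> \<open>\<open>P\<close> is \<open>Q a\<close> cut off below order \<open>p\<close>.
      As \<open>Q a\<close> vanishes at the orders \<open>p\<close> to \<open>p + q - 1\<close>, the
      two agree up to \<open>p + q - 1\<close>, which also bounds the degrees of \<open>A Q\<close>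
      and \<open>P B\<close>.\<close>
    define P where "P = (\<Sum>\<nu><p. Polynomial.smult (fps_nth (taylor_fps \<zeta> Q * Abs_fps a) \<nu>) ([:- \<zeta>, 1:] ^ \<nu>))"
    have P_nth: "fps_nth (taylor_fps \<zeta> P) n = (if n < p then fps_nth (taylor_fps \<zeta> Q * Abs_fps a) n else 0)" for n
    proof -
      have "fps_nth (taylor_fps \<zeta> P) n = (\<Sum>\<nu><p. if \<nu> = n then fps_nth (taylor_fps \<zeta> Q * Abs_fps a) \<nu> else 0)"
        unfolding P_def taylor_fps_sum taylor_fps_smult taylor_fps_linear_power fps_sum_nth by (rule sum.cong) auto
      thus ?thesis by simp
    qed
    have degP: "degree P \<le> p - 1"
      unfolding P_def by (auto intro!: degree_sum_le order.trans[OF degree_smult_le] simp: degree_power_eq)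
    have dPB: "degree (P * B) \<le> p + q - 1"
    proof (cases "p = 0")
      case True thus ?thesis by (simp add: P_def)
    next
      case False thus ?thesis using degree_mult_le[of P B] degP assms by linarith
    qed
    have "A * Q = P * B"
    proof (rule pade_cross_eq[where N = "p + q - 1" and a = a and \<zeta> = \<zeta>])
      show "fps_nth (taylor_fps \<zeta> P) n = fps_nth (taylor_fps \<zeta> Q * Abs_fps a) n" if "n \<le> p + q - 1" for n
        using that Q_van[of n] \<open>q \<noteq> 0\<close> by (auto simp: P_nth)
      show "degree (A * Q) \<le> p + q - 1"
        using degree_mult_le[of A Q] degQ assms \<open>q \<noteq> 0\<close> by linarith
        show "degree (P * B) \<le> p + q - 1" by (rule dPB)
    qed (simp_all add: a)
    hence "A dvd P * B" by (metis dvd_triv_left)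
    hence "A dvd P" using coprime_dvd_mult_left_iff[OF assms(1)] by simp
    moreover have "P \<noteq> 0" using \<open>A * Q = P * B\<close> Q0 \<open>A \<noteq> 0\<close> by auto
    ultimately have "p \<le> degree P" using assms(2) dvd_imp_degree_le by blast
    \<comment> \<open>Subtraction is truncated, so \<open>degP\<close> gives no contradiction for
      \<open>p = 0\<close>; but there \<open>P\<close> is an empty sum, hence 0.\<close>
    moreover have "p \<noteq> 0" using \<open>P \<noteq> 0\<close> by (auto simp: P_def intro!: Nat.gr0I)
    ultimately show False using degP by simp
  qed
  let ?N = "jacobi_num a \<zeta> p q" and ?D = "jacobi_den a \<zeta> p q"
  have "A * ?D = ?N * B"
  proof (rule pade_cross_eq[where N = "p + q" and a = a and \<zeta> = \<zeta>])
    show "degree (A * ?D) \<le> p + q"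
      using degree_mult_le[of A ?D] degree_jacobi_den[of a \<zeta> p q] assms by linarith
    show "degree (?N * B) \<le> p + q"
      using degree_mult_le[of ?N B] degree_jacobi_num[of a \<zeta> p q] assms by linarith
  qed (simp_all add: a jacobi_expansion)
  moreover have D0: "?D \<noteq> 0" using pade_eq_jacobi(1)[OF D, of \<zeta>] by auto
  ultimately have N0: "?N \<noteq> 0" using \<open>A \<noteq> 0\<close> by auto
  have "A dvd ?N * B" using \<open>A * ?D = ?N * B\<close> by (metis dvd_triv_left)
  hence "A dvd ?N" using coprime_dvd_mult_left_iff[OF assms(1)] by simp
  then obtain S where S: "?N = A * S" by auto
  have degS: "degree S = 0"
    using S N0 degree_mult_eq[of A S] degree_jacobi_num[of a \<zeta> p q] assms(2) by auto
  then obtain c where c: "S = [:c:]" by (metis degree_0_id)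
  have "?D = S * B" using \<open>A * ?D = ?N * B\<close> S \<open>A \<noteq> 0\<close> by auto
  thus "\<exists>c. c \<noteq> 0 \<and> ?N = Polynomial.smult c A \<and> ?D = Polynomial.smult c B"
    using S c N0 by (intro exI[of _ c]) auto
qed

section \<open>Homogeneous coordinates and the chordal metric\<close>

text \<open>Homogeneous coordinates on the sphere; \<open>proj_pt 0 0\<close> is a junk value.\<close>

definition proj_pt :: "complex \<Rightarrow> complex \<Rightarrow> complex option" where
  "proj_pt A B = (if B = 0 then None else Some (A / B))"

definition hnorm :: "complex \<Rightarrow> complex \<Rightarrow> real" where
  "hnorm A B = sqrt ((cmod A)\<^sup>2 + (cmod B)\<^sup>2)"

lemma hnorm_eq_0_iff [simp]: "hnorm A B = 0 \<longleftrightarrow> A = 0 \<and> B = 0"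
  by (simp add: hnorm_def sum_power2_eq_zero_iff)

lemma hnorm_nonneg [simp]: "hnorm A B \<ge> 0"
  by (simp add: hnorm_def)

lemma hnorm_pos_iff: "hnorm A B > 0 \<longleftrightarrow> A \<noteq> 0 \<or> B \<noteq> 0"
  using hnorm_nonneg[of A B] hnorm_eq_0_iff[of A B] by linarith

lemma norm_le_hnorm: "cmod A \<le> hnorm A B" "cmod B \<le> hnorm A B"
  by (auto simp: hnorm_def intro!: real_le_rsqrt)

lemma hnorm_le: "hnorm A B \<le> cmod A + cmod B"
  by (simp add: hnorm_def sqrt_sum_squares_le_sum)

lemma sqrt_one_plus_quotient: "B \<noteq> 0 \<Longrightarrow> sqrt (1 + (cmod (A / B))\<^sup>2) = hnorm A B / cmod B"
proof -
  assume B: "B \<noteq> 0"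
  have "1 + (cmod (A / B))\<^sup>2 = ((cmod A)\<^sup>2 + (cmod B)\<^sup>2) / (cmod B)\<^sup>2"
    using B by (simp add: norm_divide power_divide field_simps)
  thus ?thesis by (simp add: hnorm_def real_sqrt_divide)
qed

text \<open>In homogeneous coordinates infinity is no exception: one quotient of a determinant by
  norms covers the four cases of \<open>chordal\<close>.\<close>

lemma chordal_proj_pt:
  assumes "A \<noteq> 0 \<or> B \<noteq> 0" "A' \<noteq> 0 \<or> B' \<noteq> 0"
  shows "chordal (proj_pt A B) (proj_pt A' B') = cmod (A * B' - A' * B) / (hnorm A B * hnorm A' B')"
proof (cases "B = 0"; cases "B' = 0")
  assume "B \<noteq> 0" "B' \<noteq> 0"
  moreover from this have "A / B - A' / B' = (A * B' - A' * B) / (B * B')"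
    by (simp add: field_simps)
  ultimately show ?thesis
    by (simp add: proj_pt_def sqrt_one_plus_quotient[unfolded norm_divide] norm_divide norm_mult)
qed (use assms in \<open>auto simp: proj_pt_def sqrt_one_plus_quotient[unfolded norm_divide] norm_divide norm_mult\<close>, auto simp: hnorm_def)

lemma proj_pt_cases:
  obtains A B where "x = proj_pt A B" "A \<noteq> 0 \<or> B \<noteq> 0"
proof (cases x)
  case None thus ?thesis using that[of 1 0] by (simp add: proj_pt_def)
next
  case (Some a) thus ?thesis using that[of a 1] by (simp add: proj_pt_def)
qed

lemma chordal_nonneg: "chordal x y \<ge> 0"
  by (cases "(x, y)" rule: chordal.cases) auto

lemma cauchy_schwarz_2:
  "cmod (A * cnj B + C * cnj D) \<le> hnorm A C * hnorm B D"
proof -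
  have "cmod (A * cnj B + C * cnj D) \<le> cmod A * cmod B + cmod C * cmod D"
    using norm_triangle_ineq[of "A * cnj B" "C * cnj D"] by (simp add: norm_mult)
  also have "\<dots> \<le> hnorm A C * hnorm B D"
    unfolding hnorm_def
    using Cauchy_Schwarz_ineq2[of "(cmod A, cmod C)" "(cmod B, cmod D)"]
    by (simp add: norm_prod_def)
  finally show ?thesis .
qed

lemma chordal_triangle: "chordal x z \<le> chordal x y + chordal y z"
proof -
  obtain A B where x: "x = proj_pt A B" "A \<noteq> 0 \<or> B \<noteq> 0" by (rule proj_pt_cases)
  obtain C D where y: "y = proj_pt C D" "C \<noteq> 0 \<or> D \<noteq> 0" by (rule proj_pt_cases)
  obtain E G where z: "z = proj_pt E G" "E \<noteq> 0 \<or> G \<noteq> 0" by (rule proj_pt_cases)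
  \<comment> \<open>For \<open>u = (A, B)\<close>, \<open>v = (C, D)\<close>, \<open>w = (E, G)\<close> this reads
    \<open>det(u, w) |v|^2 = (u \<bullet> v) det(v, w) + (w \<bullet> v) det(u, v)\<close>; now use Cauchy-Schwarz.\<close>
  have id: "(A * G - E * B) * (C * cnj C + D * cnj D) =
      (A * cnj C + B * cnj D) * (C * G - E * D) + (E * cnj C + G * cnj D) * (A * D - C * B)"
    by (simp add: algebra_simps)
  have sq: "cmod (C * cnj C + D * cnj D) = (hnorm C D)\<^sup>2"
  proof -
    have "C * cnj C + D * cnj D = of_real ((hnorm C D)\<^sup>2)"
      by (simp add: hnorm_def flip: complex_norm_square)
    thus ?thesis by (metis norm_of_real abs_power2)
  qed
  have "cmod (A * G - E * B) * (hnorm C D)\<^sup>2 \<le>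
      cmod (A * cnj C + B * cnj D) * cmod (C * G - E * D) + cmod (E * cnj C + G * cnj D) * cmod (A * D - C * B)"
    using norm_triangle_ineq[of "(A * cnj C + B * cnj D) * (C * G - E * D)"
        "(E * cnj C + G * cnj D) * (A * D - C * B)"]
    unfolding id[symmetric] norm_mult sq .
  also have "\<dots> \<le> (hnorm A B * hnorm C D) * cmod (C * G - E * D) + (hnorm E G * hnorm C D) * cmod (A * D - C * B)"
    by (intro add_mono mult_right_mono cauchy_schwarz_2) auto
  finally have *: "cmod (A * G - E * B) * hnorm C D \<le> hnorm A B * cmod (C * G - E * D) + hnorm E G * cmod (A * D - C * B)"
  proof -
    assume "cmod (A * G - E * B) * (hnorm C D)\<^sup>2 \<le> (hnorm A B * hnorm C D) * cmod (C * G - E * D) + (hnorm E G * hnorm C D) * cmod (A * D - C * B)"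
    hence "hnorm C D * (cmod (A * G - E * B) * hnorm C D) \<le>
       hnorm C D * (hnorm A B * cmod (C * G - E * D) + hnorm E G * cmod (A * D - C * B))"
      by (simp add: power2_eq_square algebra_simps)
    thus ?thesis using y(2) by (simp add: hnorm_pos_iff)
  qed
  have pos: "hnorm A B > 0" "hnorm C D > 0" "hnorm E G > 0"
    using x y z by (simp_all add: hnorm_pos_iff)
  have gen: "X / (a * e) \<le> v / (a * c) + u / (c * e)"
    if "X * c \<le> a * u + e * v" "a > 0" "c > 0" "e > 0" for X a c e u v :: real
  proof -
    have "X / (a * e) = (X * c) / (a * c * e)" using that by simp
    also have "\<dots> \<le> (a * u + e * v) / (a * c * e)" using that by (intro divide_right_mono) auto
    also have "\<dots> = v / (a * c) + u / (c * e)" using that by (simp add: add_divide_distrib)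
    finally show ?thesis .
  qed
  show ?thesis
    unfolding x(1) y(1) z(1) chordal_proj_pt[OF x(2) z(2)] chordal_proj_pt[OF x(2) y(2)] chordal_proj_pt[OF y(2) z(2)]
    by (rule gen[OF * pos])
qed

text \<open>The determinant of the two pairs is \<open>A (B' - B) + B (A - A')\<close>, and both
  \<open>A\<close> and \<open>B\<close> are bounded by \<open>hnorm A B\<close>, which cancels. The
  bound depends only on a lower bound \<open>c\<close> for the reference pair, so one constant
  serves a whole compact set.\<close>

lemma chordal_perturb:
  assumes "cmod (A - A') \<le> e" "cmod (B - B') \<le> e" "2 * e < c" "c \<le> hnorm A' B'"
  shows "A \<noteq> 0 \<or> B \<noteq> 0" "chordal (proj_pt A B) (proj_pt A' B') \<le> 2 * e / c"
proof -
  have e: "e \<ge> 0" using assms(1) norm_ge_zero order.trans by blast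
  hence c: "c > 0" using assms by linarith
  hence nz': "A' \<noteq> 0 \<or> B' \<noteq> 0" using assms by (metis hnorm_pos_iff order.strict_trans2)
  \<comment> \<open>If \<open>A\<close> and \<open>B\<close> both vanished,
    \<open>hnorm A' B'\<close> would be at most \<open>2 * e\<close>, hence below
    \<open>c\<close>.\<close>
  show nz: "A \<noteq> 0 \<or> B \<noteq> 0"
    using assms hnorm_le[of A' B'] by auto
  have "A * B' - A' * B = A * (B' - B) + B * (A - A')" by (simp add: algebra_simps)
  hence "cmod (A * B' - A' * B) \<le> cmod A * cmod (B' - B) + cmod B * cmod (A - A')"
    using norm_triangle_ineq[of "A * (B' - B)" "B * (A - A')"] by (simp add: norm_mult)
  also have "\<dots> \<le> hnorm A B * e + hnorm A B * e"
    using assms norm_le_hnorm[of A B] norm_le_hnorm[of B A] e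
    by (intro add_mono mult_mono) (auto simp: norm_minus_commute)
  finally have "cmod (A * B' - A' * B) \<le> hnorm A B * (2 * e)" by (simp add: mult_ac)
  hence "chordal (proj_pt A B) (proj_pt A' B') \<le> hnorm A B * (2 * e) / (hnorm A B * hnorm A' B')"
    unfolding chordal_proj_pt[OF nz nz'] by (intro divide_right_mono) auto
  also have "\<dots> = 2 * e / hnorm A' B'" using nz by auto
  also have "\<dots> \<le> 2 * e / c" using assms c e by (intro divide_left_mono) auto
  finally show "chordal (proj_pt A B) (proj_pt A' B') \<le> 2 * e / c" .
qed

lemma chordal_tendsto:
  assumes "(a \<longlongrightarrow> A) F" "(b \<longlongrightarrow> B) F" "(c \<longlongrightarrow> C) F" "(d \<longlongrightarrow> D) F"
    and nz: "A \<noteq> 0 \<or> B \<noteq> 0" "C \<noteq> 0 \<or> D \<noteq> 0"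
  shows "((\<lambda>i. chordal (proj_pt (a i) (b i)) (proj_pt (c i) (d i))) \<longlongrightarrow>
      chordal (proj_pt A B) (proj_pt C D)) F"
proof -
  have h: "((\<lambda>i. hnorm (a i) (b i)) \<longlongrightarrow> hnorm A B) F" "((\<lambda>i. hnorm (c i) (d i)) \<longlongrightarrow> hnorm C D) F"
    unfolding hnorm_def using assms by (auto intro!: tendsto_intros)
  have ne: "hnorm A B \<noteq> 0" "hnorm C D \<noteq> 0" using nz by auto
  have "((\<lambda>i. cmod (a i * d i - c i * b i) / (hnorm (a i) (b i) * hnorm (c i) (d i))) \<longlongrightarrow>
      chordal (proj_pt A B) (proj_pt C D)) F"
    unfolding chordal_proj_pt[OF nz] using ne by (intro tendsto_intros assms h) auto
  moreover have "eventually (\<lambda>i. cmod (a i * d i - c i * b i) / (hnorm (a i) (b i) * hnorm (c i) (d i)) =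
      chordal (proj_pt (a i) (b i)) (proj_pt (c i) (d i))) F"
    using tendsto_imp_eventually_ne[OF h(1) ne(1)] tendsto_imp_eventually_ne[OF h(2) ne(2)]
    by eventually_elim (subst chordal_proj_pt, auto)
  ultimately show ?thesis by (rule Lim_transform_eventually)
qed

section \<open>Values, poles and derivatives of quotients of polynomials\<close>

lemma coprime_poly_no_common_root: "coprime A B \<Longrightarrow> \<not> (poly A z = 0 \<and> poly B z = 0)"
  for z :: complex
  by (meson coprime_poly_0)

lemma rat_sphere_eq_proj_pt:
  "rat_sphere R z = proj_pt (poly (fst (quot_of_fract R)) z) (poly (snd (quot_of_fract R)) z)"
  by (simp add: rat_sphere_def proj_pt_def is_rat_pole_def rat_fun_def)

lemma quot_of_fract_quotient:
  fixes A B :: "complex poly"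
  assumes "B \<noteq> 0"
  shows "A * snd (quot_of_fract (to_fract A / to_fract B)) =
    fst (quot_of_fract (to_fract A / to_fract B)) * B"
proof -
  let ?R = "to_fract A / to_fract B"
  have "?R = to_fract (fst (quot_of_fract ?R)) / to_fract (snd (quot_of_fract ?R))"
    using Fract_quot_of_fract[of ?R] unfolding Fract_conv_to_fract by simp
  thus ?thesis using assms to_fract_divide_eq_iff snd_quot_of_fract_nonzero by blast
qed

text \<open>The pair \<open>A\<close>, \<open>B\<close> need not be in lowest terms: it is enough
  that it does not vanish at \<open>z\<close>. It is proportional at \<open>z\<close> to the reduced
  pair, which does not vanish there either, so the denominators vanish together.\<close>

lemma is_rat_pole_quotient:
  assumes "B \<noteq> 0" "\<not> (poly A z = 0 \<and> poly B z = 0)"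
  shows "is_rat_pole (to_fract A / to_fract B) z \<longleftrightarrow> poly B z = 0"
proof -
  let ?q = "quot_of_fract (to_fract A / to_fract B)"
  have "poly A z * poly (snd ?q) z = poly (fst ?q) z * poly B z"
    using quot_of_fract_quotient[OF assms(1), of A] by (metis poly_mult)
  moreover have "\<not> (poly (fst ?q) z = 0 \<and> poly (snd ?q) z = 0)"
    using coprime_quot_of_fract coprime_poly_no_common_root by blast
  ultimately show ?thesis
    using assms(2) unfolding is_rat_pole_def by (metis mult_eq_0_iff)
qed

lemma rat_fun_quotient:
  assumes "poly B z \<noteq> 0"
  shows "rat_fun (to_fract A / to_fract B) z = poly A z / poly B z"
proof -
  let ?q = "quot_of_fract (to_fract A / to_fract B)"
  have B: "B \<noteq> 0" using assms by auto
  have "poly A z * poly (snd ?q) z = poly (fst ?q) z * poly B z"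
    using quot_of_fract_quotient[OF B, of A] by (metis poly_mult)
  moreover have "poly (snd ?q) z \<noteq> 0"
    using is_rat_pole_quotient[OF B, of A z] assms by (auto simp: is_rat_pole_def)
  ultimately show ?thesis using assms by (simp add: rat_fun_def field_simps)
qed

lemma rat_sphere_quotient:
  assumes "B \<noteq> 0" "\<not> (poly A z = 0 \<and> poly B z = 0)"
  shows "rat_sphere (to_fract A / to_fract B) z = proj_pt (poly A z) (poly B z)"
  using is_rat_pole_quotient[OF assms] rat_fun_quotient[of B z A]
  by (auto simp: rat_sphere_def proj_pt_def)

lemma higher_deriv_rat_fun_quotient:
  assumes "poly B z \<noteq> 0"
  shows "(deriv ^^ l) (rat_fun (to_fract A / to_fract B)) z = (deriv ^^ l) (ratio A B) z"
proof (rule higher_deriv_cong_ev)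
  have "open {w. poly B w \<noteq> 0}" by (intro open_Collect_neq continuous_intros)
  hence "eventually (\<lambda>w. w \<in> {w. poly B w \<noteq> 0}) (nhds z)"
    using assms by (intro eventually_nhds_in_open) auto
  thus "eventually (\<lambda>w. rat_fun (to_fract A / to_fract B) w = poly A w / poly B w) (nhds z)"
    by eventually_elim (simp add: rat_fun_quotient)
qed simp

lemma pade_rat_deriv_dist:
  assumes "pade_D c p q" "\<not> (poly (jacobi_num c \<zeta> p q) z = 0 \<and> poly (jacobi_den c \<zeta> p q) z = 0)"
  shows "rat_deriv_dist (pade c \<zeta> p q) l z w =
    (if poly (jacobi_den c \<zeta> p q) z = 0 then \<infinity>
     else ennreal (cmod ((deriv ^^ l) (ratio (jacobi_num c \<zeta> p q) (jacobi_den c \<zeta> p q)) z - w)))"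
proof -
  have "jacobi_den c \<zeta> p q \<noteq> 0" using pade_eq_jacobi(1)[OF assms(1), of \<zeta>] by auto
  from is_rat_pole_quotient[OF this assms(2)] show ?thesis
    unfolding rat_deriv_dist_def pade_eq_jacobi(2)[OF assms(1)]
    by (simp add: higher_deriv_rat_fun_quotient)
qed

lemma pade_rat_sphere:
  assumes "pade_D c p q" "\<not> (poly (jacobi_num c \<zeta> p q) z = 0 \<and> poly (jacobi_den c \<zeta> p q) z = 0)"
  shows "rat_sphere (pade c \<zeta> p q) z = proj_pt (poly (jacobi_num c \<zeta> p q) z) (poly (jacobi_den c \<zeta> p q) z)"
proof -
  have "jacobi_den c \<zeta> p q \<noteq> 0" using pade_eq_jacobi(1)[OF assms(1), of \<zeta>] by auto
  thus ?thesis unfolding pade_eq_jacobi(2)[OF assms(1)] using assms(2) by (rule rat_sphere_quotient)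
qed

text \<open>The numerator over \<open>B ^ Suc l\<close> of the \<open>l\<close>-th derivative of
  \<open>A / B\<close>, by the quotient rule. Its polynomial dependence on \<open>A\<close> and
  \<open>B\<close> makes derivatives continuous in the coefficients.\<close>

fun quot_deriv :: "nat \<Rightarrow> complex poly \<Rightarrow> complex poly \<Rightarrow> complex poly" where
  "quot_deriv 0 A B = A"
| "quot_deriv (Suc l) A B = pderiv (quot_deriv l A B) * B -
     Polynomial.smult (of_nat (Suc l)) (quot_deriv l A B * pderiv B)"

lemma higher_deriv_quotient:
  "poly B z \<noteq> 0 \<Longrightarrow> (deriv ^^ l) (ratio A B) z = poly (quot_deriv l A B) z / poly B z ^ Suc l"
proof (induction l arbitrary: z)
  case (Suc l)
  let ?N = "quot_deriv l A B"
  have "open {w. poly B w \<noteq> 0}" by (intro open_Collect_neq continuous_intros)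
  hence "eventually (\<lambda>w. w \<in> {w. poly B w \<noteq> 0}) (nhds z)"
    using Suc.prems by (intro eventually_nhds_in_open) auto
  hence "eventually (\<lambda>w. (deriv ^^ l) (ratio A B) w = poly ?N w / poly B w ^ Suc l) (nhds z)"
    by eventually_elim (use Suc.IH in auto)
  hence "(deriv ^^ Suc l) (ratio A B) z = deriv (\<lambda>w. poly ?N w / poly B w ^ Suc l) z"
    by (simp add: deriv_cong_ev)
  also have "\<dots> = poly (quot_deriv (Suc l) A B) z / poly B z ^ Suc (Suc l)"
  proof (rule DERIV_imp_deriv)
    have "((\<lambda>w. poly ?N w / poly B w ^ Suc l) has_field_derivative
       (poly (pderiv ?N) z * poly B z ^ Suc l - poly ?N z * (of_nat (Suc l) * (poly (pderiv B) z * poly B z ^ l)))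
         / (poly B z ^ Suc l * poly B z ^ Suc l)) (at z)"
      using Suc.prems by (intro DERIV_divide poly_DERIV DERIV_power_Suc[OF poly_DERIV, THEN DERIV_cong]) (auto simp: algebra_simps)
    moreover have "(poly (pderiv ?N) z * poly B z ^ Suc l - poly ?N z * (of_nat (Suc l) * (poly (pderiv B) z * poly B z ^ l)))
         / (poly B z ^ Suc l * poly B z ^ Suc l) = poly (quot_deriv (Suc l) A B) z / poly B z ^ Suc (Suc l)"
      using Suc.prems by (simp add: divide_simps)
    ultimately show "((\<lambda>w. poly ?N w / poly B w ^ Suc l) has_field_derivative
       poly (quot_deriv (Suc l) A B) z / poly B z ^ Suc (Suc l)) (at z)" by simp
  qed
  finally show ?case .
qed simp

section \<open>Stability of good Pade approximation\<close>

text \<open>The common degree bound belongs to the notion because coefficientwise convergence alone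
  does not give convergence of values. Sequences suit the compactness argument for
  stability.\<close>

definition poly_tends :: "(nat \<Rightarrow> complex poly) \<Rightarrow> complex poly \<Rightarrow> bool" where
  "poly_tends P Q \<longleftrightarrow> (\<exists>d. \<forall>i. degree (P i) \<le> d) \<and>
     (\<forall>k. (\<lambda>i. poly.coeff (P i) k) \<longlonglongrightarrow> poly.coeff Q k)"

lemma poly_tends_const [intro]: "poly_tends (\<lambda>_. P) P"
  by (auto simp: poly_tends_def)

lemma poly_tends_pCons:
  "c \<longlonglongrightarrow> c' \<Longrightarrow> poly_tends P Q \<Longrightarrow> poly_tends (\<lambda>i. pCons (c i) (P i)) (pCons c' Q)"
  unfolding poly_tends_def
proof (elim conjE exE, intro conjI allI)
  fix d assume "\<forall>i. degree (P i) \<le> d"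
  thus "\<exists>d. \<forall>i. degree (pCons (c i) (P i)) \<le> d"
    by (intro exI[of _ "Suc d"]) (auto intro: order.trans[OF degree_pCons_le])
qed (auto simp: coeff_pCons split: nat.split)

lemma poly_tends_const_poly: "c \<longlonglongrightarrow> c' \<Longrightarrow> poly_tends (\<lambda>i. [:c i:]) [:c':]"
  by (intro poly_tends_pCons poly_tends_const)

lemma poly_tends_add:
  assumes "poly_tends P Q" "poly_tends P' Q'"
  shows "poly_tends (\<lambda>i. P i + P' i) (Q + Q')"
proof -
  obtain d d' where "\<And>i. degree (P i) \<le> d" "\<And>i. degree (P' i) \<le> d'"
    using assms by (auto simp: poly_tends_def)
  hence "degree (P i + P' i) \<le> max d d'" for i
    by (intro degree_add_le) (auto intro: le_max_iff_disj[THEN iffD2])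
  thus ?thesis using assms by (auto simp: poly_tends_def intro!: tendsto_add)
qed

lemma poly_tends_mult:
  assumes "poly_tends P Q" "poly_tends P' Q'"
  shows "poly_tends (\<lambda>i. P i * P' i) (Q * Q')"
proof -
  obtain d d' where "\<And>i. degree (P i) \<le> d" "\<And>i. degree (P' i) \<le> d'"
    using assms by (auto simp: poly_tends_def)
  hence "degree (P i * P' i) \<le> d + d'" for i
    by (intro order.trans[OF degree_mult_le] add_mono)
  thus ?thesis using assms by (auto simp: poly_tends_def coeff_mult intro!: tendsto_sum tendsto_mult)
qed

lemma poly_tends_smult:
  assumes "c \<longlonglongrightarrow> c'" "poly_tends P Q"
  shows "poly_tends (\<lambda>i. Polynomial.smult (c i) (P i)) (Polynomial.smult c' Q)"
  using poly_tends_mult[OF poly_tends_const_poly[OF assms(1)] assms(2)] by simp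

lemma poly_tends_diff:
  assumes "poly_tends P Q" "poly_tends P' Q'"
  shows "poly_tends (\<lambda>i. P i - P' i) (Q - Q')"
  using poly_tends_add[OF assms(1) poly_tends_smult[OF tendsto_const[of "-1"] assms(2)]] by simp

lemma poly_tends_sum:
  assumes "\<And>x. x \<in> S \<Longrightarrow> poly_tends (P x) (Q x)"
  shows "poly_tends (\<lambda>i. \<Sum>x\<in>S. P x i) (\<Sum>x\<in>S. Q x)"
  using assms by (induction S rule: infinite_finite_induct) (auto intro!: poly_tends_add)

lemma poly_tends_prod:
  assumes "\<And>x. x \<in> S \<Longrightarrow> poly_tends (P x) (Q x)"
  shows "poly_tends (\<lambda>i. \<Prod>x\<in>S. P x i) (\<Prod>x\<in>S. Q x)"
  using assms by (induction S rule: infinite_finite_induct) (auto intro!: poly_tends_mult)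

lemma poly_tends_power: "poly_tends P Q \<Longrightarrow> poly_tends (\<lambda>i. P i ^ n) (Q ^ n)"
  by (induction n) (auto intro!: poly_tends_mult)

lemma poly_tends_pderiv:
  assumes "poly_tends P Q"
  shows "poly_tends (\<lambda>i. pderiv (P i)) (pderiv Q)"
proof -
  obtain d where "\<And>i. degree (P i) \<le> d" using assms by (auto simp: poly_tends_def)
  hence "degree (pderiv (P i)) \<le> d" for i by (simp add: degree_pderiv diff_le_self order.trans[OF diff_le_self])
  thus ?thesis using assms by (auto simp: poly_tends_def coeff_pderiv intro!: tendsto_mult)
qed

lemma poly_eq_sum_bound:
  fixes P :: "complex poly"
  assumes "degree P \<le> d"
  shows "poly P z = (\<Sum>k\<le>d. poly.coeff P k * z ^ k)"
  unfolding poly_altdef using assms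
  by (intro sum.mono_neutral_left) (auto simp: coeff_eq_0)

lemma poly_tends_eval:
  assumes "poly_tends P Q" "z \<longlonglongrightarrow> w"
  shows "(\<lambda>i. poly (P i) (z i)) \<longlonglongrightarrow> poly Q w"
proof -
  obtain d where d: "\<And>i. degree (P i) \<le> d" using assms by (auto simp: poly_tends_def)
  have "poly.coeff Q k = 0" if "k > d" for k
  proof -
    have "(\<lambda>i. poly.coeff (P i) k) = (\<lambda>i. 0)" using d that le_less_trans by (metis coeff_eq_0)
    moreover have "(\<lambda>i. poly.coeff (P i) k) \<longlonglongrightarrow> poly.coeff Q k" using assms(1) by (simp add: poly_tends_def)
    ultimately show ?thesis using LIMSEQ_unique tendsto_const by metis
  qed
  hence "degree Q \<le> d" using degree_le by blast
  thus ?thesis using assms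
    by (auto simp: poly_eq_sum_bound[OF d] poly_eq_sum_bound poly_tends_def intro!: tendsto_intros)
qed

lemma poly_tends_det:
  assumes "\<And>i. M i \<in> carrier_mat n n" "N \<in> carrier_mat n n"
    and "\<And>r s. r < n \<Longrightarrow> s < n \<Longrightarrow> poly_tends (\<lambda>i. M i $$ (r, s)) (N $$ (r, s))"
  shows "poly_tends (\<lambda>i. Determinant.det (M i)) (Determinant.det N)"
proof -
  have "poly_tends (\<lambda>i. \<Sum>p\<in>{p. p permutes {0..<n}}. signof p * (\<Prod>r = 0..<n. M i $$ (r, p r)))
      (\<Sum>p\<in>{p. p permutes {0..<n}}. signof p * (\<Prod>r = 0..<n. N $$ (r, p r)))"
    by (intro poly_tends_sum poly_tends_mult poly_tends_const poly_tends_prod assms(3))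
       (auto simp: permutes_in_image)
  thus ?thesis by (simp add: det_def'[OF assms(1)] det_def'[OF assms(2)])
qed

lemma coeff_int_tendsto:
  assumes "\<And>k. k \<le> N \<Longrightarrow> (\<lambda>i. c i k) \<longlonglongrightarrow> c' k" "k \<le> int N"
  shows "(\<lambda>i. coeff_int (c i) k) \<longlonglongrightarrow> coeff_int c' k"
  using assms by (auto simp: coeff_int_def)

lemma poly_tends_linear_power:
  assumes "\<zeta> \<longlonglongrightarrow> \<zeta>'"
  shows "poly_tends (\<lambda>i. [:- \<zeta> i, 1:] ^ n) ([:- \<zeta>', 1:] ^ n)"
  by (intro poly_tends_power poly_tends_pCons poly_tends_const tendsto_minus assms)

lemma poly_tends_partial_sum:
  assumes "\<And>k. k \<le> N \<Longrightarrow> (\<lambda>i. c i k) \<longlonglongrightarrow> c' k" "\<zeta> \<longlonglongrightarrow> \<zeta>'" "k \<le> int N"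
  shows "poly_tends (\<lambda>i. partial_sum (c i) (\<zeta> i) k) (partial_sum c' \<zeta>' k)"
  using assms by (cases "k < 0")
    (auto simp: partial_sum_def intro!: poly_tends_sum poly_tends_smult poly_tends_linear_power)

lemma poly_tends_jacobi_num:
  assumes "\<And>k. k \<le> p + q \<Longrightarrow> (\<lambda>i. c i k) \<longlonglongrightarrow> c' k" "\<zeta> \<longlonglongrightarrow> \<zeta>'"
  shows "poly_tends (\<lambda>i. jacobi_num (c i) (\<zeta> i) p q) (jacobi_num c' \<zeta>' p q)"
  unfolding jacobi_num_def
  by (rule poly_tends_det)
     (auto intro!: poly_tends_mult poly_tends_linear_power poly_tends_partial_sum[where N = "p + q"]
       poly_tends_const_poly coeff_int_tendsto[where N = "p + q"] assms)

lemma poly_tends_jacobi_den: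
  assumes "\<And>k. k \<le> p + q \<Longrightarrow> (\<lambda>i. c i k) \<longlonglongrightarrow> c' k" "\<zeta> \<longlonglongrightarrow> \<zeta>'"
  shows "poly_tends (\<lambda>i. jacobi_den (c i) (\<zeta> i) p q) (jacobi_den c' \<zeta>' p q)"
  unfolding jacobi_den_def
  by (rule poly_tends_det)
     (auto intro!: poly_tends_linear_power poly_tends_const_poly coeff_int_tendsto[where N = "p + q"] assms)

text \<open>Up to sign the Hankel determinant is the weight with \<open>j = q\<close>, the constant
  coefficient of a determinant that converges in the sense of \<open>poly_tends\<close>; a nonzero
  limit forces eventually nonzero terms.\<close>

lemma pade_D_eventually:
  assumes "\<And>k. k \<le> p + q \<Longrightarrow> (\<lambda>i. c i k) \<longlonglongrightarrow> c' k" "pade_D c' p q"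
  shows "eventually (\<lambda>i. pade_D (c i) p q) sequentially"
proof -
  have cof: "poly_tends (\<lambda>i. jacobi_cof (c i) p q q) (jacobi_cof c' p q q)"
    unfolding jacobi_cof_def cofactor_def
    by (intro poly_tends_mult poly_tends_const poly_tends_det[where n = q])
       (auto simp: mat_delete_def jacobi_mat_def intro!: poly_tends_const_poly coeff_int_tendsto[where N = "p + q"] assms)
  have "(\<lambda>i. jacobi_weight (c i) p q q) \<longlonglongrightarrow> jacobi_weight c' p q q"
    unfolding jacobi_weight_def using cof by (auto simp: poly_tends_def)
  moreover have "jacobi_weight c' p q q \<noteq> 0" using assms(2) jacobi_weight_last by blast
  ultimately have "eventually (\<lambda>i. jacobi_weight (c i) p q q \<noteq> 0) sequentially"
    by (rule tendsto_imp_eventually_ne)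
  thus ?thesis by (simp add: jacobi_weight_last)
qed

lemma poly_tends_quot_deriv:
  assumes "poly_tends A A'" "poly_tends B B'"
  shows "poly_tends (\<lambda>i. quot_deriv l (A i) (B i)) (quot_deriv l A' B')"
  by (induction l) (auto intro!: assms poly_tends_diff poly_tends_mult poly_tends_pderiv poly_tends_smult tendsto_const
      simp del: of_nat_Suc)

text \<open>Here \<open>c\<close> and \<open>d\<close> are the Taylor coefficients of the function at \<open>\<zeta>\<close> and at \<open>z\<close>; the latter matter only
  for \<open>z \<in> X\<close>.\<close>

definition pade_good :: "nat \<Rightarrow> nat \<Rightarrow> nat \<Rightarrow> real \<Rightarrow> complex set \<Rightarrow> complex set \<Rightarrow> ratfun \<Rightarrow>
    (nat \<Rightarrow> complex) \<Rightarrow> complex \<Rightarrow> (nat \<Rightarrow> complex) \<Rightarrow> complex \<Rightarrow> bool" where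
  "pade_good p q N \<epsilon> X Y h c \<zeta> d z \<longleftrightarrow>
     (let A = jacobi_num c \<zeta> p q; B = jacobi_den c \<zeta> p q in
     pade_D c p q \<and> (poly A z \<noteq> 0 \<or> poly B z \<noteq> 0) \<and>
     (z \<in> X \<longrightarrow> poly B z \<noteq> 0 \<and>
       (\<forall>l\<le>N. cmod ((deriv ^^ l) (ratio A B) z - fact l * d l) < \<epsilon>)) \<and>
     (z \<in> Y \<longrightarrow> chordal (proj_pt (poly A z) (poly B z)) (rat_sphere h z) < \<epsilon>))"

text \<open>If the limit point lies outside the closed set \<open>X\<close> or \<open>Y\<close>, so
  do the points eventually, and the clause for that set is vacuous. Otherwise each clause is a
  nonvanishing or a strict inequality for quantities that converge; \<open>quot_deriv\<close> covers
  the derivatives.\<close>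

lemma eventually_pade_good:
  assumes good: "pade_good p q N \<epsilon> X Y h c' \<zeta>' d' z'"
    and c: "\<And>k. k \<le> p + q \<Longrightarrow> (\<lambda>i. c i k) \<longlonglongrightarrow> c' k"
    and d: "\<And>k. z' \<in> X \<Longrightarrow> k \<le> N \<Longrightarrow> (\<lambda>i. d i k) \<longlonglongrightarrow> d' k"
    and \<zeta>: "\<zeta> \<longlonglongrightarrow> \<zeta>'" and z: "z \<longlonglongrightarrow> z'"
    and XY: "closed X" "closed Y" 
  shows "eventually (\<lambda>i. pade_good p q N \<epsilon> X Y h (c i) (\<zeta> i) (d i) (z i)) sequentially"
proof -
  let ?A' = "jacobi_num c' \<zeta>' p q" and ?B' = "jacobi_den c' \<zeta>' p q"
  let ?A = "\<lambda>i. jacobi_num (c i) (\<zeta> i) p q" and ?B = "\<lambda>i. jacobi_den (c i) (\<zeta> i) p q"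
  note pt = poly_tends_jacobi_num[OF c \<zeta>] poly_tends_jacobi_den[OF c \<zeta>]
  have g: "pade_D c' p q" "poly ?A' z' \<noteq> 0 \<or> poly ?B' z' \<noteq> 0"
    "z' \<in> X \<Longrightarrow> poly ?B' z' \<noteq> 0"
    "\<And>l. z' \<in> X \<Longrightarrow> l \<le> N \<Longrightarrow> cmod ((deriv ^^ l) (ratio ?A' ?B') z' - fact l * d' l) < \<epsilon>"
    "z' \<in> Y \<Longrightarrow> chordal (proj_pt (poly ?A' z') (poly ?B' z')) (rat_sphere h z') < \<epsilon>"
    using good unfolding pade_good_def Let_def by auto
  have At: "(\<lambda>i. poly (?A i) (z i)) \<longlonglongrightarrow> poly ?A' z'" and Bt: "(\<lambda>i. poly (?B i) (z i)) \<longlonglongrightarrow> poly ?B' z'"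
    using pt z by (auto intro: poly_tends_eval)
  have 1: "eventually (\<lambda>i. pade_D (c i) p q) sequentially"
    by (rule pade_D_eventually[OF c g(1)])
  have 2: "eventually (\<lambda>i. poly (?A i) (z i) \<noteq> 0 \<or> poly (?B i) (z i) \<noteq> 0) sequentially"
    using g(2)
  proof
    assume "poly ?A' z' \<noteq> 0"
    from tendsto_imp_eventually_ne[OF At this] show ?thesis by eventually_elim auto
  next
    assume "poly ?B' z' \<noteq> 0"
    from tendsto_imp_eventually_ne[OF Bt this] show ?thesis by eventually_elim auto
  qed
  have 3: "eventually (\<lambda>i. z i \<in> X \<longrightarrow> poly (?B i) (z i) \<noteq> 0 \<and>
       (\<forall>l\<le>N. cmod ((deriv ^^ l) (ratio (?A i) (?B i)) (z i) - fact l * d i l) < \<epsilon>)) sequentially"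
  proof (cases "z' \<in> X")
    case False
    hence "eventually (\<lambda>i. z i \<in> - X) sequentially"
      using topological_tendstoD[OF z, of "- X"] XY by auto
    thus ?thesis by eventually_elim auto
  next
    case True
    have ev: "eventually (\<lambda>i. cmod (poly (quot_deriv l (?A i) (?B i)) (z i) / poly (?B i) (z i) ^ Suc l - fact l * d i l) < \<epsilon>) sequentially"
      if l: "l \<le> N" for l
    proof (rule order_tendstoD)
      show "(\<lambda>i. cmod (poly (quot_deriv l (?A i) (?B i)) (z i) / poly (?B i) (z i) ^ Suc l - fact l * d i l)) \<longlonglongrightarrow>
         cmod (poly (quot_deriv l ?A' ?B') z' / poly ?B' z' ^ Suc l - fact l * d' l)"
        using g(3)[OF True] True l pt z Bt
        by (intro tendsto_intros d poly_tends_eval[OF poly_tends_quot_deriv]) auto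
      show "cmod (poly (quot_deriv l ?A' ?B') z' / poly ?B' z' ^ Suc l - fact l * d' l) < \<epsilon>"
        using g(4)[OF True l] higher_deriv_quotient[OF g(3)[OF True], of l] by simp
    qed
    have "eventually (\<lambda>i. \<forall>l\<in>{..N}. cmod (poly (quot_deriv l (?A i) (?B i)) (z i) / poly (?B i) (z i) ^ Suc l - fact l * d i l) < \<epsilon>) sequentially"
      using ev by (intro eventually_ball_finite) auto
    with tendsto_imp_eventually_ne[OF Bt g(3)[OF True]] show ?thesis
      by eventually_elim (auto simp: higher_deriv_quotient simp del: power_Suc)
  qed
  have 4: "eventually (\<lambda>i. z i \<in> Y \<longrightarrow> chordal (proj_pt (poly (?A i) (z i)) (poly (?B i) (z i))) (rat_sphere h (z i)) < \<epsilon>) sequentially"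
  proof (cases "z' \<in> Y")
    case False
    hence "eventually (\<lambda>i. z i \<in> - Y) sequentially"
      using topological_tendstoD[OF z, of "- Y"] XY by auto
    thus ?thesis by eventually_elim auto
  next
    case True
    let ?q = "quot_of_fract h"
    have nz: "poly (fst ?q) z' \<noteq> 0 \<or> poly (snd ?q) z' \<noteq> 0"
      using coprime_poly_no_common_root[OF coprime_quot_of_fract[of h]] by blast
    have "(\<lambda>i. chordal (proj_pt (poly (?A i) (z i)) (poly (?B i) (z i))) (rat_sphere h (z i))) \<longlonglongrightarrow>
        chordal (proj_pt (poly ?A' z') (poly ?B' z')) (rat_sphere h z')"
      unfolding rat_sphere_eq_proj_pt
      by (intro chordal_tendsto At Bt nz g(2) tendsto_intros z)
    from order_tendstoD(2)[OF this g(5)[OF True]] show ?thesis by eventually_elim auto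
  qed
  from 1 2 3 4 show ?thesis unfolding pade_good_def Let_def by eventually_elim blast
qed

text \<open>Failure for every radius \<open>1 / Suc i\<close> yields bad centres and points. By
  compactness a subsequence converges inside \<open>X \<times> (X \<union> Y)\<close>, where
  \<open>eventually_pade_good\<close> contradicts badness. Hence one radius serves all centres and
  points.\<close>

lemma pade_good_stable:
  fixes a :: "complex \<Rightarrow> nat \<Rightarrow> complex"
  assumes "compact X" "compact Y" "X \<inter> Y = {}"
    and a: "\<And>k. continuous_on X (\<lambda>\<zeta>. a \<zeta> k)"
    and good: "\<And>\<zeta> z. \<zeta> \<in> X \<Longrightarrow> z \<in> X \<union> Y \<Longrightarrow> pade_good p q N \<epsilon> X Y h (a \<zeta>) \<zeta> (a z) z"
    and J: "p + q \<le> J" "N \<le> J"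
  obtains \<delta> where "\<delta> > 0"
    "\<And>b \<zeta> z. \<forall>\<zeta>\<in>X. \<forall>k\<le>J. cmod (b \<zeta> k - a \<zeta> k) < \<delta> \<Longrightarrow> \<zeta> \<in> X \<Longrightarrow> z \<in> X \<union> Y \<Longrightarrow>
       pade_good p q N \<epsilon> X Y h (b \<zeta>) \<zeta> (b z) z"
proof (rule ccontr)
  assume contr: "\<not> thesis"
  have "\<exists>b \<zeta> z. (\<forall>\<zeta>\<in>X. \<forall>k\<le>J. cmod (b \<zeta> k - a \<zeta> k) < 1 / Suc i) \<and> \<zeta> \<in> X \<and> z \<in> X \<union> Y \<and>
       \<not> pade_good p q N \<epsilon> X Y h (b \<zeta>) \<zeta> (b z) z" for i
  proof (rule ccontr)
    assume "\<not> ?thesis"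
    hence thesis by (intro that[of "1 / Suc i"]) (simp, blast)
    with contr show False ..
  qed
  then obtain b \<zeta> z where b: "\<And>i x k. x \<in> X \<Longrightarrow> k \<le> J \<Longrightarrow> cmod (b i x k - a x k) < 1 / Suc i"
    and \<zeta>: "\<And>i. \<zeta> i \<in> X" and z: "\<And>i. z i \<in> X \<union> Y"
    and bad: "\<And>i. \<not> pade_good p q N \<epsilon> X Y h (b i (\<zeta> i)) (\<zeta> i) (b i (z i)) (z i)"
    by metis
  have "compact (X \<times> (X \<union> Y))" using assms by (intro compact_Times compact_Un)
  moreover have "\<forall>i. (\<zeta> i, z i) \<in> X \<times> (X \<union> Y)" using \<zeta> z by auto
  ultimately obtain l r where lr: "l \<in> X \<times> (X \<union> Y)" "strict_mono r" "((\<lambda>i. (\<zeta> i, z i)) \<circ> r) \<longlonglongrightarrow> l"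
    unfolding compact_def by meson
  obtain \<zeta>' z' where l: "l = (\<zeta>', z')" by force
  have t: "(\<lambda>i. \<zeta> (r i)) \<longlonglongrightarrow> \<zeta>'" "(\<lambda>i. z (r i)) \<longlonglongrightarrow> z'"
    using tendsto_fst[OF lr(3)] tendsto_snd[OF lr(3)] by (simp_all add: l o_def)
  have zero: "(\<lambda>i. 1 / real (Suc (r i))) \<longlonglongrightarrow> 0"
    using LIMSEQ_subseq_LIMSEQ[OF LIMSEQ_inverse_real_of_nat lr(2)] by (simp add: o_def inverse_eq_divide)
  have conv: "(\<lambda>i. b (r i) (x i) k) \<longlonglongrightarrow> a x' k"
    if "x \<longlonglongrightarrow> x'" "eventually (\<lambda>i. x i \<in> X) sequentially" "x' \<in> X" "k \<le> J" for x x' k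
  proof -
    have 1: "(\<lambda>i. a (x i) k) \<longlonglongrightarrow> a x' k"
      by (rule continuous_on_tendsto_compose[OF a that(1,3,2)])
    have "(\<lambda>i. b (r i) (x i) k - a (x i) k) \<longlonglongrightarrow> 0"
      by (rule Lim_null_comparison[OF _ zero], rule eventually_mono[OF that(2)])
         (use b \<open>k \<le> J\<close> in \<open>fastforce intro: less_imp_le\<close>)
    from tendsto_add[OF this 1] show ?thesis by simp
  qed
  have "eventually (\<lambda>i. pade_good p q N \<epsilon> X Y h (b (r i) (\<zeta> (r i))) (\<zeta> (r i)) (b (r i) (z (r i))) (z (r i))) sequentially"
  proof (rule eventually_pade_good[OF good])
    show "\<zeta>' \<in> X" "z' \<in> X \<union> Y" using lr l by auto
    show "(\<lambda>i. b (r i) (\<zeta> (r i)) k) \<longlonglongrightarrow> a \<zeta>' k" if "k \<le> p + q" for k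
      using that J \<open>\<zeta>' \<in> X\<close> \<zeta> by (intro conv t) auto
    show "(\<lambda>i. b (r i) (z (r i)) k) \<longlonglongrightarrow> a z' k" if "z' \<in> X" "k \<le> N" for k
    proof (intro conv t that)
      \<comment> \<open>The coefficients are known to be close only at points of \<open>X\<close>.
        The closed set \<open>Y\<close> misses the limit, so the points are eventually in
        \<open>X\<close>.\<close>
      have "open (- Y)" "z' \<in> - Y" using assms that compact_imp_closed by blast+
      from topological_tendstoD[OF t(2) this] show "eventually (\<lambda>i. z (r i) \<in> X) sequentially"
        by eventually_elim (use z in auto)
      show "k \<le> J" using that J by simp
    qed
  qed (use assms t compact_imp_closed in auto)
  thus False by (simp add: bad)
qed

section \<open>Uniform approximation by rational functions\<close>

text \<open>\<open>P\<close> is the set of allowed poles. With \<open>P\<close> disjoint from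
  \<open>X\<close> this class is an algebra closed under uniform limits on \<open>X\<close>, and
  pole pushing amounts to showing that \<open>1 / (z - a)\<close> belongs to it for further
  \<open>a\<close>.\<close>

definition rat_approx :: "complex set \<Rightarrow> complex set \<Rightarrow> (complex \<Rightarrow> complex) \<Rightarrow> bool" where
  "rat_approx X P f \<longleftrightarrow> (\<forall>e>0. \<exists>A B. B \<noteq> 0 \<and> (\<forall>z. poly B z = 0 \<longrightarrow> z \<in> P) \<and>
     (\<forall>z\<in>X. cmod (f z - poly A z / poly B z) < e))"

lemma rat_approxI:
  assumes "B \<noteq> 0" "\<And>z. poly B z = 0 \<Longrightarrow> z \<in> P" "\<And>z. z \<in> X \<Longrightarrow> f z = poly A z / poly B z"
  shows "rat_approx X P f"
  unfolding rat_approx_def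
proof (intro allI impI)
  fix e :: real assume "e > 0"
  thus "\<exists>A B. B \<noteq> 0 \<and> (\<forall>z. poly B z = 0 \<longrightarrow> z \<in> P) \<and> (\<forall>z\<in>X. cmod (f z - poly A z / poly B z) < e)"
    using assms by (intro exI[of _ A] exI[of _ B]) simp
qed

lemma rat_approxE:
  assumes "rat_approx X P f" "e > 0"
  obtains A B where "B \<noteq> 0" "\<And>z. poly B z = 0 \<Longrightarrow> z \<in> P" "\<And>z. z \<in> X \<Longrightarrow> cmod (f z - poly A z / poly B z) < e"
  using assms(1)[unfolded rat_approx_def, rule_format, OF assms(2)] that by blast

lemma rat_approx_limit:
  assumes "\<And>e. e > 0 \<Longrightarrow> \<exists>g. rat_approx X P g \<and> (\<forall>z\<in>X. cmod (f z - g z) < e)"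
  shows "rat_approx X P f"
  unfolding rat_approx_def
proof (intro allI impI)
  fix e :: real assume e: "e > 0"
  obtain g where g: "rat_approx X P g" "\<And>z. z \<in> X \<Longrightarrow> cmod (f z - g z) < e / 2"
    using assms[of "e / 2"] e by auto
  obtain A B where AB: "B \<noteq> 0" "\<And>z. poly B z = 0 \<Longrightarrow> z \<in> P" "\<And>z. z \<in> X \<Longrightarrow> cmod (g z - poly A z / poly B z) < e / 2"
    by (rule rat_approxE[OF g(1) half_gt_zero[OF e]]) blast
  have "cmod (f z - poly A z / poly B z) < e" if "z \<in> X" for z
    using norm_triangle_ineq[of "f z - g z" "g z - poly A z / poly B z"] g(2)[OF that] AB(3)[OF that] by simp
  with AB(1,2) show "\<exists>A B. B \<noteq> 0 \<and> (\<forall>z. poly B z = 0 \<longrightarrow> z \<in> P) \<and> (\<forall>z\<in>X. cmod (f z - poly A z / poly B z) < e)"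
    by (intro exI[of _ A] exI[of _ B]) simp
qed

lemma rat_approx_cong: "(\<And>z. z \<in> X \<Longrightarrow> f z = g z) \<Longrightarrow> rat_approx X P f \<longleftrightarrow> rat_approx X P g"
  by (simp add: rat_approx_def)

locale approx_set =
  fixes X P :: "complex set"
  assumes compact_X: "compact X" and disjoint_P: "P \<inter> X = {}"
begin

lemma rat_approx_poly: "rat_approx X P (poly A)"
  by (rule rat_approxI[of 1 _ _ _ A]) auto

lemma rat_approx_const: "rat_approx X P (\<lambda>_. c)"
  by (rule rat_approxI[of 1 _ _ _ "[:c:]"]) auto

lemma rat_approx_add:
  assumes "rat_approx X P f" "rat_approx X P g"
  shows "rat_approx X P (\<lambda>z. f z + g z)"
  unfolding rat_approx_def
proof (intro allI impI)
  fix e :: real assume e: "e > 0"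
  obtain A B where AB: "B \<noteq> 0" "\<And>z. poly B z = 0 \<Longrightarrow> z \<in> P" "\<And>z. z \<in> X \<Longrightarrow> cmod (f z - poly A z / poly B z) < e / 2"
    by (rule rat_approxE[OF assms(1) half_gt_zero[OF e]]) blast
  obtain C D where CD: "D \<noteq> 0" "\<And>z. poly D z = 0 \<Longrightarrow> z \<in> P" "\<And>z. z \<in> X \<Longrightarrow> cmod (g z - poly C z / poly D z) < e / 2"
    by (rule rat_approxE[OF assms(2) half_gt_zero[OF e]]) blast
  have "cmod (f z + g z - poly (A * D + C * B) z / poly (B * D) z) < e" if z: "z \<in> X" for z
  proof -
    have nz: "poly B z \<noteq> 0" "poly D z \<noteq> 0" using AB CD disjoint_P z by blast+
    have "f z + g z - poly (A * D + C * B) z / poly (B * D) z =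
        (f z - poly A z / poly B z) + (g z - poly C z / poly D z)"
      using nz by (simp add: add_divide_distrib)
    also have "cmod \<dots> < e"
      using norm_triangle_ineq[of "f z - poly A z / poly B z" "g z - poly C z / poly D z"] AB(3)[OF z] CD(3)[OF z]
      by simp
    finally show ?thesis .
  qed
  moreover have "poly (B * D) z = 0 \<Longrightarrow> z \<in> P" for z using AB CD by auto
  moreover have "B * D \<noteq> 0" using AB CD by auto
  ultimately show "\<exists>A B. B \<noteq> 0 \<and> (\<forall>z. poly B z = 0 \<longrightarrow> z \<in> P) \<and> (\<forall>z\<in>X. cmod (f z + g z - poly A z / poly B z) < e)"
    by (intro exI[of _ "A * D + C * B"] exI[of _ "B * D"]) simp
qed

lemma rational_bounded:
  assumes "\<And>z. poly B z = 0 \<Longrightarrow> z \<in> P"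
  obtains M where "M > 0" "\<And>z. z \<in> X \<Longrightarrow> cmod (poly A z / poly B z) \<le> M"
proof -
  have "continuous_on X (ratio A B)"
    using assms disjoint_P by (intro continuous_intros) blast
  hence "bounded ((ratio A B) ` X)"
    using compact_X compact_continuous_image compact_imp_bounded by blast
  thus thesis using that unfolding bounded_pos by auto
qed

lemma rat_approx_mult:
  assumes "rat_approx X P f" "rat_approx X P g"
  shows "rat_approx X P (\<lambda>z. f z * g z)"
  unfolding rat_approx_def
proof (intro allI impI)
  fix e :: real assume e: "e > 0"
  \<comment> \<open>A crude approximant, taken only to bound \<open>f\<close> on \<open>X\<close>.
    The tolerance for \<open>g\<close> depends on this bound, and that for the final approximant of
    \<open>f\<close> on the bound \<open>M\<close> for the approximant of \<open>g\<close>.\<close>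
  obtain A0 B0 where AB0: "B0 \<noteq> 0" "\<And>z. poly B0 z = 0 \<Longrightarrow> z \<in> P" "\<And>z. z \<in> X \<Longrightarrow> cmod (f z - poly A0 z / poly B0 z) < 1"
    by (rule rat_approxE[OF assms(1), of 1]) (simp, blast)
  obtain M0 where M0: "M0 > 0" "\<And>z. z \<in> X \<Longrightarrow> cmod (poly A0 z / poly B0 z) \<le> M0"
    using rational_bounded[OF AB0(2)] by blast
  have fM: "cmod (f z) \<le> M0 + 1" if "z \<in> X" for z
    using norm_triangle_ineq[of "f z - poly A0 z / poly B0 z" "poly A0 z / poly B0 z"] AB0(3)[OF that] M0(2)[OF that]
    by simp
  obtain C D where CD: "D \<noteq> 0" "\<And>z. poly D z = 0 \<Longrightarrow> z \<in> P" "\<And>z. z \<in> X \<Longrightarrow> cmod (g z - poly C z / poly D z) < e / (2 * (M0 + 1))"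
  proof -
    have "e / (2 * (M0 + 1)) > 0" using e M0 by simp
    from rat_approxE[OF assms(2) this] show ?thesis using that by metis
  qed
  obtain M where M: "M > 0" "\<And>z. z \<in> X \<Longrightarrow> cmod (poly C z / poly D z) \<le> M"
    using rational_bounded[OF CD(2)] by blast
  obtain A B where AB: "B \<noteq> 0" "\<And>z. poly B z = 0 \<Longrightarrow> z \<in> P" "\<And>z. z \<in> X \<Longrightarrow> cmod (f z - poly A z / poly B z) < e / (2 * M)"
  proof -
    have "e / (2 * M) > 0" using e M by simp
    from rat_approxE[OF assms(1) this] show ?thesis using that by metis
  qed
  have "cmod (f z * g z - poly (A * C) z / poly (B * D) z) < e" if z: "z \<in> X" for z
  proof -
    have "f z * g z - poly (A * C) z / poly (B * D) z =
        f z * (g z - poly C z / poly D z) + (f z - poly A z / poly B z) * (poly C z / poly D z)"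
      by (simp add: algebra_simps)
    hence "cmod (f z * g z - poly (A * C) z / poly (B * D) z) \<le>
        cmod (f z) * cmod (g z - poly C z / poly D z) + cmod (f z - poly A z / poly B z) * cmod (poly C z / poly D z)"
      using norm_triangle_ineq by (metis norm_mult)
    also have "\<dots> < (M0 + 1) * (e / (2 * (M0 + 1))) + (e / (2 * M)) * M"
    proof (rule add_less_le_mono)
      have "cmod (f z) * cmod (g z - poly C z / poly D z) \<le> (M0 + 1) * cmod (g z - poly C z / poly D z)"
        using fM[OF z] by (intro mult_right_mono) auto
      also have "\<dots> < (M0 + 1) * (e / (2 * (M0 + 1)))"
        using CD(3)[OF z] M0 by (intro mult_strict_left_mono) auto
      finally show "cmod (f z) * cmod (g z - poly C z / poly D z) < (M0 + 1) * (e / (2 * (M0 + 1)))" .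
      show "cmod (f z - poly A z / poly B z) * cmod (poly C z / poly D z) \<le> (e / (2 * M)) * M"
        using AB(3)[OF z] M(2)[OF z] e M(1) by (intro mult_mono) auto
    qed
    also have "\<dots> = e"
    proof -
      have half: "x * (e / (2 * x)) = e / 2" if "x > 0" for x :: real using that by simp
      show ?thesis using half[of "M0 + 1"] half[of M] M0(1) M(1) by (simp only: mult.commute[of "e / (2 * M)"])
    qed
    finally show ?thesis .
  qed
  moreover have "poly (B * D) z = 0 \<Longrightarrow> z \<in> P" for z using AB CD by auto
  moreover have "B * D \<noteq> 0" using AB CD by auto
  ultimately show "\<exists>A B. B \<noteq> 0 \<and> (\<forall>z. poly B z = 0 \<longrightarrow> z \<in> P) \<and> (\<forall>z\<in>X. cmod (f z * g z - poly A z / poly B z) < e)"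
    by (intro exI[of _ "A * C"] exI[of _ "B * D"]) simp
qed

lemma rat_approx_sum:
  assumes "\<And>i. i \<in> S \<Longrightarrow> rat_approx X P (f i)"
  shows "rat_approx X P (\<lambda>z. \<Sum>i\<in>S. f i z)"
  using assms by (induction S rule: infinite_finite_induct) (auto intro: rat_approx_const rat_approx_add)

lemma rat_approx_power: "rat_approx X P f \<Longrightarrow> rat_approx X P (\<lambda>z. f z ^ n)"
  by (induction n) (auto intro: rat_approx_const rat_approx_mult)

lemma rat_approx_diff:
  assumes "rat_approx X P f" "rat_approx X P g"
  shows "rat_approx X P (\<lambda>z. f z - g z)"
  using rat_approx_add[OF assms(1) rat_approx_mult[OF rat_approx_const[of "-1"] assms(2)]] by simp

text \<open>Partial sums of the geometric series, with tail at most \<open>2 * (1 / 2) ^ n\<close>.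
  Every move of a pole rests on this.\<close>

lemma rat_approx_geometric:
  assumes g: "rat_approx X P g" "\<And>z. z \<in> X \<Longrightarrow> cmod (g z) \<le> 1 / 2"
  shows "rat_approx X P (\<lambda>z. 1 / (1 - g z))"
proof (rule rat_approx_limit)
  fix e :: real assume "e > 0"
  then obtain n where n: "(1 / 2 :: real) ^ n < e / 2" using real_arch_pow_inv[of "e / 2" "1 / 2"] by auto
  have "cmod (1 / (1 - g z) - (\<Sum>k<n. g z ^ k)) < e" if z: "z \<in> X" for z
  proof -
    have ne: "g z \<noteq> 1" using g(2)[OF z] by auto
    have "(\<Sum>k<n. g z ^ k) = (1 - g z ^ n) / (1 - g z)" using ne by (simp add: sum_gp_strict)
    hence "1 / (1 - g z) - (\<Sum>k<n. g z ^ k) = g z ^ n / (1 - g z)"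
      using ne by (simp add: diff_divide_distrib)
    hence "cmod (1 / (1 - g z) - (\<Sum>k<n. g z ^ k)) = cmod (g z) ^ n / cmod (1 - g z)"
      by (simp add: norm_divide norm_power)
    also have "\<dots> \<le> (1 / 2) ^ n / (1 / 2)"
    proof (rule frac_le)
      show "cmod (g z) ^ n \<le> (1 / 2) ^ n" using g(2)[OF z] by (intro power_mono) auto
      show "1 / 2 \<le> cmod (1 - g z)" using norm_triangle_ineq2[of 1 "g z"] g(2)[OF z] by simp
    qed auto
    also have "\<dots> < e" using n by simp
    finally show ?thesis .
  qed
  moreover have "rat_approx X P (\<lambda>z. \<Sum>k<n. g z ^ k)"
    by (intro rat_approx_sum rat_approx_power g)
  ultimately show "\<exists>h. rat_approx X P h \<and> (\<forall>z\<in>X. cmod (1 / (1 - g z) - h z) < e)" by blast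
qed

lemma rat_approx_pole: "a \<in> P \<Longrightarrow> rat_approx X P (\<lambda>z. 1 / (z - a))"
  by (rule rat_approxI[of "[:-a, 1:]" _ _ _ 1]) auto

text \<open>Factor \<open>1 / (z - b)\<close> as \<open>1 / (z - a)\<close> times
  \<open>1 / (1 - (b - a) / (z - a))\<close>, a geometric series of ratio at most 1/2 on
  \<open>X\<close>.\<close>

lemma rat_approx_pole_near:
  assumes "rat_approx X P (\<lambda>z. 1 / (z - a))" "\<And>z. z \<in> X \<Longrightarrow> 2 * cmod (b - a) \<le> cmod (z - a)" "a \<notin> X"
  shows "rat_approx X P (\<lambda>z. 1 / (z - b))"
proof -
  have "rat_approx X P (\<lambda>z. 1 / (z - a) * (1 / (1 - (b - a) * (1 / (z - a)))))"
  proof (intro rat_approx_mult assms(1) rat_approx_geometric rat_approx_const)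
    fix z assume z: "z \<in> X"
    hence "cmod (z - a) > 0" using assms(3) by auto
    thus "cmod ((b - a) * (1 / (z - a))) \<le> 1 / 2"
      using assms(2)[OF z] by (simp add: norm_divide norm_mult field_simps)
  qed
  moreover have "1 / (z - a) * (1 / (1 - (b - a) * (1 / (z - a)))) = 1 / (z - b)" if z: "z \<in> X" for z
  proof -
    have "z - a \<noteq> 0" using assms(3) z by auto
    hence "(z - a) * (1 - (b - a) * (1 / (z - a))) = z - b" by (simp add: right_diff_distrib)
    thus ?thesis by (metis divide_divide_eq_left mult_1_right times_divide_eq_right)
  qed
  ultimately show ?thesis by (subst rat_approx_cong[OF sym]) auto
qed

text \<open>Whether \<open>1 / (z - x)\<close> is approximable is locally constant in
  \<open>x\<close> off \<open>X\<close>, hence constant on a connected set.\<close>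

lemma rat_approx_pole_connected:
  assumes "connected U" "U \<inter> X = {}" "a \<in> U" "b \<in> U" "rat_approx X P (\<lambda>z. 1 / (z - b))"
  shows "rat_approx X P (\<lambda>z. 1 / (z - a))"
proof -
  let ?R = "\<lambda>x y. rat_approx X P (\<lambda>z. 1 / (z - x)) \<longleftrightarrow> rat_approx X P (\<lambda>z. 1 / (z - y))"
  have "?R a b"
  proof (rule connected_equivalence_relation[OF assms(1,3,4), of ?R])
    fix x assume x: "x \<in> U"
    then obtain d where d: "d > 0" "\<And>z. z \<in> X \<Longrightarrow> d \<le> dist x z"
      using separate_point_closed[OF compact_imp_closed[OF compact_X], of x] assms(2) by blast
    \<comment> \<open>With \<open>d / 3\<close>, all points of \<open>X\<close> are at distance at
      least \<open>2 * d / 3\<close> from \<open>y\<close>, so \<open>rat_approx_pole_near\<close>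
      applies in both directions.\<close>
    have near: "?R x y" if y: "y \<in> U" "dist x y < d / 3" for y
    proof
      assume "rat_approx X P (\<lambda>z. 1 / (z - x))"
      thus "rat_approx X P (\<lambda>z. 1 / (z - y))"
      proof (rule rat_approx_pole_near)
        show "2 * cmod (y - x) \<le> cmod (z - x)" if "z \<in> X" for z
          using d(2)[OF that] y d(1) by (simp add: dist_norm norm_minus_commute)
      qed (use x assms in auto)
    next
      assume "rat_approx X P (\<lambda>z. 1 / (z - y))"
      thus "rat_approx X P (\<lambda>z. 1 / (z - x))"
      proof (rule rat_approx_pole_near)
        show "2 * cmod (x - y) \<le> cmod (z - y)" if "z \<in> X" for z
          using d(2)[OF that] y d(1) dist_triangle[of x z y] by (simp add: dist_norm norm_minus_commute)
      qed (use y assms in auto)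
    qed
    show "\<exists>T. openin (top_of_set U) T \<and> x \<in> T \<and> (\<forall>y\<in>T. ?R x y)"
    proof (intro exI conjI ballI)
      show "openin (top_of_set U) (U \<inter> ball x (d / 3))" by (simp add: openin_open_Int)
      show "x \<in> U \<inter> ball x (d / 3)" using x d(1) by simp
      show "?R x y" if "y \<in> U \<inter> ball x (d / 3)" for y using that by (intro near) auto
    qed
  qed auto
  thus ?thesis using assms(5) by blast
qed

text \<open>The pole is pushed to infinity: \<open>1 / (z - a)\<close> is expanded in powers of
  \<open>z / a\<close>, a ratio of modulus at most 1/2 on \<open>X\<close>.\<close>

lemma rat_approx_pole_far:
  assumes "\<And>z. z \<in> X \<Longrightarrow> cmod z \<le> R" "cmod a \<ge> 2 * R" "a \<noteq> 0"
  shows "rat_approx X P (\<lambda>z. 1 / (z - a))"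
proof -
  have "rat_approx X P (\<lambda>z. (- 1 / a) * (1 / (1 - (1 / a) * poly [:0, 1:] z)))"
  proof (intro rat_approx_mult rat_approx_geometric rat_approx_const rat_approx_poly)
    fix z assume z: "z \<in> X"
    show "cmod (1 / a * poly [:0, 1:] z) \<le> 1 / 2"
      using assms(1)[OF z] assms(2,3) by (simp add: norm_divide norm_mult field_simps)
  qed
  moreover have "(- 1 / a) * (1 / (1 - (1 / a) * poly [:0, 1:] z)) = 1 / (z - a)" for z
  proof -
    have "- a * (1 - (1 / a) * poly [:0, 1:] z) = z - a" using assms(3) by (simp add: algebra_simps)
    moreover have "(- 1 / a) * (1 / (1 - (1 / a) * poly [:0, 1:] z)) = 1 / (- a * (1 - (1 / a) * poly [:0, 1:] z))"
      by simp
    ultimately show ?thesis by simp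
  qed
  ultimately show ?thesis by simp
qed

lemma rat_approx_rational:
  assumes "B \<noteq> 0" "\<And>a. poly B a = 0 \<Longrightarrow> rat_approx X P (\<lambda>z. 1 / (z - a))"
  shows "rat_approx X P (ratio A B)"
proof -
  have "rat_approx X P (\<lambda>z. 1 / poly B z)"
    using assms
  proof (induction "degree B" arbitrary: B)
    case 0
    then obtain c where "B = [:c:]" by (metis degree_0_id)
    thus ?case by (simp add: rat_approx_const)
  next
    case (Suc n)
    hence "\<not> constant (poly B)" by (simp add: constant_degree)
    then obtain a where a: "poly B a = 0" using fundamental_theorem_of_algebra by blast
    then obtain C where C: "B = [:-a, 1:] * C" by (meson dvdE poly_eq_0_iff_dvd)
    have "C \<noteq> 0" using C Suc by auto
    hence "degree B = 1 + degree C" unfolding C by (subst degree_mult_eq) auto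
    hence "rat_approx X P (\<lambda>z. 1 / poly C z)"
      using Suc \<open>C \<noteq> 0\<close> by (intro Suc.hyps(1)) (auto simp: C)
    moreover have "rat_approx X P (\<lambda>z. 1 / (z - a))" using Suc a by blast
    ultimately have "rat_approx X P (\<lambda>z. 1 / (z - a) * (1 / poly C z))" by (intro rat_approx_mult)
    moreover have "poly B z = (z - a) * poly C z" for z unfolding C poly_mult by simp
    ultimately show ?case by simp
  qed
  from rat_approx_mult[OF rat_approx_poly[of A] this] show ?thesis by simp
qed

end

lemma higher_deriv_close:
  assumes "\<delta> > 0" "open W" "cball z \<delta> \<subseteq> W" "f holomorphic_on W" "g holomorphic_on W"
    and "\<And>w. w \<in> cball z \<delta> \<Longrightarrow> cmod (f w - g w) \<le> e"
  shows "cmod ((deriv ^^ l) f z - (deriv ^^ l) g z) \<le> fact l * e / \<delta> ^ l"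
proof -
  have hol: "(\<lambda>w. f w - g w) holomorphic_on W" using assms by (intro holomorphic_intros)
  have "cmod ((deriv ^^ l) (\<lambda>w. f w - g w) z) \<le> fact l * e / \<delta> ^ l"
  proof (rule Cauchy_inequality)
    show "(\<lambda>w. f w - g w) holomorphic_on ball z \<delta>"
      using hol assms(3) ball_subset_cball by (meson holomorphic_on_subset order.trans)
    show "continuous_on (cball z \<delta>) (\<lambda>w. f w - g w)"
      using hol assms(3) by (meson holomorphic_on_imp_continuous_on holomorphic_on_subset)
    show "cmod (f x - g x) \<le> e" if "cmod (z - x) = \<delta>" for x
      using that by (intro assms(6)) (auto simp: dist_norm)
  qed (rule assms)
  moreover have "(deriv ^^ l) (\<lambda>w. f w - g w) z = (deriv ^^ l) f z - (deriv ^^ l) g z"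
    using assms by (intro higher_deriv_diff[of _ W]) auto
  ultimately show ?thesis by simp
qed

lemma holomorphic_on_quotient_poly:
  "(\<And>z. z \<in> W \<Longrightarrow> poly B z \<noteq> 0) \<Longrightarrow> (ratio A B) holomorphic_on W" for A B :: "complex poly"
  by (intro holomorphic_on_divide holomorphic_on_poly)

lemma open_nonroots: "open {w::complex. poly B w \<noteq> 0}"
  by (intro open_Collect_neq continuous_intros)

section \<open>Separation of compact sets and pole pushing\<close>

text \<open>On the edge, \<open>1 / (w - z)\<close> expands in powers of
  \<open>(w - a) / (z - a)\<close>, with ratio at most 1/2 uniformly in \<open>z\<close>. The
  integrals of \<open>(w - a) ^ k\<close> are constants, so the integrated partial sums are rational
  in \<open>z\<close> with the single pole \<open>a\<close>.\<close>

lemma edge_rat_approx: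
  assumes Z: "compact Z" and ab: "a \<noteq> b" and far: "\<And>z. z \<in> Z \<Longrightarrow> 2 * cmod (b - a) \<le> cmod (z - a)"
  shows "rat_approx Z (- Z) (\<lambda>z. contour_integral (linepath a b) (\<lambda>w. 1 / (w - z)))"
proof -
  interpret approx_set Z "- Z" by unfold_locales (use Z in auto)
  have aZ: "a \<notin> Z" using far[of a] ab by auto
  define I where "I k = contour_integral (linepath a b) (\<lambda>w. (w - a) ^ k)" for k
  show ?thesis
  proof (rule rat_approx_limit)
    fix e :: real assume "e > 0"
    then obtain n where n: "(1 / 2 :: real) ^ n < e" using real_arch_pow_inv[of e "1 / 2"] by auto
    let ?g = "\<lambda>z. \<Sum>k<n. (- I k) * (1 / (z - a)) ^ Suc k"
    have "cmod (contour_integral (linepath a b) (\<lambda>w. 1 / (w - z)) - ?g z) < e" if z: "z \<in> Z" for z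
    proof -
      have za: "z \<noteq> a" using aZ z by auto
      have wa: "cmod (w - a) \<le> cmod (b - a)" if "w \<in> closed_segment a b" for w
        using segment_bound1[OF that] by (simp add: norm_minus_commute)
      have wz: "cmod (b - a) \<le> cmod (w - z)" if "w \<in> closed_segment a b" for w
        using norm_triangle_ineq2[of "z - a" "w - a"] wa[OF that] far[OF z]
        by (simp add: norm_minus_commute)
      hence zseg: "z \<notin> closed_segment a b" using ab by fastforce
      have int1: "((\<lambda>w. 1 / (w - z)) has_contour_integral contour_integral (linepath a b) (\<lambda>w. 1 / (w - z))) (linepath a b)"
        using zseg
        by (intro has_contour_integral_integral contour_integrable_continuous_linepath continuous_intros) auto
      have int2: "((\<lambda>w. \<Sum>k<n. (w - a) ^ k * (- ((1 / (z - a)) ^ Suc k))) has_contour_integral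
          (\<Sum>k<n. I k * (- ((1 / (z - a)) ^ Suc k)))) (linepath a b)"
        unfolding I_def
        by (intro has_contour_integral_sum has_contour_integral_rmul has_contour_integral_integral
            contour_integrable_continuous_linepath continuous_intros) auto
      have "cmod (contour_integral (linepath a b) (\<lambda>w. 1 / (w - z)) - (\<Sum>k<n. I k * (- ((1 / (z - a)) ^ Suc k))))
         \<le> ((1 / 2) ^ n / cmod (b - a)) * cmod (b - a)"
      proof (rule has_contour_integral_bound_linepath[OF has_contour_integral_diff[OF int1 int2]])
        fix w assume w: "w \<in> closed_segment a b"
        define x where "x = (w - a) / (z - a)"
        have x: "cmod x \<le> 1 / 2"
          using wa[OF w] far[OF z] za ab by (simp add: x_def norm_divide field_simps)
        have x1: "x \<noteq> 1" using x by auto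
        have wnz: "w \<noteq> z" using w zseg by auto
        have "(\<Sum>k<n. (w - a) ^ k * (- ((1 / (z - a)) ^ Suc k))) = - (1 / (z - a)) * (\<Sum>k<n. x ^ k)"
          unfolding sum_distrib_left by (rule sum.cong) (auto simp: x_def power_divide)
        also have "(\<Sum>k<n. x ^ k) = (1 - x ^ n) / (1 - x)" using x1 by (simp add: sum_gp_strict)
        also have "- (1 / (z - a)) * ((1 - x ^ n) / (1 - x)) = (1 - x ^ n) / (w - z)"
        proof -
          have "(z - a) * (1 - x) = - (w - z)" using za by (simp add: x_def right_diff_distrib)
          moreover have "- (1 / (z - a)) * ((1 - x ^ n) / (1 - x)) = - ((1 - x ^ n) / ((z - a) * (1 - x)))" by simp
          ultimately show ?thesis by (metis minus_divide_right minus_minus)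
        qed
        finally have "1 / (w - z) - (\<Sum>k<n. (w - a) ^ k * (- ((1 / (z - a)) ^ Suc k))) = x ^ n / (w - z)"
          by (simp add: diff_divide_distrib)
        hence "cmod (1 / (w - z) - (\<Sum>k<n. (w - a) ^ k * (- ((1 / (z - a)) ^ Suc k)))) = cmod x ^ n / cmod (w - z)"
          by (simp add: norm_divide norm_power)
        also have "\<dots> \<le> (1 / 2) ^ n / cmod (b - a)"
          using x wz[OF w] ab by (intro frac_le power_mono) auto
        finally show "cmod (1 / (w - z) - (\<Sum>k<n. (w - a) ^ k * (- ((1 / (z - a)) ^ Suc k)))) \<le> (1 / 2) ^ n / cmod (b - a)" .
      qed auto
      also have "\<dots> = (1 / 2) ^ n" using ab by simp
      finally show ?thesis using n by (simp add: sum_negf)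
    qed
    moreover have "rat_approx Z (- Z) ?g"
      using aZ by (intro rat_approx_sum rat_approx_mult rat_approx_const rat_approx_power rat_approx_pole) auto
    ultimately show "\<exists>g. rat_approx Z (- Z) g \<and> (\<forall>z\<in>Z. cmod (contour_integral (linepath a b) (\<lambda>w. 1 / (w - z)) - g z) < e)"
      by blast
  qed
qed

text \<open>The terms indexed by both \<open>S\<close> and its image cancel. With the shift to an
  adjacent square as \<open>\<sigma>\<close>, only the edges on the boundary of a union of squares
  remain.\<close>

lemma sum_shift_cancel:
  fixes f :: "'a \<Rightarrow> 'b :: ab_group_add"
  assumes "finite S" "inj_on \<sigma> S"
  shows "(\<Sum>x\<in>S. f x) - (\<Sum>x\<in>S. f (\<sigma> x)) = (\<Sum>x\<in>S - \<sigma> ` S. f x) - (\<Sum>x\<in>\<sigma> ` S - S. f x)"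
proof -
  have 1: "(\<Sum>x\<in>S. f (\<sigma> x)) = (\<Sum>x\<in>\<sigma> ` S. f x)" using assms(2) by (simp add: sum.reindex)
  have 2: "(\<Sum>x\<in>S. f x) = (\<Sum>x\<in>S - \<sigma> ` S. f x) + (\<Sum>x\<in>S \<inter> \<sigma> ` S. f x)"
    using assms(1) by (subst sum.union_disjoint[symmetric]) (auto simp: Un_Diff_Int intro: sum.cong)
  have 3: "(\<Sum>x\<in>\<sigma> ` S. f x) = (\<Sum>x\<in>\<sigma> ` S - S. f x) + (\<Sum>x\<in>S \<inter> \<sigma> ` S. f x)"
    using assms(1) by (subst sum.union_disjoint[symmetric]) (auto intro: sum.cong)
  show ?thesis unfolding 1 2 3 by simp
qed

section \<open>Cauchy integrals over the squares of a grid\<close>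

definition grid_pt :: "real \<Rightarrow> int \<Rightarrow> int \<Rightarrow> complex" where
  "grid_pt s i j = Complex (s * of_int i) (s * of_int j)"

text \<open>Edges are indexed by their left or lower end point and carry a fixed orientation, so
  that an edge shared by two squares is the same term with opposite signs.\<close>

definition h_edge :: "real \<Rightarrow> complex \<Rightarrow> int \<times> int \<Rightarrow> complex" where
  "h_edge s z = (\<lambda>(i, j). contour_integral (linepath (grid_pt s i j) (grid_pt s (i + 1) j)) (\<lambda>w. 1 / (w - z)))"

definition v_edge :: "real \<Rightarrow> complex \<Rightarrow> int \<times> int \<Rightarrow> complex" where
  "v_edge s z = (\<lambda>(i, j). contour_integral (linepath (grid_pt s i j) (grid_pt s i (j + 1))) (\<lambda>w. 1 / (w - z)))"

context
  fixes s :: real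
  assumes s: "s > 0"
begin

lemma floor_scaled: "s * of_int \<lfloor>x / s\<rfloor> \<le> x" "x < s * of_int \<lfloor>x / s\<rfloor> + s"
proof -
  show "s * of_int \<lfloor>x / s\<rfloor> \<le> x"
    using mult_left_mono[OF of_int_floor_le[of "x / s"], of s] s by simp
  have "s * (x / s) < s * (of_int \<lfloor>x / s\<rfloor> + 1)"
    using floor_correct[of "x / s"] s by (intro mult_strict_left_mono) auto
  thus "x < s * of_int \<lfloor>x / s\<rfloor> + s" using s by (simp add: distrib_left)
qed

text \<open>The left side is the Cauchy integral counterclockwise around the square with lower left
  corner \<open>(i, j)\<close>, so it is a winding number times \<open>2 \<pi> \<i>\<close>. The
  hypothesis \<open>gen\<close> keeps \<open>z\<close> off every grid line, and the floors name the
  square around \<open>z\<close>.\<close>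

lemma square_integral:
  assumes gen: "Re z / s \<notin> \<int>" "Im z / s \<notin> \<int>"
  shows "h_edge s z (i, j) - h_edge s z (i, j + 1) + v_edge s z (i + 1, j) - v_edge s z (i, j) =
    (if (i, j) = (\<lfloor>Re z / s\<rfloor>, \<lfloor>Im z / s\<rfloor>) then 2 * of_real pi * \<i> else 0)"
proof -
  define a1 a3 where "a1 = grid_pt s i j" and "a3 = grid_pt s (i + 1) (j + 1)"
  have ne: "Re z \<noteq> s * of_int k" "Im z \<noteq> s * of_int k" for k
    using gen s by auto
  have zseg: "z \<notin> closed_segment (grid_pt s i j) (grid_pt s (i + 1) j)" "z \<notin> closed_segment (grid_pt s i j) (grid_pt s i (j + 1))" for i j
    using ne by (auto simp: grid_pt_def closed_segment_same_Re closed_segment_same_Im)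
  have cont: "continuous_on (closed_segment (grid_pt s i j) (grid_pt s (i + 1) j)) (\<lambda>w. 1 / (w - z))"
     "continuous_on (closed_segment (grid_pt s i j) (grid_pt s i (j + 1))) (\<lambda>w. 1 / (w - z))" for i j
    using zseg[of i j] by (auto intro!: continuous_intros)
  have cont': "continuous_on (closed_segment (grid_pt s (i + 1) j) (grid_pt s i j)) (\<lambda>w. 1 / (w - z))"
     "continuous_on (closed_segment (grid_pt s i (j + 1)) (grid_pt s i j)) (\<lambda>w. 1 / (w - z))" for i j
    using cont[of i j] by (simp_all add: closed_segment_commute)
  note int = cont[THEN contour_integrable_continuous_linepath] cont'[THEN contour_integrable_continuous_linepath]
  have a24: "Complex (Re a3) (Im a1) = grid_pt s (i + 1) j" "Complex (Re a1) (Im a3) = grid_pt s i (j + 1)"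
    by (simp_all add: a1_def a3_def grid_pt_def)
  have "contour_integral (rectpath a1 a3) (\<lambda>w. 1 / (w - z)) =
      h_edge s z (i, j) + (v_edge s z (i + 1, j) + (- h_edge s z (i, j + 1) + - v_edge s z (i, j)))"
    unfolding rectpath_def Let_def a24 unfolding a1_def a3_def h_edge_def v_edge_def
    using int contour_integral_reverse_linepath[OF cont(1)[of i "j + 1"]] contour_integral_reverse_linepath[OF cont(2)[of i j]]
    by (simp add: contour_integrable_joinI)
  moreover have "path_image (rectpath a1 a3) \<subseteq> {w. Re w \<in> {s * of_int i, s * of_int (i + 1)} \<or> Im w \<in> {s * of_int j, s * of_int (j + 1)}}"
    using s by (subst path_image_rectpath) (auto simp: a1_def a3_def grid_pt_def)
  hence "z \<notin> path_image (rectpath a1 a3)"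
    using ne(1)[of i] ne(1)[of "i + 1"] ne(2)[of j] ne(2)[of "j + 1"] by auto
  hence "winding_number (rectpath a1 a3) z = 1 / (2 * pi * \<i>) * contour_integral (rectpath a1 a3) (\<lambda>w. 1 / (w - z))"
    by (intro winding_number_valid_path) auto
  hence "contour_integral (rectpath a1 a3) (\<lambda>w. 1 / (w - z)) = 2 * of_real pi * \<i> * winding_number (rectpath a1 a3) z"
    by simp
  moreover have "winding_number (rectpath a1 a3) z = (if (i, j) = (\<lfloor>Re z / s\<rfloor>, \<lfloor>Im z / s\<rfloor>) then 1 else 0)"
  proof (cases "(i, j) = (\<lfloor>Re z / s\<rfloor>, \<lfloor>Im z / s\<rfloor>)")
    case True
    have "s * of_int i < Re z \<and> Re z < s * of_int (i + 1)" "s * of_int j < Im z \<and> Im z < s * of_int (j + 1)"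
      using True ne(1)[of i] ne(2)[of j] floor_scaled[of "Re z"] floor_scaled[of "Im z"]
      by (auto simp: less_le distrib_left)
    hence "z \<in> box a1 a3" by (auto simp: in_box_complex_iff a1_def a3_def grid_pt_def)
    thus ?thesis using True by (simp add: winding_number_rectpath)
  next
    case False
    have "z \<notin> cbox a1 a3"
    proof
      assume "z \<in> cbox a1 a3"
      hence "s * of_int i \<le> Re z" "Re z \<le> s * of_int (i + 1)" "s * of_int j \<le> Im z" "Im z \<le> s * of_int (j + 1)"
        by (auto simp: in_cbox_complex_iff a1_def a3_def grid_pt_def)
      hence "s * of_int i \<le> Re z" "Re z < s * of_int (i + 1)" "s * of_int j \<le> Im z" "Im z < s * of_int (j + 1)"
        using ne(1)[of "i + 1"] ne(2)[of "j + 1"] by auto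
      hence "\<lfloor>Re z / s\<rfloor> = i" "\<lfloor>Im z / s\<rfloor> = j" using s by (auto simp: floor_eq_iff field_simps)
      thus False using False by simp
    qed
    moreover have "Re a1 \<le> Re a3" "Im a1 \<le> Im a3" using s by (auto simp: a1_def a3_def grid_pt_def)
    ultimately show ?thesis using False by (simp add: winding_number_rectpath_outside)
  qed
  ultimately show ?thesis by (auto simp: algebra_simps split: if_splits)
qed

lemma dist_grid_floor: "dist z (grid_pt s \<lfloor>Re z / s\<rfloor> \<lfloor>Im z / s\<rfloor>) \<le> 2 * s"
proof -
  have "\<bar>x - s * of_int \<lfloor>x / s\<rfloor>\<bar> \<le> s" for x
    using floor_scaled[of x] by (simp add: abs_le_iff)
  from this[of "Re z"] this[of "Im z"] show ?thesis
    using cmod_le[of "z - grid_pt s \<lfloor>Re z / s\<rfloor> \<lfloor>Im z / s\<rfloor>"] by (simp add: dist_norm grid_pt_def)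
qed

lemma dist_grid_neighbours:
  "dist (grid_pt s i j) (grid_pt s (i + 1) j) = s" "dist (grid_pt s i j) (grid_pt s i (j + 1)) = s"
  "dist (grid_pt s i j) (grid_pt s (i - 1) j) = s" "dist (grid_pt s i j) (grid_pt s i (j - 1)) = s"
proof -
  show "dist (grid_pt s i j) (grid_pt s (i + 1) j) = s" "dist (grid_pt s i j) (grid_pt s i (j + 1)) = s"
    "dist (grid_pt s i j) (grid_pt s (i - 1) j) = s" "dist (grid_pt s i j) (grid_pt s i (j - 1)) = s"
    using s by (simp_all add: dist_norm grid_pt_def norm_complex_def algebra_simps)
qed

lemma finite_grid_near:
  assumes "bounded X"
  shows "finite {(i, j). \<exists>x\<in>X. dist x (grid_pt s i j) \<le> r}"
proof -
  obtain M where M: "\<And>x. x \<in> X \<Longrightarrow> cmod x \<le> M" using assms by (auto simp: bounded_iff)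
  define k where "k = \<lceil>(M + r) / s\<rceil>"
  have "{(i, j). \<exists>x\<in>X. dist x (grid_pt s i j) \<le> r} \<subseteq> {-k..k} \<times> {-k..k}"
  proof
    fix y assume "y \<in> {(i, j). \<exists>x\<in>X. dist x (grid_pt s i j) \<le> r}"
    then obtain i j x where y: "y = (i, j)" and x: "x \<in> X" "dist x (grid_pt s i j) \<le> r" by auto
    have "cmod (grid_pt s i j) \<le> M + r"
      using M[OF x(1)] x(2) norm_triangle_ineq[of x "grid_pt s i j - x"] by (simp add: dist_norm norm_minus_commute)
    hence "\<bar>s * of_int i\<bar> \<le> M + r" "\<bar>s * of_int j\<bar> \<le> M + r"
      using abs_Re_le_cmod[of "grid_pt s i j"] abs_Im_le_cmod[of "grid_pt s i j"] by (auto simp: grid_pt_def)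
    hence "\<bar>of_int i\<bar> \<le> (M + r) / s" "\<bar>of_int j\<bar> \<le> (M + r) / s"
      using s by (auto simp: abs_mult field_simps)
    hence "\<bar>of_int i\<bar> \<le> real_of_int k" "\<bar>of_int j\<bar> \<le> real_of_int k"
      unfolding k_def using le_of_int_ceiling order.trans by blast+
    thus "y \<in> {-k..k} \<times> {-k..k}" unfolding y by auto
  qed
  thus ?thesis using finite_subset by blast
qed

end

text \<open>For small positive \<open>t\<close> the point \<open>x + t\<close> lies strictly between
  two consecutive multiples of \<open>s\<close>, even if \<open>x\<close> is a multiple
  itself.\<close>

lemma eventually_shift_not_int:
  fixes x s :: real
  assumes "s > 0"
  shows "eventually (\<lambda>t. (x + t) / s \<notin> \<int>) (at_right 0)"
proof -
  let ?u = "s * of_int (\<lfloor>x / s\<rfloor> + 1) - x"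
  have "?u > 0" using floor_scaled(2)[OF assms, of x] by (simp add: distrib_left)
  have "(x + t) / s \<notin> \<int>" if t: "0 < t" "t < ?u" for t
  proof
    assume "(x + t) / s \<in> \<int>"
    then obtain k where "(x + t) / s = of_int k" by (auto elim: Ints_cases)
    hence k: "x + t = s * of_int k" using assms by (simp add: field_simps)
    have "s * of_int \<lfloor>x / s\<rfloor> < s * of_int k" "s * of_int k < s * of_int (\<lfloor>x / s\<rfloor> + 1)"
      using floor_scaled(1)[OF assms, of x] t unfolding k[symmetric] by linarith+
    hence "of_int \<lfloor>x / s\<rfloor> < (of_int k :: real)" "of_int k < (of_int (\<lfloor>x / s\<rfloor> + 1) :: real)"
      using assms by (simp_all only: mult_less_cancel_left_pos)
    thus False unfolding of_int_less_iff by linarith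
  qed
  thus ?thesis using \<open>?u > 0\<close> unfolding eventually_at_right_field by blast
qed

text \<open>The sum of the Cauchy integrals over the squares of a fine grid that are near \<open>X\<close> is
  \<open>2 \<pi> \<i>\<close> near \<open>X\<close> and \<open>0\<close> near \<open>Y\<close>, except on the grid lines. The edges shared by two such squares cancel,
  and the remaining ones are far from \<open>X \<union> Y\<close>, so that their integrals are limits of rational
  functions; these are continuous on \<open>X \<union> Y\<close>, which takes care of the grid lines.\<close>

lemma rat_approx_separate:
  assumes X: "compact X" and Y: "compact Y" and XY: "X \<inter> Y = {}"
  shows "rat_approx (X \<union> Y) (- (X \<union> Y)) (\<lambda>z. if z \<in> X then 1 else 0)"
proof -
  obtain d where d: "d > 0" "\<And>x y. x \<in> X \<Longrightarrow> y \<in> Y \<Longrightarrow> d \<le> dist x y"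
    using separate_compact_closed[OF X compact_imp_closed[OF Y] XY] by blast
  \<comment> \<open>A corner of a boundary edge has distance at least \<open>7 * s\<close> from
    \<open>X\<close>, else its neighbour would also be within \<open>8 * s\<close>, and at most
    \<open>9 * s\<close> from some point of \<open>X\<close>, hence at least
    \<open>16 * s - 9 * s\<close> from \<open>Y\<close>. Passing to \<open>Z\<close> leaves
    \<open>6 * s\<close>, enough for \<open>edge_rat_approx\<close>, which asks for
    \<open>2 * s\<close>. For \<open>near\<close>, the distances \<open>3 * s\<close> and
    \<open>11 * s\<close> stay within \<open>8 * s\<close> and below \<open>16 * s\<close>.\<close>
  define s where "s = d / 16"
  have s: "s > 0" using d by (simp add: s_def)
  have XYd: "16 * s \<le> dist x y" if "x \<in> X" "y \<in> Y" for x y using d(2)[OF that] by (simp add: s_def)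
  define S where "S = {(i, j). \<exists>x\<in>X. dist x (grid_pt s i j) \<le> 8 * s}"
  have S_iff: "(i, j) \<in> S \<longleftrightarrow> (\<exists>x\<in>X. dist x (grid_pt s i j) \<le> 8 * s)" for i j by (simp add: S_def)
  have finS: "finite S" unfolding S_def using finite_grid_near[OF s compact_imp_bounded[OF X]] .
  \<comment> \<open>The closed neighbourhood of radius \<open>s\<close> leaves room to move a point
    of \<open>X \<union> Y\<close> off the grid lines.\<close>
  define Z where "Z = {x + y | x y. x \<in> X \<union> Y \<and> y \<in> cball 0 s}"
  have Z: "compact Z" unfolding Z_def using X Y by (intro compact_sums compact_Un compact_cball)
  have ZI: "z \<in> Z" if "x \<in> X \<union> Y" "dist x z \<le> s" for x z
    unfolding Z_def using that
    by (intro CollectI exI[of _ x] exI[of _ "z - x"]) (simp add: dist_norm norm_minus_commute)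
  have ZE: "\<exists>x\<in>X \<union> Y. dist x z \<le> s" if "z \<in> Z" for z
    using that unfolding Z_def by (auto simp: dist_norm intro!: bexI)
  interpret approx_set Z "- Z" by unfold_locales (use Z in auto)
  define \<sigma> \<tau> :: "int \<times> int \<Rightarrow> int \<times> int" where "\<sigma> = (\<lambda>(i, j). (i, j + 1))" and "\<tau> = (\<lambda>(i, j). (i + 1, j))"
  have inj: "inj_on \<sigma> S" "inj_on \<tau> S" by (auto simp: \<sigma>_def \<tau>_def inj_on_def)
  \<comment> \<open>The sum of the integrals around all squares in \<open>S\<close>, already reduced
    to unshared edges. Off the grid lines its value is \<open>G_generic\<close>; as a combination of
    edge integrals it is approximable on all of \<open>Z\<close>.\<close>
  define G where "G z = (\<Sum>x\<in>S - \<sigma> ` S. h_edge s z x) - (\<Sum>x\<in>\<sigma> ` S - S. h_edge s z x) -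
      ((\<Sum>x\<in>S - \<tau> ` S. v_edge s z x) - (\<Sum>x\<in>\<tau> ` S - S. v_edge s z x))" for z
  have boundary_far: "6 * s \<le> cmod (z - a)"
    if "z \<in> Z" "dist a a' = s" "a = grid_pt s i j" "a' = grid_pt s i' j'" "((i, j) \<in> S) \<noteq> ((i', j') \<in> S)" for z a a' i j i' j'
  proof -
    have far_X: "7 * s \<le> dist x a" if "x \<in> X" for x
    proof (rule ccontr)
      assume "\<not> 7 * s \<le> dist x a"
      hence "dist x a \<le> 8 * s" "dist x a' \<le> 8 * s"
        using s \<open>dist a a' = s\<close> dist_triangle[of x a' a] by auto
      hence "(i, j) \<in> S" "(i', j') \<in> S" using \<open>x \<in> X\<close> \<open>a = _\<close> \<open>a' = _\<close> by (auto simp: S_iff)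
      thus False using \<open>(_ \<in> S) \<noteq> _\<close> by simp
    qed
    have far_Y: "7 * s \<le> dist y a" if "y \<in> Y" for y
    proof -
      obtain x where x: "x \<in> X" "dist x a \<le> 9 * s"
      proof (cases "(i, j) \<in> S")
        case True
        then obtain x where "x \<in> X" "dist x a \<le> 8 * s" using \<open>a = _\<close> by (auto simp: S_iff)
        thus ?thesis using that s by auto
      next
        case False
        then obtain x where "x \<in> X" "dist x a' \<le> 8 * s" using \<open>a' = _\<close> \<open>(_ \<in> S) \<noteq> _\<close> by (auto simp: S_iff)
        thus ?thesis using that \<open>dist a a' = s\<close> dist_triangle[of x a a'] by (auto simp: dist_commute)
      qed
      thus ?thesis using XYd[OF x(1) \<open>y \<in> Y\<close>] dist_triangle[of x y a] by (simp add: dist_commute)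
    qed
    obtain x where x: "x \<in> X \<union> Y" "dist x z \<le> s" using ZE[OF \<open>z \<in> Z\<close>] by blast
    hence "7 * s \<le> dist x a" using far_X far_Y by blast
    thus ?thesis using x(2) dist_triangle[of x a z] by (simp add: dist_norm)
  qed
  have G_approx: "rat_approx Z (- Z) G"
  proof -
    have h: "rat_approx Z (- Z) (\<lambda>z. h_edge s z (i, j))" if "((i, j) \<in> S) \<noteq> ((i, j - 1) \<in> S)" for i j
      unfolding h_edge_def split
    proof (rule edge_rat_approx[OF Z])
      show "grid_pt s i j \<noteq> grid_pt s (i + 1) j" using dist_grid_neighbours(1)[OF s, of i j] s by auto
      show "2 * cmod (grid_pt s (i + 1) j - grid_pt s i j) \<le> cmod (z - grid_pt s i j)" if "z \<in> Z" for z
        using boundary_far[OF that dist_grid_neighbours(4)[OF s, of i j] refl refl] s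
          \<open>((i, j) \<in> S) \<noteq> _\<close> dist_grid_neighbours(1)[OF s, of i j] by (simp add: dist_norm norm_minus_commute)
    qed
    have v: "rat_approx Z (- Z) (\<lambda>z. v_edge s z (i, j))" if "((i, j) \<in> S) \<noteq> ((i - 1, j) \<in> S)" for i j
      unfolding v_edge_def split
    proof (rule edge_rat_approx[OF Z])
      show "grid_pt s i j \<noteq> grid_pt s i (j + 1)" using dist_grid_neighbours(2)[OF s, of i j] s by auto
      show "2 * cmod (grid_pt s i (j + 1) - grid_pt s i j) \<le> cmod (z - grid_pt s i j)" if "z \<in> Z" for z
        using boundary_far[OF that dist_grid_neighbours(3)[OF s, of i j] refl refl] s
          \<open>((i, j) \<in> S) \<noteq> _\<close> dist_grid_neighbours(2)[OF s, of i j] by (simp add: dist_norm norm_minus_commute)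
    qed
    have \<sigma>_iff: "(i, j) \<in> \<sigma> ` S \<longleftrightarrow> (i, j - 1) \<in> S" for i j by (force simp: \<sigma>_def image_iff)
    have \<tau>_iff: "(i, j) \<in> \<tau> ` S \<longleftrightarrow> (i - 1, j) \<in> S" for i j by (force simp: \<tau>_def image_iff)
    have hx: "rat_approx Z (- Z) (\<lambda>z. h_edge s z x)" if "(x \<in> S) \<noteq> (x \<in> \<sigma> ` S)" for x
      using h[of "fst x" "snd x"] that \<sigma>_iff[of "fst x" "snd x"] by simp
    have vx: "rat_approx Z (- Z) (\<lambda>z. v_edge s z x)" if "(x \<in> S) \<noteq> (x \<in> \<tau> ` S)" for x
      using v[of "fst x" "snd x"] that \<tau>_iff[of "fst x" "snd x"] by simp
    show ?thesis unfolding G_def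
      by (intro rat_approx_diff rat_approx_sum hx vx) blast+
  qed
  have G_generic: "G z = (if (\<lfloor>Re z / s\<rfloor>, \<lfloor>Im z / s\<rfloor>) \<in> S then 2 * of_real pi * \<i> else 0)"
    if "Re z / s \<notin> \<int>" "Im z / s \<notin> \<int>" for z
  proof -
    have "G z = (\<Sum>x\<in>S. h_edge s z x) - (\<Sum>x\<in>S. h_edge s z (\<sigma> x)) - ((\<Sum>x\<in>S. v_edge s z x) - (\<Sum>x\<in>S. v_edge s z (\<tau> x)))"
      unfolding G_def by (simp only: sum_shift_cancel[OF finS inj(1)] sum_shift_cancel[OF finS inj(2)])
    also have "\<dots> = (\<Sum>x\<in>S. h_edge s z x - h_edge s z (\<sigma> x) + v_edge s z (\<tau> x) - v_edge s z x)"
      by (simp add: sum_subtractf sum.distrib)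
    also have "\<dots> = (\<Sum>x\<in>S. if x = (\<lfloor>Re z / s\<rfloor>, \<lfloor>Im z / s\<rfloor>) then 2 * of_real pi * \<i> else 0)"
    proof (rule sum.cong[OF refl])
      fix x :: "int \<times> int"
      show "h_edge s z x - h_edge s z (\<sigma> x) + v_edge s z (\<tau> x) - v_edge s z x = (if x = (\<lfloor>Re z / s\<rfloor>, \<lfloor>Im z / s\<rfloor>) then 2 * of_real pi * \<i> else 0)"
        using square_integral[OF s that, of "fst x" "snd x"] by (simp add: \<sigma>_def \<tau>_def case_prod_beta)
    qed
    also have "\<dots> = (if (\<lfloor>Re z / s\<rfloor>, \<lfloor>Im z / s\<rfloor>) \<in> S then 2 * of_real pi * \<i> else 0)" using finS by simp
    finally show ?thesis .
  qed
  have near: "(\<lfloor>Re z / s\<rfloor>, \<lfloor>Im z / s\<rfloor>) \<in> S \<longleftrightarrow> z0 \<in> X" if z: "z0 \<in> X \<union> Y" "dist z0 z \<le> s" for z z0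
  proof -
    let ?v = "grid_pt s \<lfloor>Re z / s\<rfloor> \<lfloor>Im z / s\<rfloor>"
    have v: "dist z0 ?v \<le> 3 * s"
      using dist_grid_floor[OF s, of z] z(2) dist_triangle[of z0 ?v z] by simp
    show ?thesis
    proof
      assume "z0 \<in> X"
      thus "(\<lfloor>Re z / s\<rfloor>, \<lfloor>Im z / s\<rfloor>) \<in> S" unfolding S_iff using v s by (intro bexI[of _ z0]) auto
    next
      assume "(\<lfloor>Re z / s\<rfloor>, \<lfloor>Im z / s\<rfloor>) \<in> S"
      then obtain x where x: "x \<in> X" "dist x ?v \<le> 8 * s" unfolding S_iff by blast
      hence "dist x z0 \<le> 11 * s" using v dist_triangle[of x z0 ?v] by (simp add: dist_commute)
      thus "z0 \<in> X" using XYd[OF x(1), of z0] z(1) s by fastforce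
    qed
  qed
  have gen: "eventually (\<lambda>t. Re (z + of_real t * Complex 1 1) / s \<notin> \<int> \<and> Im (z + of_real t * Complex 1 1) / s \<notin> \<int> \<and>
      dist z (z + of_real t * Complex 1 1) \<le> s) (at_right 0)" for z
  proof -
    have "((\<lambda>t. dist z (z + of_real t * Complex 1 1)) \<longlongrightarrow> dist z (z + of_real 0 * Complex 1 1)) (at_right 0)"
      by (intro tendsto_intros)
    hence "eventually (\<lambda>t. dist z (z + of_real t * Complex 1 1) < s) (at_right 0)"
      by (rule order_tendstoD) (use s in auto)
    with eventually_shift_not_int[OF s, of "Re z"] eventually_shift_not_int[OF s, of "Im z"]
    show ?thesis by eventually_elim auto
  qed
  show ?thesis
    unfolding rat_approx_def
  proof (intro allI impI)
    fix e :: real assume e: "e > 0"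
    \<comment> \<open>The value reached on \<open>X\<close> is \<open>2 \<pi> \<i>\<close>; division
      by it turns the tolerance \<open>e * pi\<close> into \<open>e / 2\<close>.\<close>
    hence "e * pi > 0" by simp
    from rat_approxE[OF G_approx this] obtain A B where AB: "B \<noteq> 0" "\<And>z. poly B z = 0 \<Longrightarrow> z \<in> - Z"
      "\<And>z. z \<in> Z \<Longrightarrow> cmod (G z - poly A z / poly B z) < e * pi" by metis
    \<comment> \<open>A point \<open>z\<close> that may lie on a grid line is approached along the
      diagonal through points of \<open>Z\<close> off the lines. By continuity of the quotient the
      bound passes to the limit as a weak inequality.\<close>
    have bound: "cmod ((if z \<in> X then 2 * of_real pi * \<i> else 0) - poly A z / poly B z) \<le> e * pi" if z: "z \<in> X \<union> Y" for z
    proof -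
      let ?w = "\<lambda>t::real. z + of_real t * Complex 1 1"
      let ?c = "if z \<in> X then 2 * of_real pi * \<i> else 0"
      have Bz: "poly B z \<noteq> 0" using AB(2)[of z] ZI[OF z, of z] s by auto
      have wz: "((\<lambda>t. ?w t) \<longlongrightarrow> ?w 0) (at_right 0)" by (intro tendsto_intros)
      have "((\<lambda>t. cmod (?c - poly A (?w t) / poly B (?w t))) \<longlongrightarrow> cmod (?c - poly A (?w 0) / poly B (?w 0))) (at_right 0)"
        using Bz by (intro tendsto_intros) auto
      moreover have "eventually (\<lambda>t. cmod (?c - poly A (?w t) / poly B (?w t)) \<le> e * pi) (at_right 0)"
        using gen[of z]
      proof eventually_elim
        case (elim t)
        hence "G (?w t) = ?c" using G_generic[of "?w t"] near[OF z, of "?w t"] by simp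
        moreover have "?w t \<in> Z" using elim ZI[OF z] by blast
        ultimately show ?case using AB(3)[of "?w t"] by simp
      qed
      ultimately show ?thesis
        using tendsto_upperbound[of _ "cmod (?c - poly A (?w 0) / poly B (?w 0))" "at_right (0::real)" "e * pi"] by simp
    qed
    let ?A = "Polynomial.smult (1 / (2 * of_real pi * \<i>)) A"
    have "cmod ((if z \<in> X then 1 else 0) - poly ?A z / poly B z) < e" if z: "z \<in> X \<union> Y" for z
    proof -
      have "(if z \<in> X then 1 else 0) - poly ?A z / poly B z =
         ((if z \<in> X then 2 * of_real pi * \<i> else 0) - poly A z / poly B z) / (2 * of_real pi * \<i>)"
        by (simp add: diff_divide_distrib)
      also have "cmod \<dots> \<le> e * pi / (2 * pi)"
        unfolding norm_divide using bound[OF z] e by (intro frac_le) (auto simp: norm_mult)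
      also have "\<dots> < e" using e by simp
      finally show ?thesis .
    qed
    moreover have "z \<in> - (X \<union> Y)" if "poly B z = 0" for z
      using AB(2)[OF that] ZI[of z z] s by auto
    ultimately show "\<exists>A B. B \<noteq> 0 \<and> (\<forall>z. poly B z = 0 \<longrightarrow> z \<in> - (X \<union> Y)) \<and>
        (\<forall>z\<in>X \<union> Y. cmod ((if z \<in> X then 1 else 0) - poly A z / poly B z) < e)"
      using AB(1) by (intro exI[of _ ?A] exI[of _ B]) simp
  qed
qed

definition thick :: "real \<Rightarrow> complex set \<Rightarrow> complex set" where
  "thick \<delta> X = {z. infdist z X \<le> \<delta>}"

text \<open>The margin around \<open>X\<close> is what Cauchy's inequality needs to turn uniform
  closeness into closeness of derivatives. The cap \<open>\<delta> \<le> 1\<close> makes the powers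
  of \<open>\<delta>\<close> decrease with the exponent.\<close>

lemma thicken:
  assumes X: "compact X" "X \<noteq> {}" and C: "closed C" "X \<inter> C = {}"
  obtains \<delta> where "0 < \<delta>" "\<delta> \<le> 1" "compact (thick \<delta> X)" "thick \<delta> X \<inter> C = {}"
proof -
  obtain d where d: "d > 0" "\<And>x y. x \<in> X \<Longrightarrow> y \<in> C \<Longrightarrow> d \<le> dist x y"
    using separate_compact_closed[OF X(1) C] by blast
  define \<delta> where "\<delta> = min 1 (d / 2)"
  have "thick \<delta> X \<inter> C = {}"
  proof (rule ccontr)
    assume "\<not> ?thesis"
    then obtain y where y: "y \<in> C" "infdist y X \<le> \<delta>" by (auto simp: thick_def)
    have "d \<le> infdist y X"
      unfolding infdist_notempty[OF X(2)] using X(2) d(2)[OF _ y(1)] by (intro cINF_greatest) (auto simp: dist_commute)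
    thus False using y(2) d(1) by (auto simp: \<delta>_def min_def split: if_splits)
  qed
  moreover have "0 < \<delta>" "\<delta> \<le> 1" using d by (auto simp: \<delta>_def)
  moreover have "compact (thick \<delta> X)" unfolding thick_def
    using compact_infdist_le[OF X(2,1) \<open>0 < \<delta>\<close>] .
  ultimately show thesis using that by blast
qed

lemma cball_subset_thick: "x \<in> X \<Longrightarrow> cball x \<delta> \<subseteq> thick \<delta> X"
  unfolding thick_def by (auto simp: dist_commute intro: order.trans[OF infdist_le])

lemma subset_thick: "0 < \<delta> \<Longrightarrow> X \<subseteq> thick \<delta> X"
  unfolding thick_def by (auto simp: infdist_zero)

text \<open>Cauchy's inequality costs a factor \<open>fact l / \<delta> ^ l\<close>, at most
  \<open>fact J / \<delta> ^ J\<close> since \<open>\<delta> \<le> 1\<close>. The assumed tolerance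
  compensates this and leaves \<open>e / 2\<close> for every order up to \<open>J\<close>.\<close>

lemma derivs_close:
  assumes \<delta>: "0 < \<delta>" "\<delta> \<le> 1" and e: "e > 0"
    and nz: "\<And>w. w \<in> thick \<delta> X \<Longrightarrow> poly B w \<noteq> 0" "\<And>w. w \<in> thick \<delta> X \<Longrightarrow> poly B' w \<noteq> 0"
    and close: "\<And>w. w \<in> thick \<delta> X \<Longrightarrow> cmod (poly A w / poly B w - poly A' w / poly B' w) \<le> e * \<delta> ^ J / (2 * fact J)"
    and l: "l \<le> J" and z: "z \<in> X"
  shows "cmod ((deriv ^^ l) (ratio A B) z - (deriv ^^ l) (ratio A' B') z) < e"
proof -
  let ?W = "{w. poly B w \<noteq> 0} \<inter> {w. poly B' w \<noteq> 0}"
  have sub: "cball z \<delta> \<subseteq> thick \<delta> X" using z by (rule cball_subset_thick)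
  have "cmod ((deriv ^^ l) (ratio A B) z - (deriv ^^ l) (ratio A' B') z)
      \<le> fact l * (e * \<delta> ^ J / (2 * fact J)) / \<delta> ^ l"
    by (rule higher_deriv_close[OF \<delta>(1), of ?W])
       (use sub nz close in \<open>auto intro!: open_Int open_nonroots holomorphic_on_quotient_poly\<close>)
  also have "\<dots> \<le> fact J * (e * \<delta> ^ J / (2 * fact J)) / \<delta> ^ J"
    using \<delta> e l by (intro frac_le mult_right_mono fact_mono power_decreasing) auto
  also have "\<dots> = e / 2" using \<delta>(1) by simp
  finally show ?thesis using e by simp
qed

text \<open>A path to the new pole is taken instead of the whole component because its image is
  compact, so that \<open>X\<close> can be thickened without touching it. A bounded component
  supplies a point of \<open>P\<close>, an unbounded one a point far out.\<close>

lemma path_to_pole: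
  assumes X: "compact X" and a: "a \<notin> X"
    and hole: "bounded (connected_component_set (- X) a) \<Longrightarrow> \<exists>b\<in>connected_component_set (- X) a. b \<in> P"
  obtains U b where "compact U" "connected U" "U \<inter> X = {}" "a \<in> U" "b \<in> U" "b \<in> P \<or> cmod b \<ge> R"
proof -
  let ?C = "connected_component_set (- X) a"
  have aC: "a \<in> ?C" using a by simp
  have opC: "open ?C" using X by (intro open_connected_component) (simp add: compact_imp_closed open_Compl)
  have "path_connected ?C"
    using connected_open_path_connected[OF opC connected_connected_component] .
  moreover obtain b where b: "b \<in> ?C" "b \<in> P \<or> cmod b \<ge> R"
  proof (cases "bounded ?C")
    case True
    thus ?thesis using hole that by blast
  next
    case False
    then obtain b where "b \<in> ?C" "\<not> cmod b \<le> R" unfolding bounded_iff by blast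
    thus ?thesis using that[of b] by auto
  qed
  ultimately obtain g where g: "path g" "path_image g \<subseteq> ?C" "pathstart g = a" "pathfinish g = b"
    using aC unfolding path_connected_def by blast
  show thesis
  proof (rule that[of "path_image g" b])
    show "path_image g \<inter> X = {}" using g(2) connected_component_subset[of "- X" a] by blast
    show "a \<in> path_image g" "b \<in> path_image g" using g by (auto simp: pathstart_in_path_image pathfinish_in_path_image)
  qed (use g b in \<open>auto intro: compact_path_image connected_path_image\<close>)
qed

text \<open>The finitely many roots of \<open>B\<close> are moved along their paths, which avoid a
  common thickening of \<open>X\<close>, to a point of \<open>P\<close> or so far out that
  polynomials take over.\<close>

lemma runge_poles:
  assumes X: "compact X" "X \<noteq> {}" and B: "\<And>z. z \<in> X \<Longrightarrow> poly B z \<noteq> 0"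
    and hole: "\<And>a. a \<notin> X \<Longrightarrow> bounded (connected_component_set (- X) a) \<Longrightarrow>
       \<exists>b\<in>connected_component_set (- X) a. b \<in> P"
    and e: "e > 0"
  obtains A' B' where "B' \<noteq> 0" "\<And>z. poly B' z = 0 \<Longrightarrow> z \<in> P - X"
    "\<And>l z. l \<le> J \<Longrightarrow> z \<in> X \<Longrightarrow> cmod ((deriv ^^ l) (ratio A' B') z -
        (deriv ^^ l) (ratio A B) z) < e"
proof -
  have B0: "B \<noteq> 0" using X B by auto
  define roots where "roots = {a. poly B a = 0}"
  have fin: "finite roots" unfolding roots_def using B0 by (rule poly_roots_finite)
  obtain R where R: "\<And>x. x \<in> X \<Longrightarrow> cmod x \<le> R" using compact_imp_bounded[OF X(1)] by (auto simp: bounded_iff)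
  have R0: "R \<ge> 0" using R X(2) norm_ge_zero order.trans by blast
  \<comment> \<open>The thickening will lie in the disc of radius \<open>R + 2\<close>, and
    \<open>rat_approx_pole_far\<close> asks for twice that radius.\<close>
  have "\<forall>a\<in>roots. \<exists>U. compact U \<and> connected U \<and> U \<inter> X = {} \<and> a \<in> U \<and> (\<exists>b\<in>U. b \<in> P \<or> cmod b \<ge> 2 * (R + 2))"
  proof
    fix a assume "a \<in> roots"
    hence "a \<notin> X" using B by (auto simp: roots_def)
    from path_to_pole[OF X(1) this hole[OF this], where R = "2 * (R + 2)"]
    show "\<exists>U. compact U \<and> connected U \<and> U \<inter> X = {} \<and> a \<in> U \<and> (\<exists>b\<in>U. b \<in> P \<or> cmod b \<ge> 2 * (R + 2))"
      by metis
  qed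
  from bchoice[OF this] obtain U where U': "\<forall>a\<in>roots. compact (U a) \<and> connected (U a) \<and> U a \<inter> X = {} \<and> a \<in> U a \<and>
      (\<exists>b\<in>U a. b \<in> P \<or> cmod b \<ge> 2 * (R + 2))" by blast
  have U: "compact (U a)" "connected (U a)" "U a \<inter> X = {}" "a \<in> U a" "\<exists>b\<in>U a. b \<in> P \<or> cmod b \<ge> 2 * (R + 2)"
    if "a \<in> roots" for a using U' that by auto
  have "compact (\<Union>a\<in>roots. U a)" using fin U(1) by (rule compact_UN)
  hence "closed (\<Union>a\<in>roots. U a)" by (rule compact_imp_closed)
  moreover have "X \<inter> (\<Union>a\<in>roots. U a) = {}" using U(3) by blast
  ultimately obtain \<delta> where \<delta>: "0 < \<delta>" "\<delta> \<le> 1" "compact (thick \<delta> X)" "thick \<delta> X \<inter> (\<Union>a\<in>roots. U a) = {}"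
    by (rule thicken[OF X])
  have Bnz: "poly B w \<noteq> 0" if "w \<in> thick \<delta> X" for w
  proof
    assume "poly B w = 0"
    hence "w \<in> roots" by (simp add: roots_def)
    thus False using U(4)[of w] \<delta>(4) that by blast
  qed
  have thickR: "cmod w \<le> R + 2" if "w \<in> thick \<delta> X" for w
  proof -
    have "infdist w X < 2" using that \<delta>(2) by (simp add: thick_def)
    then obtain x where "x \<in> X" "dist w x < 2"
      unfolding infdist_notempty[OF X(2)] using X(2) by (subst (asm) cINF_less_iff) (auto intro!: bdd_belowI2[of _ 0])
    thus ?thesis using R[of x] norm_triangle_ineq[of x "w - x"] by (simp add: dist_norm)
  qed
  \<comment> \<open>Approximation takes place on the thickening, as \<open>derivs_close\<close>
    requires, so points of \<open>P\<close> inside it cannot serve as poles.\<close>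
  interpret approx_set "thick \<delta> X" "P - thick \<delta> X" by unfold_locales (use \<delta> in auto)
  have pole: "rat_approx (thick \<delta> X) (P - thick \<delta> X) (\<lambda>z. 1 / (z - a))" if "poly B a = 0" for a
  proof -
    have a: "a \<in> roots" using that by (simp add: roots_def)
    from U(5)[OF a] obtain b where b: "b \<in> U a" "b \<in> P \<or> cmod b \<ge> 2 * (R + 2)" by blast
    have "b \<notin> thick \<delta> X" using b(1) \<delta>(4) a by blast
    from b(2) have "rat_approx (thick \<delta> X) (P - thick \<delta> X) (\<lambda>z. 1 / (z - b))"
    proof
      assume "b \<in> P"
      thus ?thesis using \<open>b \<notin> thick \<delta> X\<close> by (intro rat_approx_pole) auto
    next
      assume "cmod b \<ge> 2 * (R + 2)"
      thus ?thesis using R0 thickR by (intro rat_approx_pole_far[of "R + 2"]) auto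
    qed
    thus ?thesis
      using rat_approx_pole_connected[OF U(2)[OF a] _ U(4)[OF a] b(1)] \<delta>(4) a by blast
  qed
  have "e * \<delta> ^ J / (2 * fact J) > 0" using e \<delta>(1) by simp
  from rat_approxE[OF rat_approx_rational[OF B0 pole] this, of A] obtain A' B' where AB: "B' \<noteq> 0"
    "\<And>z. poly B' z = 0 \<Longrightarrow> z \<in> P - thick \<delta> X"
    "\<And>z. z \<in> thick \<delta> X \<Longrightarrow> cmod (poly A z / poly B z - poly A' z / poly B' z) < e * \<delta> ^ J / (2 * fact J)" by metis
  have B'nz: "poly B' w \<noteq> 0" if "w \<in> thick \<delta> X" for w using AB(2)[of w] that by auto
  show thesis
  proof (rule that[of B' A'])
    show "z \<in> P - X" if "poly B' z = 0" for z
      using AB(2)[OF that] subset_thick[OF \<delta>(1), of X] by auto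
    show "cmod ((deriv ^^ l) (ratio A' B') z - (deriv ^^ l) (ratio A B) z) < e"
      if "l \<le> J" "z \<in> X" for l z
      using AB(3)
      by (intro derivs_close[OF \<delta>(1,2) e B'nz Bnz _ that]) (auto simp: norm_minus_commute less_imp_le)
  qed (rule AB)
qed

section \<open>Joining two rational functions on disjoint compact sets, and adjusting the
  degree\<close>

lemma continuous_positive_lower_bound:
  fixes f :: "complex \<Rightarrow> real"
  assumes "compact X" "continuous_on X f" "\<And>x. x \<in> X \<Longrightarrow> f x > 0"
  obtains c where "c > 0" "\<And>x. x \<in> X \<Longrightarrow> c \<le> f x"
proof (cases "X = {}")
  case True thus ?thesis using that[of 1] by auto
next
  case False
  then obtain x where "x \<in> X" "\<And>y. y \<in> X \<Longrightarrow> f x \<le> f y"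
    using continuous_attains_inf[OF assms(1) _ assms(2)] by blast
  thus ?thesis using that[of "f x"] assms(3) by blast
qed

lemma continuous_hnorm_poly: "continuous_on S (\<lambda>z. hnorm (poly A z) (poly B z))"
  unfolding hnorm_def by (intro continuous_intros)

lemma poly_bounded_compact:
  fixes A :: "complex poly"
  assumes "compact X"
  obtains M where "M > 0" "\<And>z. z \<in> X \<Longrightarrow> cmod (poly A z) \<le> M"
proof -
  have "bounded (poly A ` X)"
    using assms by (intro compact_imp_bounded compact_continuous_image continuous_intros)
  thus thesis using that unfolding bounded_pos by auto
qed

lemma proj_pt_scale: "c \<noteq> 0 \<Longrightarrow> proj_pt (c * A) (c * B) = proj_pt A B"
  by (auto simp: proj_pt_def)

lemma cancel_common_factor:
  fixes N D :: "complex poly"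
  assumes "D \<noteq> 0"
  obtains A B where "coprime A B" "B \<noteq> 0" "\<And>z. poly D z \<noteq> 0 \<Longrightarrow> poly B z \<noteq> 0 \<and> poly A z / poly B z = poly N z / poly D z"
    "\<And>z. poly N z \<noteq> 0 \<or> poly D z \<noteq> 0 \<Longrightarrow> proj_pt (poly A z) (poly B z) = proj_pt (poly N z) (poly D z)"
proof -
  let ?q = "quot_of_fract (to_fract N / to_fract D)"
  show thesis
  proof (rule that[of "fst ?q" "snd ?q"])
    show "coprime (fst ?q) (snd ?q)" by (rule coprime_quot_of_fract)
    show "snd ?q \<noteq> 0" by simp
    show "poly (snd ?q) z \<noteq> 0 \<and> poly (fst ?q) z / poly (snd ?q) z = poly N z / poly D z" if "poly D z \<noteq> 0" for z
      using rat_fun_quotient[OF that, of N] is_rat_pole_quotient[OF assms, of N z] that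
      by (auto simp: rat_fun_def is_rat_pole_def)
    show "proj_pt (poly (fst ?q) z) (poly (snd ?q) z) = proj_pt (poly N z) (poly D z)"
      if "poly N z \<noteq> 0 \<or> poly D z \<noteq> 0" for z
      using rat_sphere_quotient[OF assms, of N z] that by (simp add: rat_sphere_eq_proj_pt)
  qed
qed

text \<open>Interpolating the homogeneous coordinates \<open>(A1, B1)\<close> and \<open>(A2, B2)\<close>, instead of the quotients, avoids
  any special treatment of the poles in \<open>K\<close>.\<close>

lemma rational_merge:
  assumes X: "compact X" "X \<noteq> {}" and K: "compact K" "X \<inter> K = {}"
    and B1: "\<And>z. z \<in> X \<Longrightarrow> poly B1 z \<noteq> 0"
    and nz2: "\<And>z. z \<in> K \<Longrightarrow> poly A2 z \<noteq> 0 \<or> poly B2 z \<noteq> 0" and e: "e > 0"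
  obtains A B where "coprime A B" "\<And>z. z \<in> X \<Longrightarrow> poly B z \<noteq> 0"
    "\<And>l z. l \<le> J \<Longrightarrow> z \<in> X \<Longrightarrow> cmod ((deriv ^^ l) (ratio A B) z -
        (deriv ^^ l) (ratio A1 B1) z) < e"
    "\<And>z. z \<in> K \<Longrightarrow> chordal (proj_pt (poly A z) (poly B z)) (proj_pt (poly A2 z) (poly B2 z)) < e"
proof -
  have "B1 \<noteq> 0" using X B1 by auto
  hence "finite {a. poly B1 a = 0}" by (rule poly_roots_finite)
  hence "closed (K \<union> {a. poly B1 a = 0})"
    using compact_imp_closed[OF K(1)] finite_imp_closed by (intro closed_Un)
  moreover have "X \<inter> (K \<union> {a. poly B1 a = 0}) = {}" using K B1 by auto
  ultimately obtain \<delta> where \<delta>: "0 < \<delta>" "\<delta> \<le> 1" "compact (thick \<delta> X)" "thick \<delta> X \<inter> (K \<union> {a. poly B1 a = 0}) = {}"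
    by (rule thicken[OF X])
  let ?X = "thick \<delta> X"
  have XK: "?X \<inter> K = {}" and B1nz: "\<And>w. w \<in> ?X \<Longrightarrow> poly B1 w \<noteq> 0" using \<delta>(4) by auto
  have cXK: "compact (?X \<union> K)" using \<delta> K by (intro compact_Un)
  obtain M1 where M1: "M1 > 0" "\<And>z. z \<in> ?X \<union> K \<Longrightarrow> cmod (poly A1 z) \<le> M1" by (rule poly_bounded_compact[OF cXK, of A1]) blast
  obtain M2 where M2: "M2 > 0" "\<And>z. z \<in> ?X \<union> K \<Longrightarrow> cmod (poly B1 z) \<le> M2" by (rule poly_bounded_compact[OF cXK, of B1]) blast
  obtain M3 where M3: "M3 > 0" "\<And>z. z \<in> ?X \<union> K \<Longrightarrow> cmod (poly A2 z) \<le> M3" by (rule poly_bounded_compact[OF cXK, of A2]) blast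
  obtain M4 where M4: "M4 > 0" "\<And>z. z \<in> ?X \<union> K \<Longrightarrow> cmod (poly B2 z) \<le> M4" by (rule poly_bounded_compact[OF cXK, of B2]) blast
  define M where "M = M1 + M2 + M3 + M4"
  have M: "M > 0" "M1 + M3 \<le> M" "M2 + M4 \<le> M" "M1 \<le> M" "M2 \<le> M" using M1(1) M2(1) M3(1) M4(1) by (auto simp: M_def)
  obtain \<beta> where \<beta>: "\<beta> > 0" "\<And>z. z \<in> ?X \<Longrightarrow> \<beta> \<le> cmod (poly B1 z)"
    by (rule continuous_positive_lower_bound[OF \<delta>(3), of "\<lambda>z. cmod (poly B1 z)"])
       (use B1nz in \<open>auto intro!: continuous_intros\<close>)
  obtain \<gamma> where \<gamma>: "\<gamma> > 0" "\<And>z. z \<in> K \<Longrightarrow> \<gamma> \<le> hnorm (poly A2 z) (poly B2 z)"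
    by (rule continuous_positive_lower_bound[OF K(1) continuous_hnorm_poly[of K A2 B2]])
       (use nz2 in \<open>auto simp: hnorm_pos_iff\<close>)
  define e1 where "e1 = e * \<delta> ^ J / (2 * fact J)"
  have e1: "e1 > 0" using e \<delta>(1) by (simp add: e1_def)
  \<comment> \<open>In turn the bounds keep \<open>D / Q\<close> away from 0 on the thickening, hold
    the quotient error there below \<open>e1\<close>, make \<open>chordal_perturb\<close> applicable
    on \<open>K\<close>, and bring its bound below \<open>e\<close>.\<close>
  define t where "t = min (\<beta> / 2) (min (e1 * \<beta>\<^sup>2 / (4 * M)) (min (\<gamma> / 4) (e * \<gamma> / 4)))"
  have t: "t > 0" "t \<le> \<beta> / 2" "t \<le> e1 * \<beta>\<^sup>2 / (4 * M)" "t \<le> \<gamma> / 4" "t \<le> e * \<gamma> / 4"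
    using \<beta>(1) \<gamma>(1) e e1 M(1) by (auto simp: t_def)
  have "t / M > 0" using t M by simp
  from rat_approxE[OF rat_approx_separate[OF \<delta>(3) K(1) XK] this] obtain P Q where PQ: "Q \<noteq> 0"
    "\<And>z. poly Q z = 0 \<Longrightarrow> z \<in> - (?X \<union> K)"
    "\<And>z. z \<in> ?X \<union> K \<Longrightarrow> cmod ((if z \<in> ?X then 1 else 0) - poly P z / poly Q z) < t / M" by metis
  \<comment> \<open>With \<open>\<psi> = P / Q\<close>, the pair \<open>(N, D)\<close> represents
    \<open>\<psi> (A1, B1) + (1 - \<psi>) (A2, B2)\<close> after multiplication by \<open>Q\<close>,
    and \<open>\<psi>\<close> is close to 1 on the thickening and to 0 on \<open>K\<close>.\<close>
  define N D where "N = P * A1 + (Q - P) * A2" and "D = P * B1 + (Q - P) * B2"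
  have Qnz: "poly Q z \<noteq> 0" if "z \<in> ?X \<union> K" for z using PQ(2)[of z] that by auto
  have diff: "cmod (poly N z / poly Q z - (if z \<in> ?X then poly A1 z else poly A2 z)) \<le> t"
    "cmod (poly D z / poly Q z - (if z \<in> ?X then poly B1 z else poly B2 z)) \<le> t" if z: "z \<in> ?X \<union> K" for z
  proof -
    let ?\<psi> = "poly P z / poly Q z" and ?u = "(if z \<in> ?X then 1 else 0) :: complex"
    have gen: "cmod (poly (P * C1 + (Q - P) * C2) z / poly Q z - (if z \<in> ?X then poly C1 z else poly C2 z)) \<le> t"
      if C: "cmod (poly C1 z) + cmod (poly C2 z) \<le> M" for C1 C2
    proof -
      have "poly (P * C1 + (Q - P) * C2) z / poly Q z - (if z \<in> ?X then poly C1 z else poly C2 z) = (?\<psi> - ?u) * (poly C1 z - poly C2 z)"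
        using Qnz[OF z] by (simp add: field_simps)
      also have "cmod \<dots> \<le> (t / M) * M"
        unfolding norm_mult using PQ(3)[OF z] C norm_triangle_ineq4[of "poly C1 z" "poly C2 z"] t(1) M(1)
        by (intro mult_mono) (auto simp: norm_minus_commute)
      finally show ?thesis using M(1) by simp
    qed
    show "cmod (poly N z / poly Q z - (if z \<in> ?X then poly A1 z else poly A2 z)) \<le> t"
      unfolding N_def using M1(2)[OF z] M3(2)[OF z] M(2) by (intro gen) linarith
    show "cmod (poly D z / poly Q z - (if z \<in> ?X then poly B1 z else poly B2 z)) \<le> t"
      unfolding D_def using M2(2)[OF z] M4(2)[OF z] M(3) by (intro gen) linarith
  qed
  have DX: "\<beta> / 2 \<le> cmod (poly D z / poly Q z)" if "z \<in> ?X" for z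
    using diff(2)[of z] that \<beta>(2)[OF that] t(2) norm_triangle_ineq2[of "poly B1 z" "poly B1 z - poly D z / poly Q z"]
    by (simp add: norm_minus_commute)
  have Dnz: "poly D z \<noteq> 0" if "z \<in> ?X" for z using DX[OF that] \<beta>(1) by auto
  have closeX: "cmod (poly N z / poly D z - poly A1 z / poly B1 z) \<le> e1" if z: "z \<in> ?X" for z
  proof -
    let ?n = "poly N z / poly Q z" and ?d = "poly D z / poly Q z"
    have nzs: "?d \<noteq> 0" "poly B1 z \<noteq> 0" "poly Q z \<noteq> 0" using Dnz[OF z] B1nz[OF z] Qnz[of z] z by auto
    have nd: "poly N z / poly D z = ?n / ?d" using nzs by simp
    have frac: "n / d - a / b = ((n - a) * b - (d - b) * a) / (d * b)" if "d \<noteq> 0" "b \<noteq> 0" for n d a b :: complex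
      using that by (simp add: field_simps)
    have "poly N z / poly D z - poly A1 z / poly B1 z = ((?n - poly A1 z) * poly B1 z - (?d - poly B1 z) * poly A1 z) / (?d * poly B1 z)"
      unfolding nd by (rule frac[OF nzs(1,2)])
    also have "cmod \<dots> \<le> (t * M + t * M) / (\<beta> / 2 * \<beta>)"
      unfolding norm_divide norm_mult
    proof (rule frac_le)
      have "cmod ((?n - poly A1 z) * poly B1 z - (?d - poly B1 z) * poly A1 z) \<le>
         cmod (?n - poly A1 z) * cmod (poly B1 z) + cmod (?d - poly B1 z) * cmod (poly A1 z)"
        using norm_triangle_ineq4 by (metis norm_mult)
      also have "\<dots> \<le> t * M + t * M"
        using diff[of z] z M1(2)[of z] M2(2)[of z] M t(1) by (intro add_mono mult_mono) auto
      finally show "cmod ((?n - poly A1 z) * poly B1 z - (?d - poly B1 z) * poly A1 z) \<le> t * M + t * M" .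
      show "\<beta> / 2 * \<beta> \<le> cmod (poly D z) / cmod (poly Q z) * cmod (poly B1 z)"
        using DX[OF z] \<beta>(2)[OF z] \<beta>(1) unfolding norm_divide by (intro mult_mono) auto
    qed (use t M \<beta> in auto)
    also have "\<dots> = t * (4 * M / \<beta>\<^sup>2)" by (simp add: power2_eq_square)
    also have "\<dots> \<le> e1 * \<beta>\<^sup>2 / (4 * M) * (4 * M / \<beta>\<^sup>2)" using t(3) M(1) by (intro mult_right_mono) auto
    also have "\<dots> = e1" using M(1) \<beta>(1) by simp
    finally show ?thesis .
  qed
  have closeK: "poly N z \<noteq> 0 \<or> poly D z \<noteq> 0" "chordal (proj_pt (poly N z) (poly D z)) (proj_pt (poly A2 z) (poly B2 z)) < e"
    if z: "z \<in> K" for z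
  proof -
    let ?n = "poly N z / poly Q z" and ?d = "poly D z / poly Q z"
    have zX: "z \<notin> ?X" and Q: "poly Q z \<noteq> 0" using z XK Qnz[of z] by auto
    have d: "cmod (?n - poly A2 z) \<le> t" "cmod (?d - poly B2 z) \<le> t" using diff[of z] z zX by auto
    have t2: "2 * t < \<gamma>" using t(1,4) \<gamma>(1) by linarith
    note cp = chordal_perturb[OF d t2 \<gamma>(2)[OF z]]
    show "poly N z \<noteq> 0 \<or> poly D z \<noteq> 0" using cp(1) by auto
    have "proj_pt (poly N z) (poly D z) = proj_pt ?n ?d"
      using proj_pt_scale[of "1 / poly Q z" "poly N z" "poly D z"] Q by simp
    moreover have "2 * t / \<gamma> < e"
    proof -
      have "2 * t / \<gamma> \<le> 2 * (e * \<gamma> / 4) / \<gamma>" using t(5) \<gamma>(1) by (intro divide_right_mono mult_left_mono) auto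
      also have "\<dots> = e / 2" using \<gamma>(1) by simp
      finally show ?thesis using e by simp
    qed
    ultimately show "chordal (proj_pt (poly N z) (poly D z)) (proj_pt (poly A2 z) (poly B2 z)) < e"
      using cp(2) by simp
  qed
  obtain x where "x \<in> X" using X(2) by blast
  hence "poly D x \<noteq> 0" using Dnz[of x] subset_thick[OF \<delta>(1)] by blast
  hence "D \<noteq> 0" by auto
  then obtain A B where AB: "coprime A B" "B \<noteq> 0"
    "\<And>z. poly D z \<noteq> 0 \<Longrightarrow> poly B z \<noteq> 0 \<and> poly A z / poly B z = poly N z / poly D z"
    "\<And>z. poly N z \<noteq> 0 \<or> poly D z \<noteq> 0 \<Longrightarrow> proj_pt (poly A z) (poly B z) = proj_pt (poly N z) (poly D z)"
    by (rule cancel_common_factor[of D N]) blast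
  show thesis
  proof (rule that[of A B])
    show "poly B z \<noteq> 0" if "z \<in> X" for z
      using AB(3) Dnz subset_thick[OF \<delta>(1)] that by blast
    show "cmod ((deriv ^^ l) (ratio A B) z - (deriv ^^ l) (ratio A1 B1) z) < e"
      if "l \<le> J" "z \<in> X" for l z
    proof (rule derivs_close[OF \<delta>(1,2) e _ _ _ that])
      fix w assume w: "w \<in> ?X"
      show "poly B w \<noteq> 0" "poly B1 w \<noteq> 0" using AB(3) Dnz B1nz w by auto
      show "cmod (poly A w / poly B w - poly A1 w / poly B1 w) \<le> e * \<delta> ^ J / (2 * fact J)"
        using AB(3)[OF Dnz[OF w]] closeX[OF w] by (simp add: e1_def)
    qed
    show "chordal (proj_pt (poly A z) (poly B z)) (proj_pt (poly A2 z) (poly B2 z)) < e" if "z \<in> K" for z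
      using closeK[OF that] AB(4) by simp
  qed (rule AB)
qed

text \<open>Adding a small multiple of \<open>T * B\<close> to the numerator, with \<open>T\<close>
  a monomial of degree \<open>p - degree B\<close>, preserves coprimality, gives degree
  \<open>p\<close> and changes the quotient by a small polynomial.\<close>

lemma rational_exact_degree:
  assumes X: "compact X" "X \<noteq> {}" and K: "compact K"
    and AB: "coprime A0 B" "\<And>z. z \<in> X \<Longrightarrow> poly B z \<noteq> 0"
    and p: "degree A0 < p" "degree B \<le> p" and e: "e > 0"
  obtains A where "coprime A B" "degree A = p"
    "\<And>l z. l \<le> J \<Longrightarrow> z \<in> X \<Longrightarrow> cmod ((deriv ^^ l) (ratio A B) z -
        (deriv ^^ l) (ratio A0 B) z) < e"
    "\<And>z. z \<in> K \<Longrightarrow> chordal (proj_pt (poly A z) (poly B z)) (proj_pt (poly A0 z) (poly B z)) < e"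
proof -
  have B0: "B \<noteq> 0" using X AB by auto
  hence "finite {a. poly B a = 0}" by (rule poly_roots_finite)
  hence "closed {a. poly B a = 0}" by (intro compact_imp_closed finite_imp_compact)
  moreover have "X \<inter> {a. poly B a = 0} = {}" using AB by auto
  ultimately obtain \<delta> where \<delta>: "0 < \<delta>" "\<delta> \<le> 1" "compact (thick \<delta> X)" "thick \<delta> X \<inter> {a. poly B a = 0} = {}"
    by (rule thicken[OF X])
  have Bnz: "poly B w \<noteq> 0" if "w \<in> thick \<delta> X" for w using \<delta>(4) that by auto
  define T where "T = monom (1 :: complex) (p - degree B)"
  obtain M1 where M1: "M1 > 0" "\<And>z. z \<in> thick \<delta> X \<Longrightarrow> cmod (poly T z) \<le> M1" by (rule poly_bounded_compact[OF \<delta>(3), of T]) blast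
  obtain M2 where M2: "M2 > 0" "\<And>z. z \<in> K \<Longrightarrow> cmod (poly (T * B) z) \<le> M2" by (rule poly_bounded_compact[OF K(1), of "T * B"]) blast
  obtain \<gamma> where \<gamma>: "\<gamma> > 0" "\<And>z. z \<in> K \<Longrightarrow> \<gamma> \<le> hnorm (poly A0 z) (poly B z)"
    by (rule continuous_positive_lower_bound[OF K(1) continuous_hnorm_poly[of K A0 B]])
       (use coprime_poly_no_common_root[OF AB(1)] in \<open>auto simp: hnorm_pos_iff\<close>)
  define e1 where "e1 = e * \<delta> ^ J / (2 * fact J)"
  have e1: "e1 > 0" using e \<delta>(1) by (simp add: e1_def)
  \<comment> \<open>One bound makes the change \<open>d * T\<close> of the quotient at most
    \<open>e1\<close> on the thickening. The other makes the change \<open>d * T * B\<close> of the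
    numerator small on \<open>K\<close>, where \<open>B\<close> may vanish and only homogeneous
    coordinates are usable.\<close>
  define d where "d = min (e1 / M1) (min (\<gamma> / 4) (e * \<gamma> / 4) / M2)"
  have d: "d > 0" "d \<le> e1 / M1" "d \<le> min (\<gamma> / 4) (e * \<gamma> / 4) / M2" using e1 M1 M2 \<gamma> e by (auto simp: d_def)
  have dM1: "d * M1 \<le> e1" using d(2) M1(1) by (simp add: pos_le_divide_eq)
  have dM2: "d * M2 \<le> \<gamma> / 4" "d * M2 \<le> e * \<gamma> / 4" using d(3) M2(1) by (auto simp: pos_le_divide_eq)
  define E where "E = Polynomial.smult (of_real d) (T * B)"
  define A where "A = A0 + E"
  have degE: "degree E = p" using d(1) B0 p(2) by (simp add: E_def T_def degree_mult_eq degree_monom_eq monom_eq_0_iff)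
  show thesis
  proof (rule that[of A])
    show "degree A = p" unfolding A_def using p degE by (simp add: degree_add_eq_right)
    have "A = Polynomial.smult (of_real d) T * B + A0" by (simp add: A_def E_def)
    thus "coprime A B" using AB(1) gcd_add_mult[of B "Polynomial.smult (of_real d) T" A0]
      by (simp add: coprime_iff_gcd_eq_1 gcd.commute)
    show "cmod ((deriv ^^ l) (ratio A B) z - (deriv ^^ l) (ratio A0 B) z) < e"
      if "l \<le> J" "z \<in> X" for l z
    proof (rule derivs_close[OF \<delta>(1,2) e Bnz Bnz _ that])
      fix w assume w: "w \<in> thick \<delta> X"
      have "poly A w / poly B w - poly A0 w / poly B w = of_real d * poly T w"
        using Bnz[OF w] by (simp add: A_def E_def field_simps)
      also have "cmod \<dots> \<le> d * M1" using M1(2)[OF w] d(1) by (simp add: norm_mult)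
      finally show "cmod (poly A w / poly B w - poly A0 w / poly B w) \<le> e * \<delta> ^ J / (2 * fact J)"
        using dM1 by (simp add: e1_def)
    qed
    show "chordal (proj_pt (poly A z) (poly B z)) (proj_pt (poly A0 z) (poly B z)) < e" if z: "z \<in> K" for z
    proof -
      have "cmod (poly A z - poly A0 z) = d * cmod (poly (T * B) z)"
        using d(1) by (simp add: A_def E_def norm_mult)
      also have "\<dots> \<le> d * M2" using M2(2)[OF z] d(1) by (intro mult_left_mono) auto
      finally have 1: "cmod (poly A z - poly A0 z) \<le> d * M2" .
      have 2: "2 * (d * M2) < \<gamma>" using dM2(1) \<gamma>(1) by linarith
      have "chordal (proj_pt (poly A z) (poly B z)) (proj_pt (poly A0 z) (poly B z)) \<le> 2 * (d * M2) / \<gamma>"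
        by (rule chordal_perturb(2)[OF 1 _ 2 \<gamma>(2)[OF z]]) (use d M2 in auto)
      also have "\<dots> \<le> 2 * (e * \<gamma> / 4) / \<gamma>" using dM2(2) \<gamma>(1) by (intro divide_right_mono mult_left_mono) auto
      also have "\<dots> < e" using \<gamma>(1) e by simp
      finally show ?thesis .
    qed
  qed
qed

section \<open>The space of smooth functions\<close>

locale exhaustion =
  fixes \<Omega> :: "complex set" and L :: "nat \<Rightarrow> complex set"
  assumes open_\<Omega>: "open \<Omega>"
    and incseq_L: "incseq L"
    and compact_L: "\<And>n. compact (L n)"
    and closure_L: "\<And>n. closure (L n \<inter> \<Omega>) = L n"
    and exhaust: "\<And>C. compact C \<Longrightarrow> C \<subseteq> \<Omega> \<Longrightarrow> \<exists>n. C \<subseteq> L n"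
begin

abbreviation D :: "(complex \<Rightarrow> complex) \<Rightarrow> nat \<Rightarrow> complex \<Rightarrow> complex" where
  "D \<equiv> deriv_ext \<Omega> L"

text \<open>Membership in \<open>T_space\<close> without extensionality. The seminorms are applied
  to differences \<open>\<lambda>z. g z - f z\<close>, which need not be extensional.\<close>

definition smooth :: "(complex \<Rightarrow> complex) \<Rightarrow> bool" where
  "smooth f \<longleftrightarrow> f holomorphic_on \<Omega> \<and> (\<forall>l n. uniformly_continuous_on (L n \<inter> \<Omega>) ((deriv ^^ l) f))"

lemma T_space_iff: "f \<in> T_space \<Omega> L \<longleftrightarrow> f \<in> extensional \<Omega> \<and> smooth f"
  by (auto simp: T_space_def smooth_def)

lemma L_mono: "m \<le> n \<Longrightarrow> L m \<subseteq> L n"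
  using incseq_L by (simp add: incseq_def)

lemma in_some_L: "z \<in> \<Omega> \<Longrightarrow> \<exists>n. z \<in> L n"
  using exhaust[of "{z}"] by auto

lemma nbhd_in_L:
  assumes "z \<in> \<Omega>"
  obtains r n where "r > 0" "cball z r \<subseteq> \<Omega>" "cball z r \<subseteq> L n"
proof -
  obtain r where "r > 0" "cball z r \<subseteq> \<Omega>" using open_\<Omega> assms open_contains_cball by blast
  thus thesis using that exhaust[of "cball z r"] by auto
qed

lemma D_eq [simp]: "z \<in> \<Omega> \<Longrightarrow> D f l z = (deriv ^^ l) f z"
  by (simp add: deriv_ext_def)

text \<open>Hypothesis (a) at a point outside \<open>\<Omega>\<close>: such a point of
  \<open>L n\<close> is a limit point of \<open>L n \<inter> \<Omega>\<close>, so limits there are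
  unique.\<close>

lemma boundary_not_bot:
  assumes "z \<in> L n" "z \<notin> \<Omega>"
  shows "at z within (L n \<inter> \<Omega>) \<noteq> bot"
proof -
  have "z \<in> closure (L n \<inter> \<Omega>)" using assms closure_L by simp
  thus ?thesis using assms by (simp add: closure_def trivial_limit_within)
qed

text \<open>Every \<open>L m\<close> yields its own extension, whereas the description in
  \<open>deriv_ext\<close> demands one limit for all \<open>m\<close>. The extensions agree because
  the sets \<open>L m\<close> are nested and the limit within the smaller one is unique.\<close>

lemma D_extension:
  assumes "smooth f"
  obtains g where "continuous_on (L n) g" "\<And>z. z \<in> L n \<Longrightarrow> D f l z = g z"
proof -
  have "\<exists>g. continuous_on (L m) g \<and> (\<forall>z\<in>L m \<inter> \<Omega>. (deriv ^^ l) f z = g z)" for m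
  proof -
    have "uniformly_continuous_on (L m \<inter> \<Omega>) ((deriv ^^ l) f)" using assms by (simp add: smooth_def)
    from uniformly_continuous_on_extension_on_closure[OF this] show ?thesis
      unfolding closure_L using uniformly_continuous_imp_continuous by metis
  qed
  then obtain g where g: "\<And>m. continuous_on (L m) (g m)" "\<And>m z. z \<in> L m \<Longrightarrow> z \<in> \<Omega> \<Longrightarrow> (deriv ^^ l) f z = g m z"
    by (metis IntI)
  have lim: "((deriv ^^ l) f \<longlongrightarrow> g m z) (at z within (L m \<inter> \<Omega>))" if z: "z \<in> L m" for m z
  proof -
    have "(g m \<longlongrightarrow> g m z) (at z within L m)" using g(1) z by (simp add: continuous_on_def)
    hence "(g m \<longlongrightarrow> g m z) (at z within (L m \<inter> \<Omega>))" by (rule tendsto_within_subset) auto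
    moreover have "eventually (\<lambda>w. g m w = (deriv ^^ l) f w) (at z within (L m \<inter> \<Omega>))"
      using g(2) by (auto simp: eventually_at_filter intro!: always_eventually)
    ultimately show ?thesis using Lim_transform_eventually by blast
  qed
  have "D f l z = g n z" if z: "z \<in> L n" for z
  proof (cases "z \<in> \<Omega>")
    case True thus ?thesis using g(2)[OF z] by simp
  next
    case False
    have uniq: "v = w" if "((deriv ^^ l) f \<longlongrightarrow> v) (at z within (L m \<inter> \<Omega>))" "((deriv ^^ l) f \<longlongrightarrow> w) (at z within (L m \<inter> \<Omega>))" "z \<in> L m" for v w m
      using tendsto_unique[OF boundary_not_bot[OF that(3) False]] that by blast
    have all: "((deriv ^^ l) f \<longlongrightarrow> g n z) (at z within (L m \<inter> \<Omega>))" if m: "z \<in> L m" for m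
    proof (cases "m \<le> n")
      case True
      thus ?thesis using lim[OF z] L_mono[OF True] by (intro tendsto_within_subset[OF lim[OF z]]) auto
    next
      case False
      hence "L n \<inter> \<Omega> \<subseteq> L m \<inter> \<Omega>" using L_mono[of n m] by auto
      hence "((deriv ^^ l) f \<longlongrightarrow> g m z) (at z within (L n \<inter> \<Omega>))" by (rule tendsto_within_subset[OF lim[OF m]])
      hence "g m z = g n z" using uniq[OF _ lim[OF z] z] by blast
      thus ?thesis using lim[OF m] by simp
    qed
    have "(THE v. \<forall>m. z \<in> L m \<longrightarrow> ((deriv ^^ l) f \<longlongrightarrow> v) (at z within (L m \<inter> \<Omega>))) = g n z"
      by (rule the_equality) (use all uniq z in blast)+
    thus ?thesis using False by (simp add: deriv_ext_def)
  qed
  thus thesis using that g(1) by blast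
qed

lemma continuous_on_D: "smooth f \<Longrightarrow> continuous_on (L n) (D f l)"
  by (metis D_extension continuous_on_cong)

lemma le_on_L:
  assumes "continuous_on (L n) u" "\<And>z. z \<in> L n \<Longrightarrow> z \<in> \<Omega> \<Longrightarrow> u z \<le> (c :: real)" "z \<in> L n"
  shows "u z \<le> c"
  by (rule continuous_le_on_closure[of "L n \<inter> \<Omega>"]) (use assms closure_L in auto)

lemma eq_on_L:
  fixes u v :: "complex \<Rightarrow> complex"
  assumes "continuous_on (L n) u" "continuous_on (L n) v" "\<And>z. z \<in> L n \<Longrightarrow> z \<in> \<Omega> \<Longrightarrow> u z = v z" "z \<in> L n"
  shows "u z = v z"
proof -
  have "continuous_on (L n) (\<lambda>z. cmod (u z - v z))" using assms by (intro continuous_intros)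
  from le_on_L[OF this, of 0 z] assms show ?thesis by simp
qed

lemma smooth_diff:
  assumes "smooth f" "smooth g"
  shows "smooth (\<lambda>z. f z - g z)"
    and "\<And>z. z \<in> \<Omega> \<Longrightarrow> (deriv ^^ l) (\<lambda>z. f z - g z) z = (deriv ^^ l) f z - (deriv ^^ l) g z"
proof -
  have eq: "(deriv ^^ l) (\<lambda>z. f z - g z) z = (deriv ^^ l) f z - (deriv ^^ l) g z" if "z \<in> \<Omega>" for z l
    using assms that open_\<Omega> by (intro higher_deriv_diff[of _ \<Omega>]) (auto simp: smooth_def)
  show "smooth (\<lambda>z. f z - g z)"
    unfolding smooth_def
  proof (intro conjI allI)
    show "(\<lambda>z. f z - g z) holomorphic_on \<Omega>" using assms by (auto simp: smooth_def intro: holomorphic_intros)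
    fix l n
    have "uniformly_continuous_on (L n \<inter> \<Omega>) (\<lambda>z. (deriv ^^ l) f z - (deriv ^^ l) g z)"
      using assms by (intro uniformly_continuous_on_diff) (auto simp: smooth_def)
    thus "uniformly_continuous_on (L n \<inter> \<Omega>) ((deriv ^^ l) (\<lambda>z. f z - g z))"
      unfolding uniformly_continuous_on_def by (simp add: eq)
  qed
  show "\<And>z. z \<in> \<Omega> \<Longrightarrow> (deriv ^^ l) (\<lambda>z. f z - g z) z = (deriv ^^ l) f z - (deriv ^^ l) g z" by (rule eq)
qed

lemma higher_deriv_restrict: "z \<in> \<Omega> \<Longrightarrow> (deriv ^^ l) (restrict f \<Omega>) z = (deriv ^^ l) f z"
  by (intro higher_deriv_cong_ev eventually_mono[OF eventually_nhds_in_open[OF open_\<Omega>]]) auto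

lemma smooth_cong:
  assumes "smooth f" "\<And>z l. z \<in> \<Omega> \<Longrightarrow> (deriv ^^ l) g z = (deriv ^^ l) f z"
  shows "smooth g"
proof -
  have "g z = f z" if "z \<in> \<Omega>" for z using assms(2)[OF that, of 0] by simp
  thus ?thesis using assms unfolding smooth_def uniformly_continuous_on_def by (auto cong: holomorphic_cong)
qed

lemma restrict_in_T_space: "smooth f \<Longrightarrow> restrict f \<Omega> \<in> T_space \<Omega> L"
  unfolding T_space_iff using smooth_cong higher_deriv_restrict by auto

text \<open>The sets \<open>{g. near k f g}\<close> turn out to be a countable base of neighbourhoods of \<open>f\<close>. The points of \<open>L k - \<Omega>\<close>
  may be left out since \<open>L k\<close> is the closure of \<open>L k \<inter> \<Omega>\<close>.\<close>

definition near :: "nat \<Rightarrow> (complex \<Rightarrow> complex) \<Rightarrow> (complex \<Rightarrow> complex) \<Rightarrow> bool" where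
  "near k f g \<longleftrightarrow> (\<forall>l\<le>k. \<forall>z\<in>L k \<inter> \<Omega>. cmod ((deriv ^^ l) f z - (deriv ^^ l) g z) \<le> 1 / 2 ^ k)"

lemma near_mono: "near k f g \<Longrightarrow> j \<le> k \<Longrightarrow> near j f g"
  unfolding near_def
proof (intro allI impI ballI)
  fix l z assume *: "\<forall>l\<le>k. \<forall>z\<in>L k \<inter> \<Omega>. cmod ((deriv ^^ l) f z - (deriv ^^ l) g z) \<le> 1 / 2 ^ k"
    and jk: "j \<le> k" "l \<le> j" and z: "z \<in> L j \<inter> \<Omega>"
  have "cmod ((deriv ^^ l) f z - (deriv ^^ l) g z) \<le> 1 / 2 ^ k" using * jk z L_mono[OF jk(1)] by auto
  also have "\<dots> \<le> 1 / 2 ^ j" using jk by (intro divide_left_mono power_increasing) auto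
  finally show "cmod ((deriv ^^ l) f z - (deriv ^^ l) g z) \<le> 1 / 2 ^ j" .
qed

lemma near_refl: "near k f f"
  by (simp add: near_def)

lemma near_triangle:
  assumes "near (Suc k) f g" "near (Suc k) g h"
  shows "near k f h"
  unfolding near_def
proof (intro allI impI ballI)
  fix l z assume l: "l \<le> k" and z: "z \<in> L k \<inter> \<Omega>"
  have "cmod ((deriv ^^ l) f z - (deriv ^^ l) g z) \<le> 1 / 2 ^ Suc k" "cmod ((deriv ^^ l) g z - (deriv ^^ l) h z) \<le> 1 / 2 ^ Suc k"
    using assms l z L_mono[of k "Suc k"] unfolding near_def by auto
  thus "cmod ((deriv ^^ l) f z - (deriv ^^ l) h z) \<le> 1 / 2 ^ k"
    using norm_triangle_ineq[of "(deriv ^^ l) f z - (deriv ^^ l) g z" "(deriv ^^ l) g z - (deriv ^^ l) h z"]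
      field_sum_of_halves[of "1 / 2 ^ k :: real"]
    by (simp add: mult.commute)
qed

lemma near_D:
  assumes "near k f g" "smooth f" "smooth g" "l \<le> k" "n \<le> k" "z \<in> L n"
  shows "cmod (D f l z - D g l z) \<le> 1 / 2 ^ k"
proof (rule le_on_L[of k "\<lambda>z. cmod (D f l z - D g l z)"])
  show "continuous_on (L k) (\<lambda>z. cmod (D f l z - D g l z))"
    using assms by (intro continuous_intros continuous_on_D)
  show "z \<in> L k" using assms L_mono by blast
qed (use assms in \<open>auto simp: near_def\<close>)

section \<open>Neighbourhoods in the Frechet space and in its closed subspace\<close>

lemma T_seminorm_less_iff:
  assumes "smooth h"
  shows "T_seminorm \<Omega> L l n h < ennreal e \<longleftrightarrow>
    (\<exists>c. 0 \<le> c \<and> c < e \<and> (\<forall>z\<in>L n \<inter> \<Omega>. cmod ((deriv ^^ l) h z) \<le> c))"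
proof
  assume lt: "T_seminorm \<Omega> L l n h < ennreal e"
  obtain c where c: "T_seminorm \<Omega> L l n h = ennreal c" and "0 \<le> c"
    using lt by (cases "T_seminorm \<Omega> L l n h" rule: ennreal_cases) auto
  note \<open>0 \<le> c\<close>
  moreover have "c < e" using lt \<open>0 \<le> c\<close> unfolding c by (simp add: ennreal_less_iff)
  moreover have "cmod ((deriv ^^ l) h z) \<le> c" if "z \<in> L n \<inter> \<Omega>" for z
  proof -
    have "ennreal (cmod (D h l z)) \<le> T_seminorm \<Omega> L l n h"
      unfolding T_seminorm_def using that by (intro SUP_upper) auto
    thus ?thesis using that \<open>0 \<le> c\<close> unfolding c by simp
  qed
  ultimately show "\<exists>c. 0 \<le> c \<and> c < e \<and> (\<forall>z\<in>L n \<inter> \<Omega>. cmod ((deriv ^^ l) h z) \<le> c)" by blast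
next
  assume "\<exists>c. 0 \<le> c \<and> c < e \<and> (\<forall>z\<in>L n \<inter> \<Omega>. cmod ((deriv ^^ l) h z) \<le> c)"
  then obtain c where c: "0 \<le> c" "c < e" "\<And>z. z \<in> L n \<inter> \<Omega> \<Longrightarrow> cmod ((deriv ^^ l) h z) \<le> c" by blast
  have "cmod (D h l z) \<le> c" if "z \<in> L n" for z
    by (rule le_on_L[OF _ _ that]) (use assms c in \<open>auto intro!: continuous_intros continuous_on_D\<close>)
  hence "T_seminorm \<Omega> L l n h \<le> ennreal c"
    unfolding T_seminorm_def by (intro SUP_least ennreal_leI)
  also have "\<dots> < ennreal e" using c by (simp add: ennreal_lessI)
  finally show "T_seminorm \<Omega> L l n h < ennreal e" .
qed

text \<open>Induction over the generation of the topology. For a subbasic ball the slack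
  \<open>e - c\<close> absorbs \<open>1 / 2 ^ k\<close> for large \<open>k\<close>.\<close>

lemma openin_T_near:
  assumes "openin (T_topology \<Omega> L) S" "f \<in> S"
  shows "S \<subseteq> T_space \<Omega> L" "\<exists>k. \<forall>g\<in>T_space \<Omega> L. near k f g \<longrightarrow> g \<in> S"
proof -
  let ?B = "{{g \<in> T_space \<Omega> L. T_seminorm \<Omega> L l n (\<lambda>z. g z - f z) < ennreal e} | f l n e.
        f \<in> T_space \<Omega> L \<and> 0 < e}"
  have "generate_topology_on ?B S"
    using assms(1) by (simp add: T_topology_def openin_topology_generated_by_iff)
  hence "S \<subseteq> T_space \<Omega> L \<and> (\<forall>f\<in>S. \<exists>k. \<forall>g\<in>T_space \<Omega> L. near k f g \<longrightarrow> g \<in> S)"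
  proof induction
    case Empty show ?case by simp
  next
    case (Int a b)
    have "\<exists>k. \<forall>g\<in>T_space \<Omega> L. near k f g \<longrightarrow> g \<in> a \<inter> b" if "f \<in> a \<inter> b" for f
    proof -
      have f: "f \<in> a" "f \<in> b" using that by auto
      from bspec[OF conjunct2[OF Int.IH(1)] f(1)] obtain j where j: "\<forall>g\<in>T_space \<Omega> L. near j f g \<longrightarrow> g \<in> a" ..
      from bspec[OF conjunct2[OF Int.IH(2)] f(2)] obtain k where k: "\<forall>g\<in>T_space \<Omega> L. near k f g \<longrightarrow> g \<in> b" ..
      have "g \<in> a \<inter> b" if "g \<in> T_space \<Omega> L" "near (max j k) f g" for g
        using j k that near_mono[OF that(2), of j] near_mono[OF that(2), of k] by simp
      thus ?thesis by blast
    qed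
    moreover have "a \<inter> b \<subseteq> T_space \<Omega> L" using conjunct1[OF Int.IH(1)] by blast
    ultimately show ?case by simp
  next
    case (UN \<K>)
    show ?case
    proof (intro conjI ballI)
      show "\<Union>\<K> \<subseteq> T_space \<Omega> L" using UN.IH by (intro Union_least) simp
      fix f assume "f \<in> \<Union>\<K>"
      then obtain S where S: "S \<in> \<K>" "f \<in> S" by blast
      from bspec[OF conjunct2[OF UN.IH[OF S(1)]] S(2)] obtain k where
        "\<forall>g\<in>T_space \<Omega> L. near k f g \<longrightarrow> g \<in> S" ..
      thus "\<exists>k. \<forall>g\<in>T_space \<Omega> L. near k f g \<longrightarrow> g \<in> \<Union>\<K>" using S(1) by blast
    qed
  next
    case (Basis s)
    then obtain f0 l n e where s: "s = {g \<in> T_space \<Omega> L. T_seminorm \<Omega> L l n (\<lambda>z. g z - f0 z) < ennreal e}"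
      and f0: "f0 \<in> T_space \<Omega> L" "0 < e" by blast
    have "\<exists>k. \<forall>g\<in>T_space \<Omega> L. near k f g \<longrightarrow> g \<in> s" if f: "f \<in> s" for f
    proof -
      have sm: "smooth f" "smooth f0" using f f0 by (auto simp: s T_space_iff)
      obtain c where c: "0 \<le> c" "c < e" "\<And>z. z \<in> L n \<inter> \<Omega> \<Longrightarrow> cmod ((deriv ^^ l) (\<lambda>z. f z - f0 z) z) \<le> c"
        using f T_seminorm_less_iff[OF smooth_diff(1)[OF sm]] by (auto simp: s)
      obtain j where j: "(1 / 2 :: real) ^ j < e - c" using real_arch_pow_inv[of "e - c" "1 / 2"] c by auto
      define k where "k = max j (max l n)"
      have k: "l \<le> k" "n \<le> k" "j \<le> k" by (auto simp: k_def)
      have "(1 / 2 :: real) ^ k \<le> (1 / 2) ^ j" using k by (intro power_decreasing) auto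
      hence kc: "1 / 2 ^ k < e - c" using j by (simp add: power_one_over)
      have "g \<in> s" if g: "g \<in> T_space \<Omega> L" "near k f g" for g
      proof -
        have smg: "smooth g" using g by (simp add: T_space_iff)
        have "cmod ((deriv ^^ l) (\<lambda>z. g z - f0 z) z) \<le> 1 / 2 ^ k + c" if z: "z \<in> L n \<inter> \<Omega>" for z
        proof -
          have "cmod ((deriv ^^ l) f z - (deriv ^^ l) g z) \<le> 1 / 2 ^ k"
            using g(2) k z L_mono[OF k(2)] by (auto simp: near_def)
          moreover have "cmod ((deriv ^^ l) f z - (deriv ^^ l) f0 z) \<le> c"
            using c(3)[OF z] z smooth_diff(2)[OF sm] by simp
          ultimately have "cmod ((deriv ^^ l) g z - (deriv ^^ l) f0 z) \<le> 1 / 2 ^ k + c"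
            using norm_triangle_ineq[of "(deriv ^^ l) g z - (deriv ^^ l) f z" "(deriv ^^ l) f z - (deriv ^^ l) f0 z"]
            by (simp add: norm_minus_commute)
          thus ?thesis using z smooth_diff(2)[OF smg sm(2)] by simp
        qed
        thus ?thesis unfolding s using g(1) T_seminorm_less_iff[OF smooth_diff(1)[OF smg sm(2)]] kc c(1)
          by (auto intro!: exI[of _ "1 / 2 ^ k + c"])
      qed
      thus ?thesis by blast
    qed
    thus ?case by (auto simp: s)
  qed
  thus "S \<subseteq> T_space \<Omega> L" "\<exists>k. \<forall>g\<in>T_space \<Omega> L. near k f g \<longrightarrow> g \<in> S" using assms(2) by blast+
qed

text \<open>The set \<open>{g. near k f g}\<close> is given by weak inequalities. The open set
  inside it is the intersection of the strict seminorm balls of orders 0 to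
  \<open>k\<close>.\<close>

lemma near_contains_open:
  assumes f: "f \<in> T_space \<Omega> L"
  obtains B where "openin (T_topology \<Omega> L) B" "f \<in> B" "\<And>g. g \<in> B \<Longrightarrow> g \<in> T_space \<Omega> L \<and> near k f g"
proof -
  define b where "b l = {g \<in> T_space \<Omega> L. T_seminorm \<Omega> L l k (\<lambda>z. g z - f z) < ennreal (1 / 2 ^ k)}" for l
  have "openin (T_topology \<Omega> L) (\<Inter>l\<in>{..k}. b l)"
    unfolding T_topology_def b_def
    by (intro openin_INT2 topology_generated_by_Basis) (use f in \<open>auto intro!: exI\<close>)
  moreover have sm: "smooth f" using f by (simp add: T_space_iff)
  have "f \<in> b l" for l
    unfolding b_def using f T_seminorm_less_iff[OF smooth_diff(1)[OF sm sm], of l k "1 / 2 ^ k"] smooth_diff(2)[OF sm sm]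
    by (auto intro!: exI[of _ 0])
  hence "f \<in> (\<Inter>l\<in>{..k}. b l)" by blast
  moreover have "g \<in> T_space \<Omega> L \<and> near k f g" if gb: "g \<in> (\<Inter>l\<in>{..k}. b l)" for g
  proof -
    have g: "g \<in> T_space \<Omega> L" using that by (auto simp: b_def)
    hence smg: "smooth g" by (simp add: T_space_iff)
    have "cmod ((deriv ^^ l) f z - (deriv ^^ l) g z) \<le> 1 / 2 ^ k" if l: "l \<le> k" and z: "z \<in> L k \<inter> \<Omega>" for l z
    proof -
      have "g \<in> b l" using gb l by blast
      then obtain c where "c < 1 / 2 ^ k" "cmod ((deriv ^^ l) (\<lambda>z. g z - f z) z) \<le> c"
        using T_seminorm_less_iff[OF smooth_diff(1)[OF smg sm]] z by (auto simp: b_def)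
      thus ?thesis using smooth_diff(2)[OF smg sm] z by (simp add: norm_minus_commute)
    qed
    thus ?thesis using g by (simp add: near_def)
  qed
  ultimately show thesis using that by blast
qed

lemma topspace_T [simp]: "topspace (T_topology \<Omega> L) = T_space \<Omega> L"
proof
  show "topspace (T_topology \<Omega> L) \<subseteq> T_space \<Omega> L" using openin_T_near(1)[of "topspace (T_topology \<Omega> L)"] by blast
  show "T_space \<Omega> L \<subseteq> topspace (T_topology \<Omega> L)"
  proof
    fix f assume "f \<in> T_space \<Omega> L"
    from near_contains_open[OF this] show "f \<in> topspace (T_topology \<Omega> L)" by (metis openin_subset subsetD)
  qed
qed

lemma in_closure_T_iff:
  "f \<in> T_topology \<Omega> L closure_of A \<longleftrightarrow> f \<in> T_space \<Omega> L \<and> (\<forall>k. \<exists>g\<in>A. g \<in> T_space \<Omega> L \<and> near k f g)"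
proof (intro iffI conjI allI)
  assume f: "f \<in> T_topology \<Omega> L closure_of A"
  thus T: "f \<in> T_space \<Omega> L" by (simp add: in_closure_of)
  fix k
  from near_contains_open[OF T, of k] obtain B where "openin (T_topology \<Omega> L) B" "f \<in> B"
    "\<And>g. g \<in> B \<Longrightarrow> g \<in> T_space \<Omega> L \<and> near k f g" by metis
  thus "\<exists>g\<in>A. g \<in> T_space \<Omega> L \<and> near k f g" using f unfolding in_closure_of by blast
next
  assume f: "f \<in> T_space \<Omega> L \<and> (\<forall>k. \<exists>g\<in>A. g \<in> T_space \<Omega> L \<and> near k f g)"
  show "f \<in> T_topology \<Omega> L closure_of A"
    unfolding in_closure_of
  proof (intro conjI allI impI)
    show "f \<in> topspace (T_topology \<Omega> L)" using f by simp
    fix S assume "f \<in> S \<and> openin (T_topology \<Omega> L) S"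
    then obtain k where "\<forall>g\<in>T_space \<Omega> L. near k f g \<longrightarrow> g \<in> S" using openin_T_near(2) by blast
    thus "\<exists>y. y \<in> A \<and> y \<in> S" using f by blast
  qed
qed

abbreviation "Y \<equiv> Y_space \<Omega> L"

lemma Y_subset_T: "f \<in> Y \<Longrightarrow> f \<in> T_space \<Omega> L"
  unfolding Y_space_def in_closure_T_iff by blast

lemma smooth_Y: "f \<in> Y \<Longrightarrow> smooth f"
  using Y_subset_T by (simp add: T_space_iff)

lemma Y_closed:
  assumes "f \<in> T_space \<Omega> L" "\<And>k. \<exists>g\<in>Y. near k f g"
  shows "f \<in> Y"
proof -
  have "f \<in> T_topology \<Omega> L closure_of Y" unfolding in_closure_T_iff using assms Y_subset_T by blast
  thus ?thesis by (simp add: Y_space_def)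
qed

lemma topspace_Y [simp]: "topspace (Y_topology \<Omega> L) = Y"
  using Y_subset_T by (auto simp: Y_topology_def)

lemma openin_Y_iff:
  "openin (Y_topology \<Omega> L) S \<longleftrightarrow> S \<subseteq> Y \<and> (\<forall>f\<in>S. \<exists>k. \<forall>g\<in>Y. near k f g \<longrightarrow> g \<in> S)"
proof
  assume S: "openin (Y_topology \<Omega> L) S"
  then obtain U where U: "openin (T_topology \<Omega> L) U" "S = U \<inter> Y"
    unfolding Y_topology_def openin_subtopology by blast
  show "S \<subseteq> Y \<and> (\<forall>f\<in>S. \<exists>k. \<forall>g\<in>Y. near k f g \<longrightarrow> g \<in> S)"
    using openin_T_near(2)[OF U(1)] U(2) Y_subset_T by blast
next
  assume S: "S \<subseteq> Y \<and> (\<forall>f\<in>S. \<exists>k. \<forall>g\<in>Y. near k f g \<longrightarrow> g \<in> S)"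
  show "openin (Y_topology \<Omega> L) S"
  proof (subst openin_subopen, intro ballI)
    fix f assume f: "f \<in> S"
    then obtain k where k: "\<forall>g\<in>Y. near k f g \<longrightarrow> g \<in> S" using S by blast
    have "f \<in> T_space \<Omega> L" using f S Y_subset_T by blast
    from near_contains_open[OF this, of k] obtain B where B: "openin (T_topology \<Omega> L) B" "f \<in> B"
      "\<And>g. g \<in> B \<Longrightarrow> g \<in> T_space \<Omega> L \<and> near k f g" by metis
    have "openin (Y_topology \<Omega> L) (B \<inter> Y)" using B(1) unfolding Y_topology_def openin_subtopology by blast
    moreover have "f \<in> B \<inter> Y" "B \<inter> Y \<subseteq> S" using B f S k by blast+
    ultimately show "\<exists>T. openin (Y_topology \<Omega> L) T \<and> f \<in> T \<and> T \<subseteq> S" by blast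
  qed
qed

lemma closure_Y_eqI:
  assumes "S \<subseteq> Y" "\<And>f k. f \<in> Y \<Longrightarrow> \<exists>g\<in>S. near k f g"
  shows "Y_topology \<Omega> L closure_of S = Y"
proof -
  have "f \<in> Y_topology \<Omega> L closure_of S" if "f \<in> Y" for f
    unfolding in_closure_of
  proof (intro conjI allI impI)
    fix U assume "f \<in> U \<and> openin (Y_topology \<Omega> L) U"
    then obtain k where "\<forall>g\<in>Y. near k f g \<longrightarrow> g \<in> U" unfolding openin_Y_iff by blast
    thus "\<exists>y. y \<in> S \<and> y \<in> U" using assms that by blast
  qed (use that in simp)
  thus ?thesis using closure_of_subset_topspace[of "Y_topology \<Omega> L" S] by auto
qed

end

section \<open>Completeness and Baire category\<close>

context exhaustion
begin

lemma near_sym: "near k f g \<longleftrightarrow> near k g f"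
  by (simp add: near_def norm_minus_commute)

text \<open>Subtracting \<open>1 / 2 ^ k j\<close> makes the induction close: step \<open>m\<close>
  costs \<open>1 / 2 ^ Suc (k m)\<close>, which is exactly the amount by which halving lowers
  \<open>1 / 2 ^ k m\<close>.\<close>

lemma near_chain:
  assumes step: "\<And>i. near (Suc (k i)) (f i) (f (Suc i))" and k: "\<And>i. k i < k (Suc i)"
    and ij: "i \<le> j" and l: "l \<le> k i" and z: "z \<in> L (k i) \<inter> \<Omega>"
  shows "cmod ((deriv ^^ l) (f i) z - (deriv ^^ l) (f j) z) \<le> 1 / 2 ^ k i - 1 / 2 ^ k j"
  using ij
proof (induction j rule: dec_induct)
  case base thus ?case by simp
next
  case (step m)
  have "k i \<le> k m" using lift_Suc_mono_le[of k i m] k step by (simp add: less_imp_le)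
  hence "z \<in> L (Suc (k m)) \<inter> \<Omega>" using z L_mono[of "k i" "Suc (k m)"] by auto
  hence "cmod ((deriv ^^ l) (f m) z - (deriv ^^ l) (f (Suc m)) z) \<le> 1 / 2 ^ Suc (k m)"
    using assms(1)[of m] l \<open>k i \<le> k m\<close> unfolding near_def by simp
  moreover have "(1 :: real) / 2 ^ k (Suc m) \<le> 1 / 2 ^ Suc (k m)"
    using k[of m] by (intro divide_left_mono power_increasing) auto
  moreover have "(1 :: real) / 2 ^ Suc (k m) = (1 / 2 ^ k m) / 2" by simp
  ultimately show ?case
    using step.IH norm_triangle_ineq[of "(deriv ^^ l) (f i) z - (deriv ^^ l) (f m) z" "(deriv ^^ l) (f m) z - (deriv ^^ l) (f (Suc m)) z"]
    by simp
qed

text \<open>The steps are summable in every derivative on every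
  \<open>L n \<inter> \<Omega>\<close>. Weierstrass' theorem gives a holomorphic limit and
  convergence of derivatives; the estimates pass to the limit and carry uniform continuity with
  them.\<close>

lemma T_complete:
  assumes f: "\<And>i. f i \<in> T_space \<Omega> L"
    and step: "\<And>i. near (Suc (k i)) (f i) (f (Suc i))" and k: "\<And>i. k i < k (Suc i)"
  obtains g where "g \<in> T_space \<Omega> L" "\<And>i. near (k i) (f i) g"
proof -
  have smf: "smooth (f i)" for i using f by (simp add: T_space_iff)
  have ki: "i \<le> k i" for i using k by (induction i) (auto simp: Suc_le_eq intro: order.strict_trans1)
  have small: "cmod ((deriv ^^ l) (f i) z - (deriv ^^ l) (f j) z) \<le> 1 / 2 ^ k i"
    if "i \<le> j" "l \<le> k i" "z \<in> L (k i) \<inter> \<Omega>" for i j l z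
  proof -
    have "0 \<le> (1 :: real) / 2 ^ k j" by simp
    thus ?thesis using near_chain[OF step k that] by linarith
  qed
  have pow: "(1 :: real) / 2 ^ k i \<le> (1 / 2) ^ i" for i
    unfolding power_one_over[symmetric] using ki by (intro power_decreasing) auto
  have "\<exists>v. (\<lambda>i. f i z) \<longlonglongrightarrow> v" if z: "z \<in> \<Omega>" for z
  proof -
    obtain n where n: "z \<in> L n" using in_some_L[OF z] by blast
    have "Cauchy (\<lambda>i. f i z)"
      unfolding Cauchy_altdef2
    proof (intro allI impI)
      fix e :: real assume "e > 0"
      then obtain m where m: "(1 / 2 :: real) ^ m < e" using real_arch_pow_inv[of e "1 / 2"] by auto
      define N where "N = max m n"
      have "(1 / 2 :: real) ^ N \<le> (1 / 2) ^ m" unfolding N_def by (intro power_decreasing) auto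
      moreover have "dist (f j z) (f N z) \<le> (1 / 2) ^ N" if "N \<le> j" for j
      proof -
        have "n \<le> k N" using ki[of N] by (simp add: N_def)
        hence "z \<in> L (k N) \<inter> \<Omega>" using n z L_mono by blast
        from small[OF that _ this, of 0] have "cmod (f N z - f j z) \<le> 1 / 2 ^ k N" by simp
        thus ?thesis using pow[of N] by (simp add: dist_norm norm_minus_commute)
      qed
      ultimately show "\<exists>N. \<forall>n\<ge>N. dist (f n z) (f N z) < e" using m by (meson le_less_trans order.trans)
    qed
    thus ?thesis by (simp add: Cauchy_convergent_iff convergent_def)
  qed
  then obtain g0 where g0: "\<And>z. z \<in> \<Omega> \<Longrightarrow> (\<lambda>i. f i z) \<longlonglongrightarrow> g0 z" by metis
  have ulim: "uniform_limit (L n \<inter> \<Omega>) f g0 sequentially" for n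
  proof (rule uniform_limitI)
    fix e :: real assume "e > 0"
    then obtain m where m: "(1 / 2 :: real) ^ m < e" using real_arch_pow_inv[of e "1 / 2"] by auto
    have "dist (f i z) (g0 z) < e" if i: "i \<ge> max m n" and z: "z \<in> L n \<inter> \<Omega>" for i z
    proof -
      have "n \<le> k i" using ki[of i] i by simp
      hence z': "z \<in> L (k i) \<inter> \<Omega>" using z L_mono by blast
      have "(\<lambda>j. cmod (f i z - f j z)) \<longlonglongrightarrow> cmod (f i z - g0 z)"
        using g0 z by (intro tendsto_intros) auto
      moreover have "\<forall>\<^sub>F j in sequentially. cmod (f i z - f j z) \<le> (1 / 2) ^ i"
        using small[of i _ 0 z] z' pow[of i] by (intro eventually_sequentiallyI[of i]) (force intro: order.trans)
      ultimately have "cmod (f i z - g0 z) \<le> (1 / 2) ^ i" by (rule tendsto_upperbound) simp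
      also have "\<dots> \<le> (1 / 2) ^ m" using i by (intro power_decreasing) auto
      finally show ?thesis using m by (simp add: dist_norm)
    qed
    thus "\<forall>\<^sub>F i in sequentially. \<forall>z\<in>L n \<inter> \<Omega>. dist (f i z) (g0 z) < e"
      by (intro eventually_sequentiallyI[of "max m n"]) blast
  qed
  \<comment> \<open>A closed disc in \<open>\<Omega>\<close> lies in one \<open>L n\<close> by
    exhaustion, so uniform convergence on the sets \<open>L n \<inter> \<Omega>\<close> is locally
    uniform on \<open>\<Omega>\<close>.\<close>
  have loc: "\<exists>d. 0 < d \<and> cball z d \<subseteq> \<Omega> \<and> uniform_limit (cball z d) f g0 sequentially" if "z \<in> \<Omega>" for z
  proof -
    obtain r n where "r > 0" "cball z r \<subseteq> \<Omega>" "cball z r \<subseteq> L n" by (rule nbhd_in_L[OF \<open>z \<in> \<Omega>\<close>])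
    thus ?thesis using uniform_limit_on_subset[OF ulim[of n], of "cball z r"] by blast
  qed
  have hol: "g0 holomorphic_on \<Omega>"
    by (rule holomorphic_uniform_sequence[OF open_\<Omega> _ loc]) (use smf in \<open>auto simp: smooth_def\<close>)
  have dlim: "(\<lambda>i. (deriv ^^ l) (f i) z) \<longlonglongrightarrow> (deriv ^^ l) g0 z" if z: "z \<in> \<Omega>" for l z
  proof -
    obtain d where d: "0 < d" "cball z d \<subseteq> \<Omega>" "uniform_limit (cball z d) f g0 sequentially" using loc[OF z] by blast
    show ?thesis
    proof (rule higher_deriv_complex_uniform_limit)
      show "uniform_limit (ball z d) f g0 sequentially"
        using d(3) ball_subset_cball uniform_limit_on_subset by blast
      have "ball z d \<subseteq> \<Omega>" using d(2) ball_subset_cball by blast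
      thus "\<forall>\<^sub>F n in sequentially. f n holomorphic_on ball z d"
        using smf unfolding smooth_def by (blast intro: always_eventually holomorphic_on_subset)
    qed (use d in auto)
  qed
  have near0: "near (k i) (f i) g0" for i
    unfolding near_def
  proof (intro allI impI ballI)
    fix l z assume l: "l \<le> k i" and z: "z \<in> L (k i) \<inter> \<Omega>"
    have "(\<lambda>j. cmod ((deriv ^^ l) (f i) z - (deriv ^^ l) (f j) z)) \<longlonglongrightarrow> cmod ((deriv ^^ l) (f i) z - (deriv ^^ l) g0 z)"
      using dlim z by (intro tendsto_intros) auto
    moreover have "\<forall>\<^sub>F j in sequentially. cmod ((deriv ^^ l) (f i) z - (deriv ^^ l) (f j) z) \<le> 1 / 2 ^ k i"
      using small[OF _ l z] by (intro eventually_sequentiallyI[of i]) auto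
    ultimately show "cmod ((deriv ^^ l) (f i) z - (deriv ^^ l) g0 z) \<le> 1 / 2 ^ k i" by (rule tendsto_upperbound) simp
  qed
  have "smooth g0"
    unfolding smooth_def
  proof (intro conjI allI hol)
    fix l n
    show "uniformly_continuous_on (L n \<inter> \<Omega>) ((deriv ^^ l) g0)"
      unfolding uniformly_continuous_on_def
    proof (intro allI impI)
      fix e :: real assume e: "e > 0"
      then obtain m where m: "(1 / 2 :: real) ^ m < e / 3" using real_arch_pow_inv[of "e / 3" "1 / 2"] by auto
      define i where "i = max m (max l n)"
      have i: "l \<le> k i" "n \<le> k i" "m \<le> i" using ki[of i] by (auto simp: i_def)
      have "(1 / 2 :: real) ^ i \<le> (1 / 2) ^ m" using i by (intro power_decreasing) auto
      hence close: "dist ((deriv ^^ l) (f i) z) ((deriv ^^ l) g0 z) < e / 3" if "z \<in> L n \<inter> \<Omega>" for z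
        using near0[of i] that L_mono[OF i(2)] i(1) pow[of i] m unfolding near_def dist_norm
        by (meson IntD1 IntD2 IntI le_less_trans subsetD order.trans)
      obtain d where d: "d > 0" "\<And>x x'. x \<in> L n \<inter> \<Omega> \<Longrightarrow> x' \<in> L n \<inter> \<Omega> \<Longrightarrow> dist x' x < d \<Longrightarrow>
          dist ((deriv ^^ l) (f i) x') ((deriv ^^ l) (f i) x) < e / 3"
      proof -
        have "uniformly_continuous_on (L n \<inter> \<Omega>) ((deriv ^^ l) (f i))" using smf by (simp add: smooth_def)
        moreover have "e / 3 > 0" using e by simp
        ultimately show ?thesis using that unfolding uniformly_continuous_on_def by metis
      qed
      have "dist ((deriv ^^ l) g0 x') ((deriv ^^ l) g0 x) < e"
        if "x \<in> L n \<inter> \<Omega>" "x' \<in> L n \<inter> \<Omega>" "dist x' x < d" for x x'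
        using close[OF that(1)] close[OF that(2)] d(2)[OF that]
          dist_triangle[of "(deriv ^^ l) g0 x'" "(deriv ^^ l) g0 x" "(deriv ^^ l) (f i) x'"]
          dist_triangle[of "(deriv ^^ l) (f i) x'" "(deriv ^^ l) g0 x" "(deriv ^^ l) (f i) x"]
        by (simp add: dist_commute)
      thus "\<exists>d>0. \<forall>x\<in>L n \<inter> \<Omega>. \<forall>x'\<in>L n \<inter> \<Omega>. dist x' x < d \<longrightarrow> dist ((deriv ^^ l) g0 x') ((deriv ^^ l) g0 x) < e"
        using d(1) by blast
    qed
  qed
  hence "restrict g0 \<Omega> \<in> T_space \<Omega> L" by (rule restrict_in_T_space)
  moreover have "near (k i) (f i) (restrict g0 \<Omega>)" for i
    using near0[of i] unfolding near_def by (simp add: higher_deriv_restrict)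
  ultimately show thesis using that by blast
qed

text \<open>Baire's argument with the sets \<open>{g. near k f g}\<close> as shrinking closed balls,
  through \<open>T_complete\<close>. Keeping \<open>g\<close> near the prescribed \<open>f0\<close>
  yields density as well as existence.\<close>

lemma baire_Y:
  fixes V :: "nat \<Rightarrow> (complex \<Rightarrow> complex) set"
  assumes op: "\<And>i. openin (Y_topology \<Omega> L) (V i)"
    and dense: "\<And>i f k. f \<in> Y \<Longrightarrow> \<exists>g\<in>V i. near k f g"
    and f0: "f0 \<in> Y"
  obtains g where "g \<in> Y" "near k0 f0 g" "\<And>i. g \<in> V i"
proof -
  have sub: "g \<in> Y" if "g \<in> V i" for g i using op[of i] that unfolding openin_Y_iff by blast
  define P where "P n x \<longleftrightarrow> fst x \<in> Y \<and> (n = 0 \<longrightarrow> x = (f0, k0))" for n :: nat and x :: "(complex \<Rightarrow> complex) \<times> nat"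
  \<comment> \<open>A state is a function with a level. The next function is near the current one at
    level \<open>Suc\<close>, as \<open>T_complete\<close> requires, and the next level is so high
    that its whole neighbourhood in \<open>Y\<close> lies in \<open>V n\<close>.\<close>
  define Q where "Q n x y \<longleftrightarrow> near (Suc (snd x)) (fst x) (fst y) \<and> snd x < snd y \<and>
      (\<forall>g\<in>Y. near (snd y) (fst y) g \<longrightarrow> g \<in> V n)" for n :: nat and x y :: "(complex \<Rightarrow> complex) \<times> nat"
  have "\<exists>s. \<forall>n. P n (s n) \<and> Q n (s n) (s (Suc n))"
  proof (rule dependent_nat_choice)
    show "\<exists>x. P 0 x" using f0 by (auto simp: P_def)
    fix x n assume "P n x"
    hence "fst x \<in> Y" by (simp add: P_def)
    then obtain g where g: "g \<in> V n" "near (Suc (snd x)) (fst x) g" using dense by blast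
    obtain k1 where k1: "\<forall>h\<in>Y. near k1 g h \<longrightarrow> h \<in> V n" using op[of n] g(1) unfolding openin_Y_iff by blast
    define k where "k = max k1 (Suc (snd x))"
    have "\<forall>h\<in>Y. near k g h \<longrightarrow> h \<in> V n" using k1 near_mono[of k g _ k1] by (simp add: k_def)
    hence "Q n x (g, k)" using g(2) by (simp add: Q_def k_def)
    moreover have "P (Suc n) (g, k)" using sub[OF g(1)] by (simp add: P_def)
    ultimately show "\<exists>y. P (Suc n) y \<and> Q n x y" by blast
  qed
  then obtain s where s: "\<And>n. P n (s n)" "\<And>n. Q n (s n) (s (Suc n))" by blast
  have sY: "fst (s n) \<in> Y" for n using s(1)[of n] by (simp add: P_def)
  obtain g where g: "g \<in> T_space \<Omega> L" "\<And>i. near (snd (s i)) (fst (s i)) g"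
    by (rule T_complete[of "\<lambda>i. fst (s i)" "\<lambda>i. snd (s i)"]) (use s(2) sY Y_subset_T in \<open>auto simp: Q_def\<close>)
  have gY: "g \<in> Y"
  proof (rule Y_closed[OF g(1)])
    fix k
    have "i \<le> snd (s i)" for i
    proof (induction i)
      case (Suc i)
      have "snd (s i) < snd (s (Suc i))" using s(2)[of i] by (simp add: Q_def)
      thus ?case using Suc by simp
    qed simp
    hence "near k (fst (s k)) g" using near_mono[OF g(2)] by blast
    thus "\<exists>h\<in>Y. near k g h" using sY near_sym by blast
  qed
  moreover have "near k0 f0 g" using g(2)[of 0] s(1)[of 0] by (simp add: P_def)
  moreover have "g \<in> V i" for i using s(2)[of i] g(2)[of "Suc i"] gY by (simp add: Q_def)
  ultimately show thesis using that by blast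
qed

end

text \<open>A bounded component of the plane complement of \<open>A\<close> is open and closed in
  the spherical complement, so the spherical component of \<open>a\<close> lies inside it. The
  component of the complement of \<open>B\<close> provided by \<open>holes\<close> then supplies the
  point, which is finite.\<close>

lemma sphere_hole:
  assumes A: "compact A" and a: "a \<notin> A" and bdd: "bounded (connected_component_set (- A) a)"
    and holes: "\<forall>C \<in> sphere_components (sphere_compl A). \<exists>D \<in> sphere_components (sphere_compl B). D \<subseteq> C"
  shows "\<exists>b\<in>connected_component_set (- A) a. b \<notin> B"
proof -
  let ?C0 = "connected_component_set (- A) a"
  let ?X = "subtopology riemann_sphere (sphere_compl A)"
  let ?E = "Some ` ?C0"
  have topX: "topspace (subtopology riemann_sphere (sphere_compl S)) = sphere_compl S" for S
    by (auto simp: sphere_compl_def)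
  have opA: "open (- A)" using A by (simp add: compact_imp_closed open_Compl)
  have op0: "open ?C0" using opA by (rule open_connected_component)
  have sub0: "?C0 \<subseteq> - A" by (rule connected_component_subset)
  \<comment> \<open>A closure point outside \<open>A\<close> has an open component of its own; this
    meets the given one and hence coincides with it.\<close>
  have cl0: "z \<in> ?C0" if z: "z \<in> closure ?C0" "z \<notin> A" for z
  proof -
    let ?Cz = "connected_component_set (- A) z"
    have op: "open ?Cz" using opA by (rule open_connected_component)
    have "z \<in> ?Cz" using z by simp
    hence "?Cz \<inter> ?C0 \<noteq> {}" using z(1) open_Int_closure_eq_empty[OF op, of ?C0] by blast
    then obtain y where "connected_component (- A) z y" "connected_component (- A) a y" by auto
    thus ?thesis by (metis connected_component_sym connected_component_trans mem_Collect_eq)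
  qed
  have E_open: "openin ?X ?E"
  proof -
    have "openin riemann_sphere ?E" using op0 by (auto simp: openin_Alexandroff_compactification)
    moreover have "?E \<subseteq> sphere_compl A" using sub0 by (auto simp: sphere_compl_def)
    ultimately show ?thesis unfolding openin_subtopology by (metis Int_absorb2)
  qed
  have E_closed: "closedin ?X ?E"
  proof -
    \<comment> \<open>Boundedness enters here: the complement of a compact set, together with
      infinity, is open in the sphere.\<close>
    have "compact (closure ?C0)" using bdd by simp
    hence "openin riemann_sphere (insert None (Some ` (UNIV - closure ?C0)))"
      unfolding openin_Alexandroff_compactification by (intro disjI2 exI[of _ "closure ?C0"]) simp
    moreover have "sphere_compl A - ?E = insert None (Some ` (UNIV - closure ?C0)) \<inter> sphere_compl A"
      using cl0 closure_subset[of ?C0] by (auto simp: sphere_compl_def)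
    ultimately have "openin ?X (topspace ?X - ?E)" unfolding topX openin_subtopology by blast
    moreover have "?E \<subseteq> topspace ?X" using sub0 unfolding topX by (auto simp: sphere_compl_def)
    ultimately show ?thesis by (simp add: closedin_def)
  qed
  have aX: "Some a \<in> topspace ?X" unfolding topX using a by (simp add: sphere_compl_def)
  let ?C = "connected_component_of_set ?X (Some a)"
  have "?C \<in> sphere_components (sphere_compl A)"
    unfolding sphere_components_def connected_components_of_def using aX by blast
  then obtain D where D: "D \<in> sphere_components (sphere_compl B)" "D \<subseteq> ?C" using holes by blast
  have "?C \<subseteq> ?E \<or> disjnt ?C ?E"
    by (rule connectedin_clopen_cases[OF connectedin_connected_component_of E_closed E_open])
  moreover have "Some a \<in> ?C" using aX by (simp add: connected_component_of_refl)
  moreover have "Some a \<in> ?E" using a by auto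
  ultimately have "?C \<subseteq> ?E" by (auto simp: disjnt_def)
  moreover obtain x where x: "x \<in> D"
    using D(1) nonempty_connected_components_of unfolding sphere_components_def by blast
  moreover have "D \<subseteq> sphere_compl B"
    using connected_components_of_subset[OF D(1)[unfolded sphere_components_def]] unfolding topX .
  ultimately have "x \<in> ?E" "x \<in> sphere_compl B" using D(2) by blast+
  thus ?thesis by (auto simp: sphere_compl_def)
qed

section \<open>A countable dense family of rational targets\<close>

lemma poly_approx_countable:
  fixes A :: "complex poly"
  assumes Q: "\<And>U :: complex set. open U \<Longrightarrow> U \<noteq> {} \<Longrightarrow> \<exists>d\<in>Q. d \<in> U" and R: "R > 0" and e: "e > 0"
  shows "\<exists>cs\<in>lists Q. \<forall>z. cmod z \<le> R \<longrightarrow> cmod (poly A z - poly (Poly cs) z) < e"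
  using e
proof (induction A arbitrary: e)
  case 0 thus ?case by (intro bexI[of _ "[]"]) auto
next
  case (pCons a A)
  obtain c where c: "c \<in> Q" "cmod (a - c) < e / 2"
    using Q[of "ball a (e / 2)"] pCons.prems by (auto simp: dist_norm)
  obtain cs where cs: "cs \<in> lists Q" "\<And>z. cmod z \<le> R \<Longrightarrow> cmod (poly A z - poly (Poly cs) z) < e / (2 * R)"
    using pCons.IH[of "e / (2 * R)"] pCons.prems R by auto
  have "cmod (poly (pCons a A) z - poly (Poly (c # cs)) z) < e" if z: "cmod z \<le> R" for z
  proof -
    have "poly (pCons a A) z - poly (Poly (c # cs)) z = (a - c) + z * (poly A z - poly (Poly cs) z)"
      by (simp add: algebra_simps)
    hence "cmod (poly (pCons a A) z - poly (Poly (c # cs)) z) \<le> cmod (a - c) + cmod z * cmod (poly A z - poly (Poly cs) z)"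
      using norm_triangle_ineq by (metis norm_mult)
    also have "cmod z * cmod (poly A z - poly (Poly cs) z) \<le> R * (e / (2 * R))"
      using z cs(2)[OF z] R by (intro mult_mono) auto
    also have "R * (e / (2 * R)) = e / 2" using R by simp
    finally show ?thesis using c by simp
  qed
  moreover have "c # cs \<in> lists Q" using c cs by auto
  ultimately show ?case by blast
qed

text \<open>Numerator and denominator of \<open>h\<close> are approximated separately by polynomials
  with coefficients in a countable dense set; \<open>chordal_perturb\<close> turns this into uniform
  chordal closeness, poles in \<open>K\<close> included.\<close>

lemma countable_dense_ratfuns:
  obtains H :: "ratfun set" where "countable H" "H \<noteq> {}"
    "\<And>h K e. compact K \<Longrightarrow> e > 0 \<Longrightarrow> \<exists>h'\<in>H. \<forall>z\<in>K. chordal (rat_sphere h' z) (rat_sphere h z) \<le> e"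
proof -
  obtain Q :: "complex set" where Q: "countable Q" "\<And>U. open U \<Longrightarrow> U \<noteq> {} \<Longrightarrow> \<exists>d\<in>Q. d \<in> U"
    using countable_dense_exists by blast
  define H where "H = (\<lambda>(as, bs). to_fract (Poly as) / to_fract (Poly bs)) ` (lists Q \<times> lists Q)"
  have cnt: "countable H" unfolding H_def using Q(1) by (intro countable_image countable_SIGMA countable_lists)
  have dense: "\<exists>h'\<in>H. \<forall>z\<in>K. chordal (rat_sphere h' z) (rat_sphere h z) \<le> e"
    if K: "compact K" and e: "e > 0" for h K e
  proof -
    let ?A = "fst (quot_of_fract h)" and ?B = "snd (quot_of_fract h)"
    have cop: "\<not> (poly ?A z = 0 \<and> poly ?B z = 0)" for z
      using coprime_poly_no_common_root[OF coprime_quot_of_fract] .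
    obtain x0 where x0: "poly ?B x0 \<noteq> 0"
      using poly_all_0_iff_0[of ?B] by auto
    obtain \<gamma> where \<gamma>: "\<gamma> > 0" "\<And>z. z \<in> K \<Longrightarrow> \<gamma> \<le> hnorm (poly ?A z) (poly ?B z)"
      by (rule continuous_positive_lower_bound[OF K continuous_hnorm_poly[of K ?A ?B]])
         (use cop in \<open>auto simp: hnorm_pos_iff\<close>)
    obtain R0 where R0: "\<And>z. z \<in> K \<Longrightarrow> cmod z \<le> R0" using compact_imp_bounded[OF K] by (auto simp: bounded_iff)
    \<comment> \<open>The disc also contains \<open>x0\<close>, where the denominator is nonzero.
      With \<open>t \<le> cmod (poly ?B x0)\<close> this prevents the approximating denominator from
      being the zero polynomial.\<close>
    define R where "R = max 1 (max R0 (cmod x0))"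
    have R: "R > 0" "cmod x0 \<le> R" "\<And>z. z \<in> K \<Longrightarrow> cmod z \<le> R" using R0 by (force simp: R_def)+
    define t where "t = min (cmod (poly ?B x0)) (min (\<gamma> / 4) (e * \<gamma> / 4))"
    have t: "t > 0" "t \<le> cmod (poly ?B x0)" "t \<le> \<gamma> / 4" "t \<le> e * \<gamma> / 4" using x0 \<gamma>(1) e by (auto simp: t_def)
    have t2: "2 * t < \<gamma>" using t(1,3) \<gamma>(1) by linarith
    obtain as where as: "as \<in> lists Q" "\<And>z. cmod z \<le> R \<Longrightarrow> cmod (poly ?A z - poly (Poly as) z) < t"
      using poly_approx_countable[OF Q(2) R(1) t(1)] by blast
    obtain bs where bs: "bs \<in> lists Q" "\<And>z. cmod z \<le> R \<Longrightarrow> cmod (poly ?B z - poly (Poly bs) z) < t"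
      using poly_approx_countable[OF Q(2) R(1) t(1)] by blast
    have B0: "Poly bs \<noteq> 0"
    proof
      assume "Poly bs = 0"
      hence "cmod (poly ?B x0) < t" using bs(2)[OF R(2)] by simp
      thus False using t(2) by simp
    qed
    have "chordal (rat_sphere (to_fract (Poly as) / to_fract (Poly bs)) z) (rat_sphere h z) \<le> e" if z: "z \<in> K" for z
    proof -
      have d: "cmod (poly (Poly as) z - poly ?A z) \<le> t" "cmod (poly (Poly bs) z - poly ?B z) \<le> t"
        using as(2)[OF R(3)[OF z]] bs(2)[OF R(3)[OF z]] by (simp_all add: norm_minus_commute)
      note cp = chordal_perturb[OF d t2 \<gamma>(2)[OF z]]
      have "rat_sphere (to_fract (Poly as) / to_fract (Poly bs)) z = proj_pt (poly (Poly as) z) (poly (Poly bs) z)"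
        using cp(1) by (intro rat_sphere_quotient[OF B0]) blast
      hence "chordal (rat_sphere (to_fract (Poly as) / to_fract (Poly bs)) z) (rat_sphere h z) \<le> 2 * t / \<gamma>"
        using cp(2) by (simp add: rat_sphere_eq_proj_pt)
      also have "\<dots> \<le> 2 * (e * \<gamma> / 4) / \<gamma>" using t(4) \<gamma>(1) by (intro divide_right_mono mult_left_mono) auto
      also have "\<dots> \<le> e" using \<gamma>(1) e by simp
      finally show ?thesis .
    qed
    moreover have "to_fract (Poly as) / to_fract (Poly bs) \<in> H" using as(1) bs(1) unfolding H_def by (auto intro!: image_eqI[of _ _ "(as, bs)"])
    ultimately show ?thesis by blast
  qed
  from dense[of "{}" 1] have ne: "H \<noteq> {}" by auto
  show thesis by (rule that[OF cnt ne dense])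
qed

context exhaustion
begin

section \<open>Rational functions without poles on the sets \<open>L n\<close>\<close>

lemma rational_smooth:
  assumes B: "\<And>n z. z \<in> L n \<Longrightarrow> poly B z \<noteq> 0"
  shows "smooth (ratio A B)"
    and "continuous_on (L n) ((deriv ^^ l) (ratio A B))"
proof -
  let ?W = "{w. poly B w \<noteq> 0}"
  have hol: "(ratio A B) holomorphic_on ?W" by (rule holomorphic_on_quotient_poly) auto
  have cont: "continuous_on (L n) ((deriv ^^ l) (ratio A B))" for l n
    using holomorphic_higher_deriv[OF hol open_nonroots, of l] B
    by (intro holomorphic_on_imp_continuous_on) (auto intro: holomorphic_on_subset)
  show "smooth (ratio A B)"
    unfolding smooth_def
  proof (intro conjI allI)
    have "\<Omega> \<subseteq> ?W" using B in_some_L by blast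
    thus "(ratio A B) holomorphic_on \<Omega>" using hol holomorphic_on_subset by blast
    fix l n
    have "uniformly_continuous_on (L n) ((deriv ^^ l) (ratio A B))"
      by (rule compact_uniformly_continuous[OF cont compact_L])
    thus "uniformly_continuous_on (L n \<inter> \<Omega>) ((deriv ^^ l) (ratio A B))"
      unfolding uniformly_continuous_on_def by (meson IntD1)
  qed
  show "continuous_on (L n) ((deriv ^^ l) (ratio A B))" by (rule cont)
qed

lemma D_rational:
  assumes B: "\<And>n z. z \<in> L n \<Longrightarrow> poly B z \<noteq> 0" and z: "z \<in> L n"
  shows "D (restrict (ratio A B) \<Omega>) l z = (deriv ^^ l) (ratio A B) z"
proof (rule eq_on_L[of n "D (restrict (ratio A B) \<Omega>) l" "(deriv ^^ l) (ratio A B)"])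
  have "smooth (ratio A B)" by (rule rational_smooth(1)) (rule B)
  hence "smooth (restrict (ratio A B) \<Omega>)"
    using restrict_in_T_space by (simp add: T_space_iff)
  thus "continuous_on (L n) (D (restrict (ratio A B) \<Omega>) l)" by (rule continuous_on_D)
  show "continuous_on (L n) ((deriv ^^ l) (ratio A B))" by (rule rational_smooth(2)) (rule B)
qed (simp_all add: higher_deriv_restrict z)

lemma rational_in_Y:
  assumes "B \<noteq> 0" and B: "\<And>n z. z \<in> L n \<Longrightarrow> poly B z \<noteq> 0"
  shows "restrict (ratio A B) \<Omega> \<in> Y"
proof -
  let ?R = "to_fract A / to_fract B"
  have "restrict (ratio A B) \<Omega> = restrict (rat_fun ?R) \<Omega>"
    using B in_some_L by (intro restrict_ext) (metis rat_fun_quotient)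
  moreover have "\<forall>z \<in> (\<Union>n. L n). \<not> is_rat_pole ?R z"
  proof
    fix z assume "z \<in> (\<Union>n. L n)"
    thus "\<not> is_rat_pole ?R z" using is_rat_pole_quotient[OF assms(1), of A z] B by auto
  qed
  ultimately have mem: "restrict (ratio A B) \<Omega> \<in>
      {restrict (rat_fun R) \<Omega> | R. \<forall>z \<in> (\<Union>n. L n). \<not> is_rat_pole R z}" by blast
  have T: "restrict (ratio A B) \<Omega> \<in> T_space \<Omega> L"
    by (rule restrict_in_T_space, rule rational_smooth(1), rule B)
  show ?thesis
    unfolding Y_space_def in_closure_T_iff
    by (intro conjI allI T bexI[OF _ mem] near_refl)
qed

lemma Y_approx_rational:
  assumes "f \<in> Y"
  obtains A B where "\<And>n z. z \<in> L n \<Longrightarrow> poly B z \<noteq> 0" "near k f (restrict (ratio A B) \<Omega>)"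
proof -
  obtain R where R: "\<forall>z \<in> (\<Union>n. L n). \<not> is_rat_pole R z" "near k f (restrict (rat_fun R) \<Omega>)"
    using assms unfolding Y_space_def in_closure_T_iff by blast
  show thesis
  proof (rule that)
    show "poly (snd (quot_of_fract R)) z \<noteq> 0" if "z \<in> L n" for n z
      using R(1) that by (auto simp: is_rat_pole_def)
    show "near k f (restrict (\<lambda>w. poly (fst (quot_of_fract R)) w / poly (snd (quot_of_fract R)) w) \<Omega>)"
      using R(2) by (simp add: rat_fun_def[abs_def])
  qed
qed

end

section \<open>Generic universality\<close>

text \<open>\<open>Z\<close> is the set to be kept free of poles, later the closure of
  \<open>\<Omega>\<close>. The spherical hypothesis (b) appears as \<open>holes\<close>, a statement
  about the plane.\<close>

locale pade_setting = exhaustion +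
  fixes K :: "nat \<Rightarrow> complex set" and F :: "(nat \<times> nat) set" and Z :: "complex set"
  assumes compact_K: "\<And>s. compact (K s)"
    and L_K_disjoint: "\<And>s n. L n \<inter> K s = {}"
    and L_Z: "\<And>n. L n \<subseteq> Z"
    and holes: "\<And>n a. a \<notin> L n \<Longrightarrow> bounded (connected_component_set (- L n) a) \<Longrightarrow>
       \<exists>b\<in>connected_component_set (- L n) a. b \<notin> Z"
    and F_unbounded: "\<And>N. \<exists>p q. (p, q) \<in> F \<and> N \<le> p \<and> N \<le> q"
begin

abbreviation coeffs :: "(complex \<Rightarrow> complex) \<Rightarrow> complex \<Rightarrow> nat \<Rightarrow> complex" where
  "coeffs \<equiv> taylor_coeff \<Omega> L"

text \<open>The index \<open>N\<close> governs the compact set, the number of derivatives and the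
  tolerance together, so that countably many conditions suffice.\<close>

definition pade_close :: "ratfun \<Rightarrow> nat \<Rightarrow> nat \<Rightarrow> nat \<Rightarrow> nat \<Rightarrow> (complex \<Rightarrow> complex) \<Rightarrow> bool" where
  "pade_close h s N p q f \<longleftrightarrow> (\<forall>\<zeta>\<in>L N. \<forall>z\<in>L N \<union> K s.
     pade_good p q N (1 / Suc N) (L N) (K s) h (coeffs f \<zeta>) \<zeta> (coeffs f z) z)"

definition good_set :: "ratfun \<Rightarrow> nat \<Rightarrow> nat \<Rightarrow> (complex \<Rightarrow> complex) set" where
  "good_set h s N = {f \<in> Y. \<exists>(p, q)\<in>F. pade_close h s N p q f}"

lemma continuous_on_coeffs: "smooth f \<Longrightarrow> continuous_on (L n) (\<lambda>\<zeta>. coeffs f \<zeta> k)"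
  unfolding taylor_coeff_def by (intro continuous_intros continuous_on_D) auto

lemma norm_div_fact_le: "cmod (w / fact k) \<le> cmod w"
proof -
  have "cmod w / fact k \<le> cmod w / 1" by (intro divide_left_mono fact_ge_1) auto
  thus ?thesis by (simp add: norm_divide)
qed

text \<open>\<open>pade_good_stable\<close> gives a radius for the coefficients of orders up to
  \<open>J\<close>. Dividing by a factorial does not enlarge differences of derivatives, so a level
  \<open>k\<close> above \<open>J\<close> and \<open>N\<close> with \<open>1 / 2 ^ k\<close> below
  the radius works.\<close>

lemma openin_good_set: "openin (Y_topology \<Omega> L) (good_set h s N)"
  unfolding openin_Y_iff
proof (intro conjI ballI)
  show "good_set h s N \<subseteq> Y" by (auto simp: good_set_def)
  fix f assume "f \<in> good_set h s N"
  then obtain p q where f: "f \<in> Y" and pq: "(p, q) \<in> F" "pade_close h s N p q f" by (auto simp: good_set_def)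
  have smf: "smooth f" using f by (rule smooth_Y)
  define J where "J = max (p + q) N"
  obtain \<delta> where \<delta>: "\<delta> > 0" "\<And>b \<zeta> z. \<forall>\<zeta>\<in>L N. \<forall>k\<le>J. cmod (b \<zeta> k - coeffs f \<zeta> k) < \<delta> \<Longrightarrow> \<zeta> \<in> L N \<Longrightarrow> z \<in> L N \<union> K s \<Longrightarrow>
       pade_good p q N (1 / Suc N) (L N) (K s) h (b \<zeta>) \<zeta> (b z) z"
  proof (rule pade_good_stable[of "L N" "K s" "coeffs f" p q N "1 / Suc N" h J])
    show "pade_good p q N (1 / Suc N) (L N) (K s) h (coeffs f \<zeta>) \<zeta> (coeffs f z) z"
      if "\<zeta> \<in> L N" "z \<in> L N \<union> K s" for \<zeta> z using pq(2) that unfolding pade_close_def by blast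
  qed (use compact_L compact_K L_K_disjoint continuous_on_coeffs[OF smf] in \<open>auto simp: J_def\<close>)
  obtain m where m: "(1 / 2 :: real) ^ m < \<delta>" using real_arch_pow_inv[OF \<delta>(1), of "1 / 2"] by auto
  define k where "k = max m (max J N)"
  have k: "m \<le> k" "J \<le> k" "N \<le> k" by (auto simp: k_def)
  have "(1 / 2 :: real) ^ k \<le> (1 / 2) ^ m" using k(1) by (intro power_decreasing) auto
  hence k\<delta>: "1 / 2 ^ k < \<delta>" using m by (simp add: power_one_over)
  have "g \<in> good_set h s N" if g: "g \<in> Y" "near k f g" for g
  proof -
    have smg: "smooth g" using g(1) by (rule smooth_Y)
    have "cmod (coeffs g \<zeta> l - coeffs f \<zeta> l) < \<delta>" if "\<zeta> \<in> L N" "l \<le> J" for \<zeta> l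
    proof -
      have "cmod (coeffs g \<zeta> l - coeffs f \<zeta> l) = cmod ((D f l \<zeta> - D g l \<zeta>) / fact l)"
        by (simp add: taylor_coeff_def norm_minus_commute flip: diff_divide_distrib)
          (simp add: norm_divide norm_minus_commute)
      also have "\<dots> \<le> cmod (D f l \<zeta> - D g l \<zeta>)" by (rule norm_div_fact_le)
      also have "\<dots> \<le> 1 / 2 ^ k" using that k by (intro near_D[OF g(2) smf smg]) auto
      finally show ?thesis using k\<delta> by simp
    qed
    hence "pade_close h s N p q g" unfolding pade_close_def using \<delta>(2)[of "coeffs g"] by blast
    thus ?thesis using g(1) pq(1) by (auto simp: good_set_def)
  qed
  thus "\<exists>k. \<forall>g\<in>Y. near k f g \<longrightarrow> g \<in> good_set h s N" by blast
qed

lemma pade_good_rational: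
  assumes cop: "coprime A B" and deg: "degree A = p" "degree B \<le> q" and A0: "A \<noteq> 0"
    and B: "\<And>w. w \<in> X \<Longrightarrow> poly B w \<noteq> 0" and \<zeta>: "\<zeta> \<in> X" and \<epsilon>: "\<epsilon> > 0"
    and chord: "z \<in> K' \<Longrightarrow> chordal (proj_pt (poly A z) (poly B z)) (rat_sphere h z) < \<epsilon>"
    and b: "\<And>w l. b w l = (deriv ^^ l) (ratio A B) w / fact l"
  shows "pade_good p q N \<epsilon> X K' h (b \<zeta>) \<zeta> (b z) z"
proof -
  have t: "taylor_fps \<zeta> A = taylor_fps \<zeta> B * Abs_fps (b \<zeta>)"
    unfolding b[abs_def] by (rule taylor_fps_quotient[OF B[OF \<zeta>]])
  obtain c where D: "pade_D (b \<zeta>) p q" and c: "c \<noteq> 0"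
    "jacobi_num (b \<zeta>) \<zeta> p q = Polynomial.smult c A" "jacobi_den (b \<zeta>) \<zeta> p q = Polynomial.smult c B"
    using pade_of_rational[OF cop deg A0 B[OF \<zeta>] t] by blast
  have "(ratio (Polynomial.smult c A) (Polynomial.smult c B)) = (ratio A B)"
    using c(1) by simp
  thus ?thesis
    unfolding pade_good_def Let_def c(2,3)
    using D c(1) coprime_poly_no_common_root[OF cop, of z] B[of z] \<epsilon> chord
    by (auto simp: b proj_pt_scale)
qed

text \<open>The target \<open>h\<close> is met on \<open>K s\<close> by \<open>A / B\<close>, which
  may have poles in \<open>\<Omega>\<close>. The function \<open>g\<close> obtained by pole pushing
  only inherits Taylor data on \<open>L M\<close>, and its approximants inherit the closeness to
  \<open>h\<close> from these.\<close>

lemma good_set_dense: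
  assumes f: "f \<in> Y"
  shows "\<exists>g\<in>good_set h s N. near k f g"
proof -
  define M where "M = max (Suc k) N"
  have M: "L N \<subseteq> L M" "L (Suc k) \<subseteq> L M" by (simp_all add: M_def L_mono)
  show ?thesis
  proof (cases "L M = {}")
    case True
    obtain p q where "(p, q) \<in> F" using F_unbounded by blast
    hence "f \<in> good_set h s N" using True M f by (auto simp: good_set_def pade_close_def)
    thus ?thesis using near_refl by blast
  next
    case False
    obtain A1 B1 where AB1: "\<And>n z. z \<in> L n \<Longrightarrow> poly B1 z \<noteq> 0"
      "near (Suc k) f (restrict (ratio A1 B1) \<Omega>)"
      by (rule Y_approx_rational[OF f, of "Suc k"]) blast
    \<comment> \<open>The half leaves room for two chordal errors, from \<open>A\<close> to
      \<open>A0\<close> and from \<open>A0\<close> to \<open>h\<close>; the third for three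
      derivative errors, from merging, degree adjustment and pole pushing.\<close>
    define e :: real where "e = min (1 / Suc N / 2) (1 / 2 ^ Suc k / 3)"
    have e: "e > 0" "2 * e \<le> 1 / Suc N" "3 * e \<le> 1 / 2 ^ Suc k" by (auto simp: e_def min_def field_simps)
    let ?A2 = "fst (quot_of_fract h)" and ?B2 = "snd (quot_of_fract h)"
    have nz2: "poly ?A2 z \<noteq> 0 \<or> poly ?B2 z \<noteq> 0" for z
      using coprime_poly_no_common_root[OF coprime_quot_of_fract[of h]] by blast
    obtain A0 B where A0B: "coprime A0 B" "\<And>z. z \<in> L M \<Longrightarrow> poly B z \<noteq> 0"
      "\<And>l z. l \<le> Suc k \<Longrightarrow> z \<in> L M \<Longrightarrow> cmod ((deriv ^^ l) (ratio A0 B) z -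
          (deriv ^^ l) (ratio A1 B1) z) < e"
      "\<And>z. z \<in> K s \<Longrightarrow> chordal (proj_pt (poly A0 z) (poly B z)) (proj_pt (poly ?A2 z) (poly ?B2 z)) < e"
      by (rule rational_merge[where J = "Suc k" and ?A1.0 = A1, OF compact_L False compact_K[of s] L_K_disjoint AB1(1) nz2 e(1)]) blast+
    obtain p q where pq: "(p, q) \<in> F" "degree A0 + degree B + 1 \<le> p" "degree A0 + degree B + 1 \<le> q"
      using F_unbounded by blast
    have p: "degree A0 < p" "degree B \<le> p" and q: "degree B \<le> q" using pq by auto
    obtain A where A: "coprime A B" "degree A = p"
      "\<And>l z. l \<le> Suc k \<Longrightarrow> z \<in> L M \<Longrightarrow> cmod ((deriv ^^ l) (ratio A B) z -
          (deriv ^^ l) (ratio A0 B) z) < e"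
      "\<And>z. z \<in> K s \<Longrightarrow> chordal (proj_pt (poly A z) (poly B z)) (proj_pt (poly A0 z) (poly B z)) < e"
      by (rule rational_exact_degree[where J = "Suc k", OF compact_L False compact_K[of s] A0B(1,2) p e(1)]) blast+
    have A_ne: "A \<noteq> 0" using A(2) p(1) by auto
    define b where "b w l = (deriv ^^ l) (ratio A B) w / fact l" for w l
    define J where "J = max (p + q) (max N (Suc k))"
    have chord: "chordal (proj_pt (poly A z) (poly B z)) (rat_sphere h z) < 1 / Suc N" if "z \<in> K s" for z
      using chordal_triangle[of "proj_pt (poly A z) (poly B z)" "rat_sphere h z" "proj_pt (poly A0 z) (poly B z)"]
        A(4)[OF that] A0B(4)[OF that] e(2) by (simp add: rat_sphere_eq_proj_pt)
    have cont_b: "continuous_on (L N) (\<lambda>\<zeta>. b \<zeta> l)" for l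
    proof -
      have "(ratio A B) holomorphic_on {w. poly B w \<noteq> 0}"
        by (rule holomorphic_on_quotient_poly) auto
      from holomorphic_higher_deriv[OF this open_nonroots, of l]
      have "continuous_on (L N) ((deriv ^^ l) (ratio A B))"
        using A0B(2) M(1) by (intro holomorphic_on_imp_continuous_on) (auto intro: holomorphic_on_subset)
      thus ?thesis unfolding b_def by (intro continuous_intros) auto
    qed
    obtain \<delta> where \<delta>: "\<delta> > 0" "\<And>a \<zeta> z. \<forall>\<zeta>\<in>L N. \<forall>l\<le>J. cmod (a \<zeta> l - b \<zeta> l) < \<delta> \<Longrightarrow> \<zeta> \<in> L N \<Longrightarrow> z \<in> L N \<union> K s \<Longrightarrow>
       pade_good p q N (1 / Suc N) (L N) (K s) h (a \<zeta>) \<zeta> (a z) z"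
    proof (rule pade_good_stable[of "L N" "K s" b p q N "1 / Suc N" h J])
      show "pade_good p q N (1 / Suc N) (L N) (K s) h (b \<zeta>) \<zeta> (b z) z"
        if "\<zeta> \<in> L N" "z \<in> L N \<union> K s" for \<zeta> z
        by (rule pade_good_rational[OF A(1,2) q A_ne _ that(1) _ chord b_def]) (use A0B(2) M(1) in auto)
    qed (use compact_L compact_K L_K_disjoint cont_b in \<open>auto simp: J_def\<close>)
    \<comment> \<open>\<open>\<delta>\<close> preserves the approximants, \<open>e\<close> the
      nearness to \<open>f\<close>.\<close>
    have \<delta>e: "min \<delta> e > 0" using \<delta>(1) e(1) by simp
    have hole: "\<exists>b\<in>connected_component_set (- L M) a. b \<in> - Z"
      if "a \<notin> L M" "bounded (connected_component_set (- L M) a)" for a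
      using holes[OF that] by blast
    obtain A' B' where A'B': "B' \<noteq> 0" "\<And>z. poly B' z = 0 \<Longrightarrow> z \<in> - Z - L M"
      "\<And>l z. l \<le> J \<Longrightarrow> z \<in> L M \<Longrightarrow> cmod ((deriv ^^ l) (ratio A' B') z -
        (deriv ^^ l) (ratio A B) z) < min \<delta> e"
      by (rule runge_poles[where P = "- Z" and e = "min \<delta> e" and J = J and A = A, OF compact_L False A0B(2) hole \<delta>e]) blast+
    \<comment> \<open>Although the approximation concerns \<open>L M\<close> only, the poles avoid
      \<open>Z\<close> and hence every \<open>L n\<close>; this puts \<open>g\<close> into
      \<open>Y\<close>.\<close>
    have B'nz: "poly B' z \<noteq> 0" if "z \<in> L n" for n z using A'B'(2)[of z] L_Z that by blast
    define g where "g = restrict (ratio A' B') \<Omega>"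
    have gY: "g \<in> Y" unfolding g_def by (rule rational_in_Y[OF A'B'(1)]) (rule B'nz)
    have Dg: "D g l z = (deriv ^^ l) (ratio A' B') z" if "z \<in> L n" for z l n
      unfolding g_def by (rule D_rational[OF _ that]) (rule B'nz)
    have "cmod (coeffs g \<zeta> l - b \<zeta> l) < \<delta>" if "\<zeta> \<in> L N" "l \<le> J" for \<zeta> l
    proof -
      have "coeffs g \<zeta> l - b \<zeta> l = ((deriv ^^ l) (ratio A' B') \<zeta> - (deriv ^^ l) (ratio A B) \<zeta>) / fact l"
        unfolding taylor_coeff_def b_def Dg[OF that(1)] by (simp add: diff_divide_distrib)
      hence "cmod (coeffs g \<zeta> l - b \<zeta> l) \<le> cmod ((deriv ^^ l) (ratio A' B') \<zeta> - (deriv ^^ l) (ratio A B) \<zeta>)"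
        using norm_div_fact_le by simp
      thus ?thesis using A'B'(3)[OF that(2), of \<zeta>] that(1) M(1) by auto
    qed
    hence "pade_close h s N p q g" unfolding pade_close_def using \<delta>(2)[of "coeffs g"] by blast
    hence "g \<in> good_set h s N" using gY pq(1) by (auto simp: good_set_def)
    moreover have "near (Suc k) (restrict (ratio A1 B1) \<Omega>) g"
      unfolding near_def
    proof (intro allI impI ballI)
      fix l z assume l: "l \<le> Suc k" and z: "z \<in> L (Suc k) \<inter> \<Omega>"
      have zM: "z \<in> L M" using z M(2) by blast
      have "l \<le> J" using l by (simp add: J_def)
      note c = A0B(3)[OF l zM] A(3)[OF l zM] A'B'(3)[OF \<open>l \<le> J\<close> zM]
      let ?d = "\<lambda>A B. (deriv ^^ l) (ratio A B) z"
      have tri: "cmod (x - y) \<le> cmod (y - u) + (cmod (u - v) + cmod (v - x))" for x y u v :: complex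
      proof -
        have "x - y = - ((y - u) + ((u - v) + (v - x)))" by simp
        hence "cmod (x - y) = cmod ((y - u) + ((u - v) + (v - x)))" by (simp only: norm_minus_cancel)
        thus ?thesis
          using norm_triangle_ineq[of "y - u" "(u - v) + (v - x)"] norm_triangle_ineq[of "u - v" "v - x"] by linarith
      qed
      have "cmod (?d A1 B1 - ?d A' B') \<le> cmod (?d A' B' - ?d A B) + (cmod (?d A B - ?d A0 B) + cmod (?d A0 B - ?d A1 B1))"
        by (rule tri)
      also have "\<dots> \<le> 1 / 2 ^ Suc k" using c e(3) by simp
      finally show "cmod ((deriv ^^ l) (restrict (ratio A1 B1) \<Omega>) z - (deriv ^^ l) g z) \<le> 1 / 2 ^ Suc k"
        using z by (simp add: g_def higher_deriv_restrict)
    qed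
    ultimately show ?thesis using near_triangle[OF AB1(2)] by blast
  qed
qed

section \<open>From the open conditions to the limits defining universality, and back\<close>

lemma pade_close_imp:
  assumes close: "pade_close h s n p q f" and \<zeta>: "\<zeta> \<in> L n"
  shows "pade_D (coeffs f \<zeta>) p q"
    and "pade_E (coeffs f \<zeta>) \<zeta> p q (K s \<union> L n)"
    and "\<And>l z. l \<le> n \<Longrightarrow> z \<in> L n \<Longrightarrow>
       rat_deriv_dist (pade (coeffs f \<zeta>) \<zeta> p q) l z (D f l z) < ennreal (1 / Suc n)"
    and "\<And>z. z \<in> K s \<Longrightarrow> chordal (rat_sphere (pade (coeffs f \<zeta>) \<zeta> p q) z) (rat_sphere h z) < 1 / Suc n"
proof -
  have good: "pade_good p q n (1 / Suc n) (L n) (K s) h (coeffs f \<zeta>) \<zeta> (coeffs f z) z" if "z \<in> L n \<union> K s" for z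
    using close \<zeta> that unfolding pade_close_def by blast
  show PD: "pade_D (coeffs f \<zeta>) p q" using good[of \<zeta>] \<zeta> by (simp add: pade_good_def Let_def)
  have nc: "\<not> (poly (jacobi_num (coeffs f \<zeta>) \<zeta> p q) z = 0 \<and> poly (jacobi_den (coeffs f \<zeta>) \<zeta> p q) z = 0)"
    if "z \<in> L n \<union> K s" for z using good[OF that] by (auto simp: pade_good_def Let_def)
  thus "pade_E (coeffs f \<zeta>) \<zeta> p q (K s \<union> L n)" unfolding pade_E_def by blast
  show "rat_deriv_dist (pade (coeffs f \<zeta>) \<zeta> p q) l z (D f l z) < ennreal (1 / Suc n)" if l: "l \<le> n" and z: "z \<in> L n" for l z
  proof -
    have "z \<in> L n \<union> K s" using z by simp
    note g = good[OF this] and n = nc[OF this]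
    show ?thesis
      unfolding pade_rat_deriv_dist[OF PD n]
      using g l z by (auto simp: pade_good_def Let_def taylor_coeff_def intro!: ennreal_lessI)
  qed
  show "chordal (rat_sphere (pade (coeffs f \<zeta>) \<zeta> p q) z) (rat_sphere h z) < 1 / Suc n" if z: "z \<in> K s" for z
  proof -
    have "z \<in> L n \<union> K s" using z by simp
    note g = good[OF this] and n = nc[OF this]
    show ?thesis
      unfolding pade_rat_sphere[OF PD n] using g z by (auto simp: pade_good_def Let_def)
  qed
qed

lemma pade_E_subset: "pade_E a \<zeta> p q X \<Longrightarrow> X' \<subseteq> X \<Longrightarrow> pade_E a \<zeta> p q X'"
  unfolding pade_E_def by blast

lemma pade_closeI:
  assumes "\<And>\<zeta>. \<zeta> \<in> L n \<Longrightarrow> pade_D (coeffs f \<zeta>) p q"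
    and "\<And>\<zeta>. \<zeta> \<in> L n \<Longrightarrow> pade_E (coeffs f \<zeta>) \<zeta> p q (K s \<union> L n)"
    and "\<And>\<zeta> l z. \<zeta> \<in> L n \<Longrightarrow> l \<le> n \<Longrightarrow> z \<in> L n \<Longrightarrow>
       rat_deriv_dist (pade (coeffs f \<zeta>) \<zeta> p q) l z (D f l z) < ennreal (1 / Suc n)"
    and "\<And>\<zeta> z. \<zeta> \<in> L n \<Longrightarrow> z \<in> K s \<Longrightarrow> chordal (rat_sphere (pade (coeffs f \<zeta>) \<zeta> p q) z) (rat_sphere h z) < 1 / Suc n"
  shows "pade_close h s n p q f"
  unfolding pade_close_def
proof (intro ballI)
  fix \<zeta> z assume \<zeta>: "\<zeta> \<in> L n" and z: "z \<in> L n \<union> K s"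
  let ?A = "jacobi_num (coeffs f \<zeta>) \<zeta> p q" and ?B = "jacobi_den (coeffs f \<zeta>) \<zeta> p q"
  have nc: "\<not> (poly ?A z = 0 \<and> poly ?B z = 0)" using assms(2)[OF \<zeta>] z unfolding pade_E_def by blast
  note dist = pade_rat_deriv_dist[OF assms(1)[OF \<zeta>] nc] and sph = pade_rat_sphere[OF assms(1)[OF \<zeta>] nc]
  have "poly ?B z \<noteq> 0 \<and> (\<forall>l\<le>n. cmod ((deriv ^^ l) (ratio ?A ?B) z - D f l z) < 1 / Suc n)" if "z \<in> L n"
  proof -
    have lt: "rat_deriv_dist (pade (coeffs f \<zeta>) \<zeta> p q) l z (D f l z) < ennreal (1 / Suc n)" if "l \<le> n" for l
      by (rule assms(3)[OF \<zeta> that \<open>z \<in> L n\<close>])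
    \<comment> \<open>\<open>rat_deriv_dist\<close> is infinite at a pole, so any finite bound
      excludes poles on \<open>L n\<close>.\<close>
    have B: "poly ?B z \<noteq> 0" using lt[of 0] unfolding dist by (auto split: if_splits)
    thus ?thesis using lt unfolding dist by (simp add: ennreal_less_iff)
  qed
  thus "pade_good p q n (1 / Suc n) (L n) (K s) h (coeffs f \<zeta>) \<zeta> (coeffs f z) z"
    unfolding pade_good_def Let_def
    using assms(1)[OF \<zeta>] nc assms(4)[OF \<zeta>, of z] by (auto simp: sph taylor_coeff_def)
qed

lemma SUP_tendsto_0:
  fixes u :: "nat \<Rightarrow> complex \<Rightarrow> complex \<Rightarrow> ennreal"
  assumes "\<And>n \<zeta> z. n \<ge> N \<Longrightarrow> \<zeta> \<in> X \<Longrightarrow> z \<in> X' \<Longrightarrow> u n \<zeta> z \<le> ennreal (2 / Suc n)"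
  shows "(\<lambda>n. SUP \<zeta>\<in>X. SUP z\<in>X'. u n \<zeta> z) \<longlonglongrightarrow> 0"
proof (rule tendsto_sandwich[of "\<lambda>_. 0" _ _ "\<lambda>n. ennreal (2 / Suc n)"])
  show "\<forall>\<^sub>F n in sequentially. (SUP \<zeta>\<in>X. SUP z\<in>X'. u n \<zeta> z) \<le> ennreal (2 / Suc n)"
    using assms by (intro eventually_sequentiallyI[of N] SUP_least) auto
  have "(\<lambda>n. 2 * (1 / real (Suc n))) \<longlonglongrightarrow> 2 * 0"
    using LIMSEQ_inverse_real_of_nat by (intro tendsto_intros) (simp add: inverse_eq_divide)
  hence "(\<lambda>n. 2 / real (Suc n)) \<longlonglongrightarrow> 0" by simp
  from tendsto_ennrealI[OF this] show "(\<lambda>n. ennreal (2 / Suc n)) \<longlonglongrightarrow> 0" by simp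
qed auto

lemma SUP_tendsto_0_eventually:
  fixes u :: "nat \<Rightarrow> complex \<Rightarrow> complex \<Rightarrow> ennreal"
  assumes "(\<lambda>n. SUP \<zeta>\<in>X. SUP z\<in>X'. u n \<zeta> z) \<longlonglongrightarrow> 0" "e > 0"
  shows "\<forall>\<^sub>F n in sequentially. \<forall>\<zeta>\<in>X. \<forall>z\<in>X'. u n \<zeta> z < ennreal e"
proof -
  have "\<forall>\<^sub>F n in sequentially. (SUP \<zeta>\<in>X. SUP z\<in>X'. u n \<zeta> z) < ennreal e"
    using assms by (intro order_tendstoD(2)[OF assms(1)]) simp
  thus ?thesis
  proof eventually_elim
    case (elim n)
    have "u n \<zeta> z \<le> (SUP \<zeta>\<in>X. SUP z\<in>X'. u n \<zeta> z)" if "\<zeta> \<in> X" "z \<in> X'" for \<zeta> z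
      using that by (intro SUP_upper2[of \<zeta>] SUP_upper) auto
    thus ?case using elim by (auto intro: le_less_trans)
  qed
qed

definition pade_limits :: "ratfun \<Rightarrow> nat \<Rightarrow> nat \<Rightarrow> (nat \<Rightarrow> nat) \<Rightarrow> (nat \<Rightarrow> nat) \<Rightarrow> (complex \<Rightarrow> complex) \<Rightarrow> nat \<Rightarrow> bool" where
  "pade_limits h s m p q f N \<longleftrightarrow>
     (\<forall>\<zeta>\<in>L m. \<forall>n\<ge>N. pade_D (coeffs f \<zeta>) (p n) (q n) \<and> pade_E (coeffs f \<zeta>) \<zeta> (p n) (q n) (K s \<union> L m)) \<and>
     (\<forall>l. (\<lambda>n. SUP \<zeta>\<in>L m. SUP z\<in>L m.
        rat_deriv_dist (pade (coeffs f \<zeta>) \<zeta> (p n) (q n)) l z (D f l z)) \<longlonglongrightarrow> 0) \<and>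
     (\<lambda>n. SUP \<zeta>\<in>L m. SUP z\<in>K s.
        ennreal (chordal (rat_sphere (pade (coeffs f \<zeta>) \<zeta> (p n) (q n)) z) (rat_sphere h z))) \<longlonglongrightarrow> 0"

lemma pade_universal_iff:
  "pade_universal \<Omega> L K F f \<longleftrightarrow>
     (\<forall>h s. \<exists>p q. (\<forall>n. (p n, q n) \<in> F) \<and> (\<forall>m. \<exists>N. pade_limits h s m p q f N))"
  unfolding pade_universal_def pade_limits_def ..

text \<open>Finitely many orders \<open>l \<le> N\<close> and one set \<open>L N\<close> are
  involved, so a single large index of the universal sequence meets all requirements at
  once.\<close>

lemma universal_imp_good_set:
  assumes f: "f \<in> Y" and univ: "pade_universal \<Omega> L K F f"
  shows "f \<in> good_set h s N"
proof -
  from univ obtain p q where pq: "\<And>n. (p n, q n) \<in> F" and all: "\<And>m. \<exists>N. pade_limits h s m p q f N"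
    unfolding pade_universal_iff by blast
  from all[of N] obtain N0 where lim: "pade_limits h s N p q f N0" ..
  note DE = conjunct1[OF lim[unfolded pade_limits_def], rule_format]
    and d = conjunct1[OF conjunct2[OF lim[unfolded pade_limits_def]], rule_format]
    and c = conjunct2[OF conjunct2[OF lim[unfolded pade_limits_def]]]
  have e: "1 / real (Suc N) > 0" by simp
  have "\<forall>\<^sub>F n in sequentially. \<forall>l\<in>{..N}. \<forall>\<zeta>\<in>L N. \<forall>z\<in>L N.
      rat_deriv_dist (pade (coeffs f \<zeta>) \<zeta> (p n) (q n)) l z (D f l z) < ennreal (1 / Suc N)"
    by (intro eventually_ball_finite ballI SUP_tendsto_0_eventually[OF d e]) simp
  moreover note SUP_tendsto_0_eventually[OF c e]
  moreover note eventually_ge_at_top[of N0]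
  ultimately have "\<forall>\<^sub>F n in sequentially. pade_close h s N (p n) (q n) f"
  proof eventually_elim
    case (elim n)
    show ?case
    proof (rule pade_closeI)
      show "chordal (rat_sphere (pade (coeffs f \<zeta>) \<zeta> (p n) (q n)) z) (rat_sphere h z) < 1 / Suc N" if "\<zeta> \<in> L N" "z \<in> K s" for \<zeta> z
        using elim(2) that chordal_nonneg by (simp add: ennreal_less_iff)
    qed (use elim DE in auto)
  qed
  then obtain n where "pade_close h s N (p n) (q n) f" by (auto simp: eventually_sequentially)
  thus ?thesis using f pq[of n] by (auto simp: good_set_def)
qed

text \<open>A diagonal choice: index \<open>n\<close> uses a target in \<open>H\<close> within
  \<open>1 / Suc n\<close> of \<open>h\<close> and tolerance level \<open>n\<close>, whence the
  bound \<open>2 / Suc n\<close>. The same sequence serves every \<open>m\<close>, because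
  \<open>L m \<subseteq> L n\<close> for \<open>n \<ge> m\<close>.\<close>

lemma good_set_imp_universal:
  assumes H: "\<And>h K e. compact K \<Longrightarrow> e > 0 \<Longrightarrow> \<exists>h'\<in>H. \<forall>z\<in>K. chordal (rat_sphere h' z) (rat_sphere h z) \<le> e"
    and V: "\<And>h s N. h \<in> H \<Longrightarrow> f \<in> good_set h s N"
  shows "pade_universal \<Omega> L K F f"
  unfolding pade_universal_iff
proof (intro allI)
  fix h :: ratfun and s :: nat
  have "\<exists>h'. h' \<in> H \<and> (\<forall>z\<in>K s. chordal (rat_sphere h' z) (rat_sphere h z) \<le> 1 / real (Suc n))" for n
    using H[OF compact_K, of "1 / real (Suc n)" s h] by auto
  then obtain h' where h': "\<And>n. h' n \<in> H" "\<And>n z. z \<in> K s \<Longrightarrow> chordal (rat_sphere (h' n) z) (rat_sphere h z) \<le> 1 / real (Suc n)"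
    by metis
  have "\<exists>x. x \<in> F \<and> pade_close (h' n) s n (fst x) (snd x) f" for n
    using V[OF h'(1), of n s n] by (force simp: good_set_def)
  then obtain x where x: "\<And>n. x n \<in> F" "\<And>n. pade_close (h' n) s n (fst (x n)) (snd (x n)) f" by metis
  define p q where "p n = fst (x n)" and "q n = snd (x n)" for n
  note close = pade_close_imp[OF x(2), folded p_def q_def]
  have chord: "chordal (rat_sphere (pade (coeffs f \<zeta>) \<zeta> (p n) (q n)) z) (rat_sphere h z) \<le> 2 / Suc n"
    if "\<zeta> \<in> L n" "z \<in> K s" for \<zeta> z n
    using chordal_triangle[of "rat_sphere (pade (coeffs f \<zeta>) \<zeta> (p n) (q n)) z" "rat_sphere h z" "rat_sphere (h' n) z"]
      close(4)[OF that] h'(2)[OF that(2), of n] by simp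
  show "\<exists>p q. (\<forall>n. (p n, q n) \<in> F) \<and> (\<forall>m. \<exists>N. pade_limits h s m p q f N)"
  proof (rule exI[of _ p], rule exI[of _ q], intro conjI allI)
    show "(p n, q n) \<in> F" for n using x(1) by (simp add: p_def q_def)
    fix m
    have up: "w \<in> L n" if "w \<in> L m" "n \<ge> m" for w n using that L_mono by blast
    show "\<exists>N. pade_limits h s m p q f N"
      unfolding pade_limits_def
    proof (intro exI[of _ m] conjI ballI allI impI)
      fix \<zeta> n assume \<zeta>: "\<zeta> \<in> L m" and n: "n \<ge> m"
      show "pade_D (coeffs f \<zeta>) (p n) (q n)" using close(1)[OF up[OF \<zeta> n]] .
      show "pade_E (coeffs f \<zeta>) \<zeta> (p n) (q n) (K s \<union> L m)"
        using L_mono[OF n] by (intro pade_E_subset[OF close(2)[OF up[OF \<zeta> n]]]) auto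
    next
      fix l
      show "(\<lambda>n. SUP \<zeta>\<in>L m. SUP z\<in>L m.
            rat_deriv_dist (pade (coeffs f \<zeta>) \<zeta> (p n) (q n)) l z (D f l z)) \<longlonglongrightarrow> 0"
      proof (rule SUP_tendsto_0[of "max m l"])
        fix n \<zeta> z assume n: "n \<ge> max m l" and \<zeta>: "\<zeta> \<in> L m" and z: "z \<in> L m"
        have "rat_deriv_dist (pade (coeffs f \<zeta>) \<zeta> (p n) (q n)) l z (D f l z) < ennreal (1 / Suc n)"
          using n by (intro close(3)[OF up[OF \<zeta>] _ up[OF z]]) auto
        also have "\<dots> \<le> ennreal (2 / Suc n)" by (intro ennreal_leI divide_right_mono) auto
        finally show "rat_deriv_dist (pade (coeffs f \<zeta>) \<zeta> (p n) (q n)) l z (D f l z) \<le> ennreal (2 / Suc n)" by simp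
      qed
    next
      show "(\<lambda>n. SUP \<zeta>\<in>L m. SUP z\<in>K s.
            ennreal (chordal (rat_sphere (pade (coeffs f \<zeta>) \<zeta> (p n) (q n)) z) (rat_sphere h z))) \<longlonglongrightarrow> 0"
        by (rule SUP_tendsto_0[of m]) (intro ennreal_leI chord[OF up])
    qed
  qed
qed

lemma zero_in_Y: "restrict (\<lambda>_. 0) \<Omega> \<in> Y"
  using rational_in_Y[of 1 0] by simp

text \<open>The universal functions are exactly the intersection of the open dense sets
  \<open>good_set h s N\<close> with \<open>h\<close> in the countable family \<open>H\<close>.
  Enumerating the triples makes this a sequence for \<open>baire_Y\<close>.\<close>

lemma universal_generic:
  "(\<exists>f \<in> Y. pade_universal \<Omega> L K F f) \<and>
    Y_topology \<Omega> L closure_of {f \<in> Y. pade_universal \<Omega> L K F f} = Y \<and>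
    gdelta_in (Y_topology \<Omega> L) {f \<in> Y. pade_universal \<Omega> L K F f}"
proof -
  obtain H :: "ratfun set" where H: "countable H" "H \<noteq> {}"
    "\<And>h K e. compact K \<Longrightarrow> e > 0 \<Longrightarrow> \<exists>h'\<in>H. \<forall>z\<in>K. chordal (rat_sphere h' z) (rat_sphere h z) \<le> e"
    by (rule countable_dense_ratfuns) blast
  let ?U = "{f \<in> Y. pade_universal \<Omega> L K F f}"
  let ?I = "H \<times> (UNIV :: nat set) \<times> (UNIV :: nat set)"
  define W where "W = (\<lambda>(h, s, N). good_set h s N)"
  have cI: "countable ?I" "?I \<noteq> {}" using H by auto
  define W' where "W' i = W (from_nat_into ?I i)" for i
  have range: "range W' = W ` ?I" unfolding W'_def using range_from_nat_into[OF cI(2,1)] by (metis image_image)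
  have U_eq: "?U = (\<Inter>i. W' i)"
  proof -
    have "(\<Inter>i. W' i) = (\<Inter>x\<in>?I. W x)" using range by simp
    also have "\<dots> = ?U"
    proof (intro equalityI subsetI)
      fix f assume "f \<in> (\<Inter>x\<in>?I. W x)"
      hence V: "f \<in> good_set h s N" if "h \<in> H" for h s N using that by (auto simp: W_def)
      have "pade_universal \<Omega> L K F f" by (rule good_set_imp_universal[OF H(3) V])
      moreover have "f \<in> Y" using V H(2) by (auto simp: good_set_def)
      ultimately show "f \<in> ?U" by simp
    next
      fix f assume "f \<in> ?U"
      thus "f \<in> (\<Inter>x\<in>?I. W x)" using universal_imp_good_set by (auto simp: W_def)
    qed
    finally show ?thesis by simp
  qed
  have op: "openin (Y_topology \<Omega> L) (W' i)" for i
    unfolding W'_def W_def using openin_good_set by (simp add: case_prod_beta)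
  have dense: "\<exists>g\<in>W' i. near k f g" if "f \<in> Y" for f i k
    unfolding W'_def W_def using good_set_dense[OF that] by (simp add: case_prod_beta)
  have approx: "\<exists>g\<in>?U. near k f g" if f: "f \<in> Y" for f k
  proof -
    show ?thesis
    proof (rule baire_Y[of W' f k, OF op dense f])
      fix g assume "g \<in> Y" "near k f g" "\<And>i. g \<in> W' i"
      thus ?thesis unfolding U_eq by blast
    qed
  qed
  have "Y_topology \<Omega> L closure_of ?U = Y" by (rule closure_Y_eqI) (use approx in auto)
  moreover have "gdelta_in (Y_topology \<Omega> L) ?U"
    unfolding U_eq by (intro gdelta_in_Inter) (auto intro: open_imp_gdelta_in op)
  moreover have "\<exists>f\<in>Y. pade_universal \<Omega> L K F f" using approx[OF zero_in_Y] by blast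
  ultimately show ?thesis by blast
qed

end

theorem theorem3p2:
  fixes \<Omega> :: "complex set"
    and L K :: "nat \<Rightarrow> complex set"
    and F :: "(nat \<times> nat) set"
  assumes "open \<Omega>"
    and "incseq L"
    and "\<And>n. compact (L n)"
    and "\<And>n. L n \<subseteq> closure \<Omega>"
    and "\<And>n. closure (L n \<inter> \<Omega>) = L n"
    and "\<And>n. \<forall>C \<in> sphere_components (sphere_compl (L n)).
           \<exists>D \<in> sphere_components (sphere_compl (closure \<Omega>)). D \<subseteq> C"
    and "\<And>C. compact C \<Longrightarrow> C \<subseteq> \<Omega> \<Longrightarrow> \<exists>n. C \<subseteq> L n"
    and "\<And>r. compact (K r)"
    and "\<And>r n. K r \<inter> L n = {}"
    and "\<exists>p q :: nat \<Rightarrow> nat. (\<forall>n. (p n, q n) \<in> F) \<and>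
           filterlim p at_top sequentially \<and> filterlim q at_top sequentially"
  shows "(\<exists>f \<in> Y_space \<Omega> L. pade_universal \<Omega> L K F f) \<and>
    Y_topology \<Omega> L closure_of {f \<in> Y_space \<Omega> L. pade_universal \<Omega> L K F f} = Y_space \<Omega> L \<and>
    gdelta_in (Y_topology \<Omega> L) {f \<in> Y_space \<Omega> L. pade_universal \<Omega> L K F f}"
proof -
  have "\<exists>p q. (p, q) \<in> F \<and> N \<le> p \<and> N \<le> q" for N
  proof -
    obtain p q :: "nat \<Rightarrow> nat" where pq: "\<And>n. (p n, q n) \<in> F"
      "filterlim p at_top sequentially" "filterlim q at_top sequentially" using assms(10) by blast
    have "\<forall>\<^sub>F n in sequentially. N \<le> p n \<and> N \<le> q n"
      using pq(2,3) by (auto simp: filterlim_at_top eventually_conj_iff)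
    then obtain n where "N \<le> p n \<and> N \<le> q n" by (auto simp: eventually_sequentially)
    thus ?thesis using pq(1) by blast
  qed
  moreover have "\<exists>b\<in>connected_component_set (- L n) a. b \<notin> closure \<Omega>"
    if "a \<notin> L n" "bounded (connected_component_set (- L n) a)" for n a
    using sphere_hole[OF assms(3) that assms(6)] .
  ultimately interpret pade_setting \<Omega> L K F "closure \<Omega>"
    using assms(1-5,7-9) by unfold_locales (auto simp: Int_commute)
  show ?thesis by (rule universal_generic)
qed

end
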